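(* Every connected conic singular sub-manifold $X$ of $\mathbb R^n$ is Lipschitz normally embedded (LNE) in $\mathbb R^n$ (with its Euclidean metric).
   Context: Smooth means $C^\infty$. **LNE.** For $S\subset\mathbb R^n$, the inner distance $d^S_{\rm in}(x,x')\in[0,+\infty]$ is the infimum of the lengths of rectifiable paths lying in $S$ joining $x$ and $x'$. The set $S$ is LNE if there is a constant $L>0$ with $d^S_{\rm in}(x,x')\le L|x-x'|$ for all $x,x'\in S$. **Sub-manifolds.** Sub-manifolds are embedded (manifold topology equal to the induced topology, inclusion a smooth injective immersion); different connected components may have different dimensions. Unless a boundary is mentioned, sub-manifolds have no boundary. A subset $N$ of a smooth manifold with boundary $(P,\partial P)$ is a p-sub-manifold of $P$ if it is a smooth sub-manifold with (possibly empty) boundary $\partial N$, with $\partial N=N\cap\partial P$, and $T_xN+T_x\partial P=T_xP$ for every $x\in\partial N$. **Conic points.** For $a\in\mathbb R^n$, let $[\mathbb R^n,a]=[0,\infty)\times\mathbb S^{n-1}$ and $\mathrm{bl}_a:[\mathbb R^n,a]\to\mathbb R^n$, $(r,u)\mapsto ru+a$. The strict transform of $S\subset \mathbb R^n$ is $[S,a]=\mathrm{clos}(\mathrm{bl}_a^{-1}(S\setminus a))$. Let $X\subset\mathbb R^n$ have non-empty and closed germ at $a$. The point $a$ is a conic point of $X$ if there is $r>0$ such that the strict transform of $X\cap\{|x-a|<r\}$, taken inside $[0,r)\times\mathbb S^{n-1}$, is a closed subset and a p-sub-manifold of $[0,r)\times\mathbb S^{n-1}$. **Conic at infinity.** Let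 $\overline{\mathbf M}=[0,\infty)\times\mathbb S^{n-1}$ and let $\beta:(0,\infty)\times\mathbb S^{n-1}\to\mathbb R^n\setminus 0$, $\beta(r,u)=u/r$. The space $\overline{\mathbb R^n}$ is the compactification of $\mathbb R^n$ as a manifold with boundary obtained by identifying $\mathbb R^n\setminus 0$ with the interior of $\overline{\mathbf M}$ via $\beta$; its boundary is the sphere at infinity $0\times\mathbb S^{n-1}$. For $X\subset\mathbb R^n$, let $\overline X$ be its closure in $\overline{\mathbb R^n}$ and let $0\times X^\infty=\overline X\cap(0\times\mathbb S^{n-1})$. The set $X$ is conic at $\infty$ if either $X$ is bounded, or the germ of $\overline X$ along $0\times X^\infty$ is non-empty and is the germ of a smooth p-sub-manifold of $\overline{\mathbb R^n}$. **Conic singular sub-manifolds of $\mathbb R^n$.** A point of $X$ is singular if the germ of $X$ at this point is not the germ of a smooth sub-manifold; $X_{\rm sing}$ is the set of singular points. A subset $X$ of $\mathbb R^n$ is a conic singular sub-manifold of $\mathbb R^n$ if (i) it is closed; (ii) $X_{\rm sing}$ is finite or empty; (iii) each point of $X_{\rm sing}$ is a conic point of $X$; (iv) $X$ is conic at $\infty$. *)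

theory Defs
  imports "HOL-Analysis.Analysis"
begin

section \<open>Lipschitz normal embedding\<close>

definition path_length :: "(real \<Rightarrow> 'a::metric_space) \<Rightarrow> ereal" where
  "path_length g =
     (SUP ts\<in>{ts. sorted ts \<and> set ts \<subseteq> {0..1}}.
        ereal (\<Sum>i<length ts - 1. dist (g (ts ! i)) (g (ts ! Suc i))))"

definition rectifiable :: "(real \<Rightarrow> 'a::metric_space) \<Rightarrow> bool" where
  "rectifiable g \<longleftrightarrow> path g \<and> path_length g < \<infinity>"

(* The infimum over the empty set is \<infinity>. *)
definition inner_dist :: "'a::metric_space set \<Rightarrow> 'a \<Rightarrow> 'a \<Rightarrow> ereal" where
  "inner_dist S x y =
     Inf {path_length g |g. rectifiable g \<and> path_image g \<subseteq> S \<and> pathstart g = x \<and> pathfinish g = y}"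

definition LNE :: "'a::metric_space set \<Rightarrow> bool" where
  "LNE S \<longleftrightarrow> (\<exists>L>0. \<forall>x\<in>S. \<forall>y\<in>S. inner_dist S x y \<le> ereal (L * dist x y))"


section \<open>Smooth maps\<close>

primrec times_differentiable_on ::
  "nat \<Rightarrow> ('a::real_normed_vector \<Rightarrow> 'b::real_normed_vector) \<Rightarrow> 'a set \<Rightarrow> bool" where
  "times_differentiable_on 0 f U \<longleftrightarrow> continuous_on U f"
| "times_differentiable_on (Suc k) f U \<longleftrightarrow>
     (\<forall>x\<in>U. f differentiable (at x)) \<and>
     (\<forall>v. times_differentiable_on k (\<lambda>x. frechet_derivative f (at x) v) U)"

(* To be used for open U only. *)
definition smooth_on :: "('a::real_normed_vector \<Rightarrow> 'b::real_normed_vector) \<Rightarrow> 'a set \<Rightarrow> bool" where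
  "smooth_on f U \<longleftrightarrow> (\<forall>k. times_differentiable_on k f U)"


section \<open>Embedded sub-manifolds with boundary of a Euclidean space\<close>

(* Model spaces. The Euclidean space of dimension k is represented by a k-dimensional linear
   subspace E of the ambient space. For b in E, chart_dom E b V is an open piece of E if b = 0,
   and an open piece of the closed half-space of E with inner normal b otherwise. *)
definition chart_dom :: "'a::euclidean_space set \<Rightarrow> 'a \<Rightarrow> 'a set \<Rightarrow> 'a set" where
  "chart_dom E b V = {p \<in> V \<inter> E. 0 \<le> b \<bullet> p}"

(* f is the inverse of a chart of N: a homeomorphism onto a subset of N that is open for the
   induced topology, and (the inclusion of N read in this chart) a smooth immersion. As usual,
   smoothness on a half-space means having a smooth extension to an open set, here V. Changes of
   charts are then automatically smooth. *)
definition local_param ::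
  "'a::euclidean_space set \<Rightarrow> 'a set \<Rightarrow> 'a \<Rightarrow> 'a set \<Rightarrow> ('a \<Rightarrow> 'a) \<Rightarrow> bool" where
  "local_param N E b V f \<longleftrightarrow>
     subspace E \<and> b \<in> E \<and> open V \<and> smooth_on f V \<and>
     (\<forall>p\<in>chart_dom E b V. inj_on (frechet_derivative f (at p)) E) \<and>
     openin (top_of_set N) (f ` chart_dom E b V) \<and>
     (\<exists>g. homeomorphism (chart_dom E b V) (f ` chart_dom E b V) f g)"

(* The subspace E may depend on the point, so the components of N may have different dimensions. *)
definition submanifold_with_boundary :: "'a::euclidean_space set \<Rightarrow> bool" where
  "submanifold_with_boundary N \<longleftrightarrow>
     (\<forall>x\<in>N. \<exists>E b V f. local_param N E b V f \<and> x \<in> f ` chart_dom E b V)"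

definition mfd_boundary :: "'a::euclidean_space set \<Rightarrow> 'a set" where
  "mfd_boundary N =
     {f p |E b V f p. local_param N E b V f \<and> p \<in> chart_dom E b V \<and> b \<noteq> 0 \<and> b \<bullet> p = 0}"

definition submanifold :: "'a::euclidean_space set \<Rightarrow> bool" where
  "submanifold N \<longleftrightarrow> submanifold_with_boundary N \<and> mfd_boundary N = {}"

(* At a boundary point this is the full tangent space, not only the inward half of it. *)
definition tangent_space :: "'a::euclidean_space set \<Rightarrow> 'a \<Rightarrow> 'a set" where
  "tangent_space N x =
     {frechet_derivative f (at p) v |E b V f p v.
        local_param N E b V f \<and> p \<in> chart_dom E b V \<and> f p = x \<and> v \<in> E}"

(* P is meant to be an embedded sub-manifold with boundary of a Euclidean space, so that the
   sub-manifolds of P are those of the Euclidean space that are contained in P. *)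
definition p_submanifold :: "'a::euclidean_space set \<Rightarrow> 'a set \<Rightarrow> bool" where
  "p_submanifold N P \<longleftrightarrow>
     N \<subseteq> P \<and> submanifold_with_boundary N \<and>
     mfd_boundary N = N \<inter> mfd_boundary P \<and>
     (\<forall>x\<in>mfd_boundary N.
        {v + w |v w. v \<in> tangent_space N x \<and> w \<in> tangent_space (mfd_boundary P) x}
          = tangent_space P x)"


section \<open>Germs along a subset\<close>

definition same_germ :: "'a::topological_space set \<Rightarrow> 'a set \<Rightarrow> 'a set \<Rightarrow> bool" where
  "same_germ A S T \<longleftrightarrow> (\<exists>W. open W \<and> A \<subseteq> W \<and> S \<inter> W = T \<inter> W)"

definition nonempty_germ :: "'a::topological_space set \<Rightarrow> 'a set \<Rightarrow> bool" where
  "nonempty_germ A S \<longleftrightarrow> (\<forall>W. open W \<and> A \<subseteq> W \<longrightarrow> S \<inter> W \<noteq> {})"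

definition closed_germ :: "'a::topological_space set \<Rightarrow> 'a set \<Rightarrow> bool" where
  "closed_germ A S \<longleftrightarrow> (\<exists>W. open W \<and> A \<subseteq> W \<and> closedin (top_of_set W) (S \<inter> W))"


section \<open>Conic points\<close>

definition blowdown :: "'a::euclidean_space \<Rightarrow> real \<times> 'a \<Rightarrow> 'a" where
  "blowdown a = (\<lambda>(r, u). r *\<^sub>R u + a)"

definition blowup_space :: "(real \<times> 'a::euclidean_space) set" where
  "blowup_space = {0..} \<times> sphere 0 1"

(* The blown-up space is closed in the product, so the closure may be taken there. *)
definition strict_transform :: "'a::euclidean_space set \<Rightarrow> 'a \<Rightarrow> (real \<times> 'a) set" where
  "strict_transform S a = closure {z \<in> blowup_space. blowdown a z \<in> S - {a}}"

definition conic_point :: "'a::euclidean_space set \<Rightarrow> 'a \<Rightarrow> bool" where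
  "conic_point X a \<longleftrightarrow>
     nonempty_germ {a} X \<and> closed_germ {a} X \<and>
     (\<exists>r>0. let P = {0..<r} \<times> sphere 0 1;
                N = strict_transform (X \<inter> ball a r) a \<inter> P
            in closedin (top_of_set P) N \<and> p_submanifold N P)"


section \<open>Conic at infinity\<close>

(* The collar [0,\<infinity>) x sphere is the compactification of the Euclidean space minus the origin. Only
   germs along the boundary at infinity are considered, hence the origin can be disregarded. *)
definition infinity_collar :: "(real \<times> 'a::euclidean_space) set" where
  "infinity_collar = {0..} \<times> sphere 0 1"

definition infinity_chart :: "real \<times> 'a::euclidean_space \<Rightarrow> 'a" where
  "infinity_chart = (\<lambda>(r, u). (1 / r) *\<^sub>R u)"

definition closure_at_infinity :: "'a::euclidean_space set \<Rightarrow> (real \<times> 'a) set" where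
  "closure_at_infinity X = closure {z \<in> {0<..} \<times> sphere 0 1. infinity_chart z \<in> X}"

definition asymptotic_set :: "'a::euclidean_space set \<Rightarrow> 'a set" where
  "asymptotic_set X = {u \<in> sphere 0 1. (0, u) \<in> closure_at_infinity X}"

definition conic_at_infinity :: "'a::euclidean_space set \<Rightarrow> bool" where
  "conic_at_infinity X \<longleftrightarrow>
     bounded X \<or>
     (nonempty_germ ({0} \<times> asymptotic_set X) (closure_at_infinity X) \<and>
      (\<exists>N. p_submanifold N infinity_collar \<and>
           same_germ ({0} \<times> asymptotic_set X) (closure_at_infinity X) N))"


section \<open>Conic singular sub-manifolds\<close>

definition singular_points :: "'a::euclidean_space set \<Rightarrow> 'a set" where
  "singular_points X = {x \<in> X. \<not> (\<exists>N. submanifold N \<and> same_germ {x} X N)}"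

definition conic_singular_submanifold :: "'a::euclidean_space set \<Rightarrow> bool" where
  "conic_singular_submanifold X \<longleftrightarrow>
     closed X \<and> finite (singular_points X) \<and>
     (\<forall>a\<in>singular_points X. conic_point X a) \<and>
     conic_at_infinity X"

end

theory Submission
  imports Defs
begin

text \<open>
  Two points of \<open>X\<close> at distance \<open>\<delta>\<close> have to be joined inside \<open>X\<close> by a curve of length at most
  \<open>C * \<delta>\<close>, with \<open>C\<close> independent of the points. The problem is local on \<open>X\<close> and at infinity. If every
  point of \<open>X\<close> has a neighbourhood with such a constant, then connectedness makes all inner distances
  finite, compactness bounds them on bounded parts of \<open>X\<close>, and a Lebesgue number gives one
  constant for each bounded part (\<open>joinable_on_bounded\<close>). What remains is the behaviour at smooth
  points, at conic points and near infinity.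

  At a smooth point the image of a straight segment under a chart does it, since a chart is
  bi-Lipschitz near a point (\<open>joinable_near_smooth_point\<close>).

  Near a conic point or near infinity, write the points of \<open>X\<close> as \<open>r u + a\<close>, respectively \<open>u / r\<close>, with
  \<open>u\<close> a unit vector and \<open>r\<close> small. Then \<open>(r, u)\<close> runs through a p-sub-manifold \<open>N\<close> of a collar
  \<open>[0, t) \<times> sphere\<close>. Take a chart of \<open>N\<close> at a point with \<open>r = 0\<close>, defined on a half-space, and let \<open>h\<close> be
  the distance to the boundary of the half-space. Transversality makes the normal derivative of the
  function \<open>r\<close> positive, so \<open>r\<close> is comparable with \<open>h\<close>; and since \<open>r\<close> vanishes for \<open>h = 0\<close>, its
  derivative in a direction \<open>w\<close> parallel to the boundary is \<open>O(h |w|)\<close>. Consequently the segment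
  between two points of the chart is short not only for \<open>|dr| + |du|\<close> but even for the metric
  \<open>|dr| / r + |du|\<close> of the cylinder, as long as the end points are close in the latter
  (\<open>near_segment\<close>). Multiplying by \<open>r\<close> gives the Euclidean metric of the cone, multiplying by \<open>1 / r\<close>
  gives the one near infinity; so one estimate serves both cases. Two points that are not close in
  the cylinder metric have a Euclidean distance comparable with their distances to \<open>a\<close>,
  respectively to the origin. They are joined through the apex \<open>a\<close>, respectively through a fixed base point
  reached by first moving inwards (\<open>joinable_cone\<close>, \<open>joinable_end\<close>). Compactness of the sphere
  of directions makes the constants uniform (\<open>uniform_over_directions\<close>), and points with well
  separated directions are again joined through the apex or the base point
  (\<open>joinable_all_directions\<close>).

  That charts of \<open>N\<close> have this form (\<open>p_submanifold_boundary_chart\<close>) depends on the fact that the boundary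
  of the collar is exactly \<open>0 \<times> sphere\<close>. One inclusion needs an explicit chart, for which
  stereographic projection is used because it is rational, hence visibly smooth; the other one is
  invariance of domain.
\<close>

section \<open>Joining points by Lipschitz curves\<close>

text \<open>
  Bounds on inner distances are carried by parametrized Lipschitz curves: they can be concatenated and
  transported by Lipschitz maps without subdividing partitions, and the Lipschitz constant on
  \<open>{0..1}\<close> bounds the length.
\<close>

definition joinable :: "'a::metric_space set \<Rightarrow> 'a \<Rightarrow> 'a \<Rightarrow> real \<Rightarrow> bool" where
  "joinable X x y L \<longleftrightarrow>
     (\<exists>g :: real \<Rightarrow> _. L-lipschitz_on {0..1} g \<and> g ` {0..1} \<subseteq> X \<and> g 0 = x \<and> g 1 = y)"

lemma joinableE:
  assumes "joinable X x y L"
  obtains g :: "real \<Rightarrow> 'a::metric_space" where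
    "L-lipschitz_on {0..1} g" "g ` {0..1} \<subseteq> X" "g 0 = x" "g 1 = y"
  using assms unfolding joinable_def by (elim exE conjE) (rule that)

lemma joinable_mono: "joinable X x y L \<Longrightarrow> L \<le> M \<Longrightarrow> joinable X x y M"
  unfolding joinable_def using lipschitz_on_le by metis

lemma joinable_nonneg: "joinable X x y L \<Longrightarrow> 0 \<le> L"
  unfolding joinable_def by (meson lipschitz_on_nonneg)

lemma joinable_refl: "x \<in> X \<Longrightarrow> 0 \<le> L \<Longrightarrow> joinable X x x L"
  unfolding joinable_def by (intro exI[of _ "\<lambda>_. x"]) (auto simp: lipschitz_on_def)

lemma joinable_lipschitz_on:
  fixes g :: "real \<Rightarrow> 'a::metric_space"
  assumes g: "C-lipschitz_on {a..b} g" and X: "g ` {a..b} \<subseteq> X" and "a \<le> b" and L: "C * (b - a) \<le> L"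
  shows "joinable X (g a) (g b) L"
proof -
  have C: "0 \<le> C" using g lipschitz_on_nonneg by blast
  have in_ab: "a + t * (b - a) \<in> {a..b}" if "t \<in> {0..1}" for t
    using that \<open>a \<le> b\<close> mult_right_mono[of t 1 "b - a"] by auto
  have "(C * (b - a))-lipschitz_on {0..1} (\<lambda>t. g (a + t * (b - a)))"
  proof (rule lipschitz_onI)
    fix s t :: real assume st: "s \<in> {0..1}" "t \<in> {0..1}"
    have "dist (g (a + s * (b - a))) (g (a + t * (b - a)))
        \<le> C * dist (a + s * (b - a)) (a + t * (b - a))"
      using lipschitz_onD[OF g in_ab[OF st(1)] in_ab[OF st(2)]] .
    also have "dist (a + s * (b - a)) (a + t * (b - a)) = (b - a) * dist s t"
      using \<open>a \<le> b\<close> by (simp add: dist_real_def flip: left_diff_distrib abs_mult)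
        (simp add: abs_mult)
    finally show "dist (g (a + s * (b - a))) (g (a + t * (b - a))) \<le> C * (b - a) * dist s t"
      by (simp add: mult.assoc)
  qed (use C \<open>a \<le> b\<close> in auto)
  then have "joinable X (g a) (g b) (C * (b - a))"
    unfolding joinable_def using X in_ab
    by (intro exI[of _ "\<lambda>t. g (a + t * (b - a))"]) auto
  then show ?thesis using L joinable_mono by blast
qed

lemma joinable_sym:
  fixes x y :: "'a::metric_space"
  assumes xy: "joinable X x y L"
  shows "joinable X y x L"
proof -
  obtain g :: "real \<Rightarrow> 'a" where g: "L-lipschitz_on {0..1} g" "g ` {0..1} \<subseteq> X" "g 0 = x" "g 1 = y"
    using joinableE[OF xy] by metis
  have "L-lipschitz_on {0..1} (\<lambda>t. g (1 - t))"
  proof (rule lipschitz_onI)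
    fix s t :: real assume "s \<in> {0..1}" "t \<in> {0..1}"
    then show "dist (g (1 - s)) (g (1 - t)) \<le> L * dist s t"
      using lipschitz_onD[OF g(1), of "1 - s" "1 - t"] by (simp add: dist_real_def abs_minus_commute)
  qed (rule lipschitz_on_nonneg[OF g(1)])
  then show ?thesis
    unfolding joinable_def using g by (intro exI[of _ "\<lambda>t. g (1 - t)"]) auto
qed

text \<open>
  Both curves are slowed down to unit speed and run one after the other on \<open>{0..L + M}\<close>; if one of the
  bounds is 0, that curve is constant.
\<close>

lemma joinable_trans:
  fixes x y z :: "'a::metric_space"
  assumes xy: "joinable X x y L" and yz: "joinable X y z M"
  shows "joinable X x z (L + M)"
proof -
  obtain g :: "real \<Rightarrow> 'a" where g: "L-lipschitz_on {0..1} g" "g ` {0..1} \<subseteq> X" "g 0 = x" "g 1 = y"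
    using joinableE[OF xy] by metis
  obtain h :: "real \<Rightarrow> 'a" where h: "M-lipschitz_on {0..1} h" "h ` {0..1} \<subseteq> X" "h 0 = y" "h 1 = z"
    using joinableE[OF yz] by metis
  have nonneg: "0 \<le> L" "0 \<le> M" using xy yz joinable_nonneg by blast+
  show ?thesis
  proof (cases "L = 0 \<or> M = 0")
    case True
    then have "x = y \<or> y = z"
      using lipschitz_onD[OF g(1), of 0 1] lipschitz_onD[OF h(1), of 0 1] g h by auto
    then show ?thesis
    proof
      assume "x = y"
      then show ?thesis using yz nonneg by (auto intro: joinable_mono[of _ _ _ M])
    next
      assume "y = z"
      then show ?thesis using xy nonneg by (auto intro: joinable_mono[of _ _ _ L])
    qed
  next
    case False
    then have pos: "0 < L" "0 < M" using nonneg by auto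
    let ?k = "\<lambda>t. if t \<le> L then g (t / L) else h ((t - L) / M)"
    have "1-lipschitz_on {0..L + M} ?k"
    proof (rule lipschitz_on_concat[where b = L])
      show "1-lipschitz_on {0..L} (\<lambda>t. g (t / L))"
      proof (rule lipschitz_onI)
        fix s t assume st: "s \<in> {0..L}" "t \<in> {0..L}"
        have "dist (g (s / L)) (g (t / L)) \<le> L * dist (s / L) (t / L)"
          using st pos by (intro lipschitz_onD[OF g(1)]) auto
        also have "\<dots> = 1 * dist s t"
          using pos by (simp add: dist_real_def abs_divide flip: diff_divide_distrib)
        finally show "dist (g (s / L)) (g (t / L)) \<le> 1 * dist s t" .
      qed simp
      show "1-lipschitz_on {L..L + M} (\<lambda>t. h ((t - L) / M))"
      proof (rule lipschitz_onI)
        fix s t assume st: "s \<in> {L..L + M}" "t \<in> {L..L + M}"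
        have "dist (h ((s - L) / M)) (h ((t - L) / M)) \<le> M * dist ((s - L) / M) ((t - L) / M)"
          using st pos by (intro lipschitz_onD[OF h(1)]) auto
        also have "\<dots> = 1 * dist s t"
          using pos by (simp add: dist_real_def abs_divide flip: diff_divide_distrib)
        finally show "dist (h ((s - L) / M)) (h ((t - L) / M)) \<le> 1 * dist s t" .
      qed simp
    qed (use pos g h in auto)
    moreover have "?k ` {0..L + M} \<subseteq> X"
      using g(2) h(2) pos by (auto simp: image_subset_iff)
    ultimately have "joinable X (?k 0) (?k (L + M)) (L + M)"
      using pos by (intro joinable_lipschitz_on) auto
    then show ?thesis using g h pos by simp
  qed
qed

text \<open>
  The sum over a partition is at most \<open>L\<close> times a telescoping sum of parameter differences.
\<close>

lemma path_length_le_lipschitz: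
  assumes g: "L-lipschitz_on {0..1} g"
  shows "path_length g \<le> ereal L"
  unfolding path_length_def
proof (rule SUP_least)
  fix ts :: "real list" assume "ts \<in> {ts. sorted ts \<and> set ts \<subseteq> {0..1}}"
  then have ts: "sorted ts" "set ts \<subseteq> {0..1}" by auto
  have L: "0 \<le> L" using g lipschitz_on_nonneg by blast
  show "ereal (\<Sum>i<length ts - 1. dist (g (ts ! i)) (g (ts ! Suc i))) \<le> ereal L"
  proof (cases "ts = []")
    case False
    have in01: "ts ! i \<in> {0..1}" if "i < length ts" for i
      using ts(2) that nth_mem by blast
    have "(\<Sum>i<length ts - 1. dist (g (ts ! i)) (g (ts ! Suc i)))
        \<le> (\<Sum>i<length ts - 1. L * (ts ! Suc i - ts ! i))"
    proof (rule sum_mono)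
      fix i assume "i \<in> {..<length ts - 1}"
      then have i: "i < length ts" "Suc i < length ts" by auto
      then have "ts ! i \<le> ts ! Suc i" using ts(1) by (simp add: sorted_nth_mono)
      then show "dist (g (ts ! i)) (g (ts ! Suc i)) \<le> L * (ts ! Suc i - ts ! i)"
        using lipschitz_onD[OF g in01[OF i(1)] in01[OF i(2)]] by (simp add: dist_real_def)
    qed
    also have "\<dots> = L * (ts ! (length ts - 1) - ts ! 0)"
      by (simp only: sum_distrib_left[symmetric] sum_lessThan_telescope[of "\<lambda>i. ts ! i"])
    also have "\<dots> \<le> L * 1"
      using in01[of 0] in01[of "length ts - 1"] False L
      by (intro mult_left_mono) auto
    finally show ?thesis by simp
  qed (use L in simp)
qed

lemma inner_dist_le_joinable:
  fixes x y :: "'a::metric_space"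
  assumes "joinable X x y L"
  shows "inner_dist X x y \<le> ereal L"
proof -
  obtain g :: "real \<Rightarrow> 'a" where g: "L-lipschitz_on {0..1} g" "g ` {0..1} \<subseteq> X" "g 0 = x" "g 1 = y"
    using joinableE[OF assms] by metis
  have len: "path_length g \<le> ereal L" using path_length_le_lipschitz[OF g(1)] .
  then have "rectifiable g"
    unfolding rectifiable_def path_def
    using lipschitz_on_continuous_on[OF g(1)] by auto
  then have "inner_dist X x y \<le> path_length g"
    unfolding inner_dist_def using g
    by (intro Inf_lower) (auto simp: path_image_def pathstart_def pathfinish_def)
  with len show ?thesis by order
qed

text \<open>
  A finite subcover gives the constant, a Lebesgue number of that subcover gives \<open>e\<close>. This
  is used for the sphere of directions as well as for bounded parts of \<open>X\<close>.
\<close>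

lemma uniform_constant_on_compact:
  fixes K :: "'a::heine_borel set" and P :: "real \<Rightarrow> 'a \<Rightarrow> 'a \<Rightarrow> bool"
  assumes K: "compact K"
    and mono: "\<And>C C' x y. P C x y \<Longrightarrow> C \<le> C' \<Longrightarrow> P C' x y"
    and loc: "\<And>x. x \<in> K \<Longrightarrow>
      \<exists>U C. open U \<and> x \<in> U \<and> (\<forall>y\<in>K \<inter> U. \<forall>z\<in>K \<inter> U. P C y z)"
  shows "\<exists>e>0. \<exists>C. \<forall>y\<in>K. \<forall>z\<in>K. dist y z < e \<longrightarrow> P C y z"
proof -
  obtain U C where U: "\<And>x. x \<in> K \<Longrightarrow> open (U x) \<and> x \<in> U x \<and>
      (\<forall>y\<in>K \<inter> U x. \<forall>z\<in>K \<inter> U x. P (C x) y z)"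
    using loc by metis
  obtain F where F: "F \<subseteq> K" "finite F" "K \<subseteq> (\<Union>x\<in>F. U x)"
    using compactE_image[OF K, of K U] U by (metis UN_I subsetI)
  obtain e where e: "e > 0" "\<And>x. x \<in> K \<Longrightarrow> \<exists>G\<in>U ` F. ball x e \<subseteq> G"
    using Heine_Borel_lemma[OF K, of "U ` F"] F U by (metis (no_types, lifting) imageE subsetD)
  have "P (Max (C ` F)) y z" if yz: "y \<in> K" "z \<in> K" "dist y z < e" for y z
  proof -
    obtain x where x: "x \<in> F" "ball y e \<subseteq> U x" using e(2)[of y] \<open>y \<in> K\<close> by blast
    then have "P (C x) y z" using U F(1) yz e(1) by (auto simp: subset_iff)
    moreover have "C x \<le> Max (C ` F)" using x F(2) by simp
    ultimately show ?thesis using mono by blast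
  qed
  with e(1) show ?thesis by blast
qed

section \<open>Quantitative estimates for smooth immersions\<close>

text \<open>
  The directional derivatives of \<open>f\<close> along basis vectors are
  again differentiable with continuous, hence locally bounded, directional derivatives; expanding in
  the basis turns this into a Lipschitz bound for the derivative of \<open>f\<close>.
\<close>

lemma smooth_on_C2_near:
  fixes f :: "'a::euclidean_space \<Rightarrow> 'b::euclidean_space"
  assumes f: "smooth_on f V" and V: "open V" "p0 \<in> V"
  obtains d K :: real where "0 < d" "d \<le> 1" "1 \<le> K" "cball p0 d \<subseteq> V"
    "\<And>p. p \<in> cball p0 d \<Longrightarrow> (f has_derivative frechet_derivative f (at p)) (at p)"
    "\<And>p v. p \<in> cball p0 d \<Longrightarrow> norm (frechet_derivative f (at p) v) \<le> K * norm v"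
    "\<And>p q v. p \<in> cball p0 d \<Longrightarrow> q \<in> cball p0 d \<Longrightarrow>
       norm (frechet_derivative f (at p) v - frechet_derivative f (at q) v)
         \<le> K * norm (p - q) * norm v"
proof -
  let ?D = "\<lambda>p. frechet_derivative f (at p)"
  let ?G = "\<lambda>e p. frechet_derivative (\<lambda>x. ?D x e) (at p)"
  obtain d0 where d0: "0 < d0" "cball p0 d0 \<subseteq> V"
    using V open_contains_cball by blast
  define d where "d = min d0 1"
  have d: "0 < d" "d \<le> 1" "cball p0 d \<subseteq> V"
    using d0 by (auto simp: d_def)
  have C2: "times_differentiable_on (Suc (Suc 0)) f V"
    using f unfolding smooth_on_def by blast
  have D: "(f has_derivative ?D p) (at p)" if "p \<in> cball p0 d" for p
    using C2 that d(3) frechet_derivative_works by (auto simp: subset_iff)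
  have G: "((\<lambda>x. ?D x e) has_derivative ?G e p) (at p)" if "p \<in> cball p0 d" for e p
  proof -
    have "(\<lambda>x. ?D x e) differentiable (at p)" using C2 that d(3) by (auto simp: subset_iff)
    then show ?thesis by (rule iffD1[OF frechet_derivative_works])
  qed
  have contG: "continuous_on (cball p0 d) (\<lambda>p. ?G e p v)" for e v
    by (rule continuous_on_subset[OF _ d(3)]) (use C2 in simp)
  have "\<exists>M. \<forall>p\<in>cball p0 d. norm (?G e p v) \<le> M" for e v
    using compact_imp_bounded[OF compact_continuous_image[OF contG compact_cball]]
    unfolding bounded_iff by (auto simp: image_iff)
  then obtain M where M: "\<And>e v p. p \<in> cball p0 d \<Longrightarrow> norm (?G e p v) \<le> M e v"
    by metis
  have M0: "0 \<le> M e v" for e v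
    using M[of p0 e v] d(1) by (smt (verit) centre_in_cball norm_ge_zero)
  have expand: "linear A \<Longrightarrow> A v = (\<Sum>b\<in>Basis. (v \<bullet> b) *\<^sub>R A b)" for A :: "'a \<Rightarrow> 'b" and v
    by (metis (no_types, lifting) euclidean_representation linear_scale linear_sum sum.cong)
  have G_bound: "norm (?G e p v) \<le> (\<Sum>b\<in>Basis. M e b) * norm v" if p: "p \<in> cball p0 d" for e p v
  proof -
    have "norm (?G e p v) = norm (\<Sum>b\<in>Basis. (v \<bullet> b) *\<^sub>R ?G e p b)"
      using expand[of "?G e p" v] has_derivative_linear[OF G[OF p]] by simp
    also have "\<dots> \<le> (\<Sum>b\<in>Basis. norm v * M e b)"
      using M[OF p] Basis_le_norm
      by (intro sum_norm_le) (auto intro!: mult_mono)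
    finally show ?thesis by (simp add: sum_distrib_left mult.commute)
  qed
  have G_lip: "norm (?D p e - ?D q e) \<le> (\<Sum>b\<in>Basis. M e b) * norm (p - q)"
    if pq: "p \<in> cball p0 d" "q \<in> cball p0 d" for e p q
  proof (rule differentiable_bound[OF convex_cball[of p0 d] _ _ pq])
    fix x assume x: "x \<in> cball p0 d"
    show "((\<lambda>x. ?D x e) has_derivative ?G e x) (at x within cball p0 d)"
      using G[OF x] has_derivative_at_withinI by blast
    show "onorm (?G e x) \<le> (\<Sum>b\<in>Basis. M e b)"
      using G_bound[OF x] by (intro onorm_le) auto
  qed
  define K1 where "K1 = (\<Sum>e\<in>Basis. \<Sum>b\<in>Basis. M e b)"
  have K1: "0 \<le> K1" unfolding K1_def using M0 by (intro sum_nonneg) auto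
  have lip: "norm (?D p v - ?D q v) \<le> K1 * norm (p - q) * norm v"
    if pq: "p \<in> cball p0 d" "q \<in> cball p0 d" for p q v
  proof -
    have "?D p v - ?D q v = (\<Sum>e\<in>Basis. (v \<bullet> e) *\<^sub>R (?D p e - ?D q e))"
      using expand[of "?D p" v] expand[of "?D q" v]
        has_derivative_linear[OF D[OF pq(1)]] has_derivative_linear[OF D[OF pq(2)]]
      by (simp add: sum_subtractf scaleR_right_diff_distrib)
    also have "norm \<dots> \<le> (\<Sum>e\<in>Basis. norm v * ((\<Sum>b\<in>Basis. M e b) * norm (p - q)))"
      using G_lip[OF pq] Basis_le_norm
      by (intro sum_norm_le) (auto intro!: mult_mono)
    also have "\<dots> = K1 * norm (p - q) * norm v"
      unfolding K1_def by (simp add: sum_distrib_left sum_distrib_right mult_ac)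
    finally show ?thesis .
  qed
  define B where "B = onorm (?D p0)"
  have p0: "p0 \<in> cball p0 d" using d by simp
  have B: "norm (?D p0 v) \<le> B * norm v" "0 \<le> B" for v
    unfolding B_def using has_derivative_bounded_linear[OF D[OF p0]]
    by (auto intro: onorm onorm_pos_le)
  have bound: "norm (?D p v) \<le> (K1 + B) * norm v" if p: "p \<in> cball p0 d" for p v
  proof -
    have "norm (?D p v) \<le> norm (?D p v - ?D p0 v) + norm (?D p0 v)"
      by (metis add.commute norm_triangle_sub)
    moreover have "K1 * norm (p - p0) * norm v \<le> K1 * 1 * norm v"
      using p d(2) K1 by (intro mult_right_mono mult_left_mono) (auto simp: dist_norm norm_minus_commute)
    ultimately show ?thesis
      using lip[OF p p0, of v] B(1)[of v] by (simp add: algebra_simps)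
  qed
  show thesis
  proof (rule that[of d "K1 + B + 1"])
    fix p v :: 'a assume "p \<in> cball p0 d"
    then have "norm (?D p v) \<le> (K1 + B) * norm v" by (rule bound)
    then show "norm (?D p v) \<le> (K1 + B + 1) * norm v"
      using norm_ge_zero[of v] unfolding distrib_right mult_1 by linarith
  next
    fix p q v :: 'a assume pq: "p \<in> cball p0 d" "q \<in> cball p0 d"
    have "K1 * (norm (p - q) * norm v) \<le> (K1 + B + 1) * (norm (p - q) * norm v)"
      using B(2) by (intro mult_right_mono) auto
    then show "norm (?D p v - ?D q v) \<le> (K1 + B + 1) * norm (p - q) * norm v"
      using lip[OF pq, of v] by (simp add: mult.assoc)
  qed (use d D K1 B(2) in auto)
qed

lemma lipschitz_bound_on_convex:
  fixes f :: "'a::euclidean_space \<Rightarrow> 'b::euclidean_space"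
  assumes S: "convex S" and D: "\<And>p. p \<in> S \<Longrightarrow> (f has_derivative D p) (at p)"
    and bound: "\<And>p v. p \<in> S \<Longrightarrow> norm (D p v) \<le> K * norm v"
    and pq: "p \<in> S" "q \<in> S"
  shows "norm (f p - f q) \<le> K * norm (p - q)"
proof (rule differentiable_bound[OF S _ _ pq])
  fix x assume x: "x \<in> S"
  show "(f has_derivative D x) (at x within S)" using has_derivative_at_withinI[OF D[OF x]] .
  show "onorm (D x) \<le> K" by (rule onorm_le) (rule bound[OF x])
qed

text \<open>
  On the small ball \<open>f\<close> differs from the linear map \<open>D p0\<close>, which is bounded below on \<open>E\<close>, by a map
  whose Lipschitz constant is half of that lower bound.
\<close>

lemma immersion_expanding_near:
  fixes f :: "'a::euclidean_space \<Rightarrow> 'b::euclidean_space"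
  assumes d: "0 < d" and K: "1 \<le> K"
    and D: "\<And>p. p \<in> cball p0 d \<Longrightarrow> (f has_derivative D p) (at p)"
    and lip: "\<And>p q v. p \<in> cball p0 d \<Longrightarrow> q \<in> cball p0 d \<Longrightarrow>
       norm (D p v - D q v) \<le> K * norm (p - q) * norm v"
    and E: "subspace E" "inj_on (D p0) E"
  obtains c d' where "0 < c" "0 < d'" "d' \<le> d"
    "\<And>p q. p \<in> cball p0 d' \<Longrightarrow> q \<in> cball p0 d' \<Longrightarrow> p - q \<in> E \<Longrightarrow>
       c * norm (p - q) \<le> norm (f p - f q)"
proof -
  have p0: "p0 \<in> cball p0 d" using d by simp
  have blin: "bounded_linear (D p0)" using has_derivative_bounded_linear[OF D[OF p0]] .
  have "\<exists>e>0. \<forall>v\<in>E. e * norm v \<le> norm (D p0 v)"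
  proof (rule injective_imp_isometric[OF closed_subspace[OF E(1)] E(1) blin])
    show "\<forall>x\<in>E. D p0 x = 0 \<longrightarrow> x = 0"
      using E inj_onD[OF E(2), of _ 0] subspace_0[OF E(1)] linear_0[OF bounded_linear.linear[OF blin]]
      by auto
  qed
  then obtain e where e: "0 < e" "\<And>v. v \<in> E \<Longrightarrow> e * norm v \<le> norm (D p0 v)" by blast
  define d' where "d' = min d (e / (2 * K))"
  have d': "0 < d'" "d' \<le> d" "K * d' \<le> e / 2"
    using d K e(1) by (auto simp: d'_def field_simps min_def)
  have "e / 2 * norm (p - q) \<le> norm (f p - f q)"
    if pq: "p \<in> cball p0 d'" "q \<in> cball p0 d'" "p - q \<in> E" for p q
  proof -
    have "norm ((f p - D p0 p) - (f q - D p0 q)) \<le> e / 2 * norm (p - q)"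
    proof (rule lipschitz_bound_on_convex[OF convex_cball[of p0 d'] _ _ pq(1,2)])
      fix x assume x: "x \<in> cball p0 d'"
      then have x': "x \<in> cball p0 d" using d'(2) by auto
      show "((\<lambda>x. f x - D p0 x) has_derivative (\<lambda>v. D x v - D p0 v)) (at x)"
        by (intro has_derivative_diff D x' bounded_linear_imp_has_derivative blin)
      fix v
      have "norm (D x v - D p0 v) \<le> K * norm (x - p0) * norm v" using lip[OF x' p0] .
      also have "\<dots> \<le> K * d' * norm v"
        using x K by (intro mult_right_mono mult_left_mono) (auto simp: dist_norm norm_minus_commute)
      also have "\<dots> \<le> e / 2 * norm v" using d'(3) by (intro mult_right_mono) auto
      finally show "norm (D x v - D p0 v) \<le> e / 2 * norm v" .
    qed
    moreover have "(f p - D p0 p) - (f q - D p0 q) = (f p - f q) - D p0 (p - q)"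
      using linear_diff[OF bounded_linear.linear[OF blin]] by simp
    moreover have "e * norm (p - q) \<le> norm (D p0 (p - q))" using e(2) pq(3) by blast
    ultimately show ?thesis
      using norm_triangle_ineq2[of "D p0 (p - q)" "f p - f q"]
      by (simp add: norm_minus_commute)
  qed
  then show thesis using that[of "e / 2" d'] e(1) d' by auto
qed

section \<open>A half-space chart of a cone\<close>

lemma lipschitz_on_segment:
  fixes f :: "'a::euclidean_space \<Rightarrow> 'b::euclidean_space"
  assumes D: "\<And>t. t \<in> {0..1} \<Longrightarrow> (f has_derivative D (p + t *\<^sub>R v)) (at (p + t *\<^sub>R v))"
    and bound: "\<And>t. t \<in> {0..1} \<Longrightarrow> norm (D (p + t *\<^sub>R v) v) \<le> B" and "0 \<le> B"
  shows "B-lipschitz_on {0..1} (\<lambda>t. f (p + t *\<^sub>R v))"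
proof (rule bounded_derivative_imp_lipschitz)
  fix t :: real assume t: "t \<in> {0..1}"
  have "((\<lambda>t. f (p + t *\<^sub>R v)) has_derivative (\<lambda>s. D (p + t *\<^sub>R v) (s *\<^sub>R v))) (at t)"
    by (rule has_derivative_compose[where f = "\<lambda>t. p + t *\<^sub>R v", OF _ D[OF t]])
      (auto intro!: derivative_eq_intros)
  then show "((\<lambda>t. f (p + t *\<^sub>R v)) has_derivative (\<lambda>s. D (p + t *\<^sub>R v) (s *\<^sub>R v))) (at t within {0..1})"
    by (rule has_derivative_at_withinI)
  have "norm (D (p + t *\<^sub>R v) (s *\<^sub>R v)) \<le> B * norm s" for s
    using mult_left_mono[OF bound[OF t], of "\<bar>s\<bar>"]
      linear_scale[OF has_derivative_linear[OF D[OF t]], of s v] by (simp add: mult.commute)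
  then show "onorm (\<lambda>s. D (p + t *\<^sub>R v) (s *\<^sub>R v)) \<le> B" by (rule onorm_le)
qed (use \<open>0 \<le> B\<close> in auto)

text \<open>
  The two summands reflect the two terms of \<open>d(r u) = dr u + r du\<close>. It is applied with \<open>r\<close> the radius near a
  conic point, and with the reciprocal radius near infinity.
\<close>

lemma lipschitz_on_polar:
  fixes r :: "'b::metric_space \<Rightarrow> real" and u :: "'b \<Rightarrow> 'a::real_normed_vector"
  assumes r: "A-lipschitz_on S r" and u: "B-lipschitz_on S u"
    and bounds: "\<And>t. t \<in> S \<Longrightarrow> norm (u t) = 1" "\<And>t. t \<in> S \<Longrightarrow> \<bar>r t\<bar> \<le> M" and "0 \<le> M"
  shows "(A + M * B)-lipschitz_on S (\<lambda>t. r t *\<^sub>R u t + a)"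
proof (rule lipschitz_onI)
  fix s t assume st: "s \<in> S" "t \<in> S"
  have "(r s *\<^sub>R u s + a) - (r t *\<^sub>R u t + a) = (r s - r t) *\<^sub>R u s + r t *\<^sub>R (u s - u t)"
    by (simp add: algebra_simps)
  then have "dist (r s *\<^sub>R u s + a) (r t *\<^sub>R u t + a) \<le> \<bar>r s - r t\<bar> + \<bar>r t\<bar> * norm (u s - u t)"
    using norm_triangle_ineq[of "(r s - r t) *\<^sub>R u s" "r t *\<^sub>R (u s - u t)"] bounds(1)[OF st(1)]
    by (simp add: dist_norm)
  also have "\<dots> \<le> A * dist s t + M * (B * dist s t)"
    using lipschitz_onD[OF r st] lipschitz_onD[OF u st] bounds(2)[OF st(2)]
    by (intro add_mono mult_mono) (auto simp: dist_norm)
  finally show "dist (r s *\<^sub>R u s + a) (r t *\<^sub>R u t + a) \<le> (A + M * B) * dist s t"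
    by (simp add: algebra_simps)
qed (use lipschitz_on_nonneg[OF r] lipschitz_on_nonneg[OF u] \<open>0 \<le> M\<close> in auto)

lemma lipschitz_on_reciprocal:
  fixes r :: "'b::metric_space \<Rightarrow> real"
  assumes r: "A-lipschitz_on S r" and m: "0 < m" "\<And>t. t \<in> S \<Longrightarrow> m \<le> r t"
  shows "(A / m\<^sup>2)-lipschitz_on S (\<lambda>t. 1 / r t)"
proof (rule lipschitz_onI)
  fix s t assume st: "s \<in> S" "t \<in> S"
  have pos: "0 < r s" "0 < r t" using m st by (meson less_le_trans)+
  have "dist (1 / r s) (1 / r t) = dist (r s) (r t) / (r s * r t)"
    using pos by (simp add: dist_real_def divide_simps abs_minus_commute abs_mult split: abs_split)
  also have "\<dots> \<le> A * dist s t / m\<^sup>2"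
    using lipschitz_onD[OF r st] lipschitz_on_nonneg[OF r] m st pos
    by (intro frac_le) (auto simp: power2_eq_square intro!: mult_mono)
  finally show "dist (1 / r s) (1 / r t) \<le> A / m\<^sup>2 * dist s t" by simp
qed (use lipschitz_on_nonneg[OF r] in simp)

definition half_ball :: "'a::euclidean_space set \<Rightarrow> 'a \<Rightarrow> 'a \<Rightarrow> real \<Rightarrow> 'a set" where
  "half_ball E e p0 r = {p \<in> cball p0 r \<inter> E. 0 \<le> e \<bullet> p}"

lemma convex_half_ball: "subspace E \<Longrightarrow> convex (half_ball E e p0 r)"
proof -
  assume E: "subspace E"
  have "half_ball E e p0 r = cball p0 r \<inter> E \<inter> {p. 0 \<le> e \<bullet> p}"
    by (auto simp: half_ball_def)
  then show ?thesis
    by (simp add: E convex_Int subspace_imp_convex convex_halfspace_ge[of 0, simplified])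
qed

lemma half_ball_mono: "r \<le> r' \<Longrightarrow> half_ball E e p0 r \<subseteq> half_ball E e p0 r'"
  by (auto simp: half_ball_def)

text \<open>
  The orthogonal projection to the boundary plane does not increase the distance to \<open>p0\<close>, which lies
  on that plane.
\<close>

lemma foot_in_half_ball:
  assumes E: "subspace E" "e \<in> E" "norm e = 1" "p0 \<in> E" "e \<bullet> p0 = 0"
  shows "p \<in> half_ball E e p0 r \<Longrightarrow> p - (e \<bullet> p) *\<^sub>R e \<in> half_ball E e p0 r"
    and "e \<bullet> (p - (e \<bullet> p) *\<^sub>R e) = 0"
proof -
  show 0: "e \<bullet> (p - (e \<bullet> p) *\<^sub>R e) = 0" using E(3) by (simp add: inner_diff_right norm_eq_1)
  assume p: "p \<in> half_ball E e p0 r"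
  have "e \<bullet> (p - (e \<bullet> p) *\<^sub>R e - p0) = 0"
    using 0 E(5) inner_diff_right[of e "p - (e \<bullet> p) *\<^sub>R e" p0] by simp
  then have "orthogonal (p - (e \<bullet> p) *\<^sub>R e - p0) ((e \<bullet> p) *\<^sub>R e)"
    by (simp add: orthogonal_def inner_commute[of _ e])
  from norm_add_Pythagorean[OF this]
  have "(norm (p - (e \<bullet> p) *\<^sub>R e - p0))\<^sup>2 + (norm ((e \<bullet> p) *\<^sub>R e))\<^sup>2 = (norm (p - p0))\<^sup>2"
    by (simp add: diff_diff_eq)
  then have "(norm (p - (e \<bullet> p) *\<^sub>R e - p0))\<^sup>2 \<le> (norm (p - p0))\<^sup>2"
    using zero_le_power2[of "norm ((e \<bullet> p) *\<^sub>R e)"] by linarith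
  then have "norm (p - (e \<bullet> p) *\<^sub>R e - p0) \<le> norm (p - p0)"
    by (rule power2_le_imp_le) (rule norm_ge_zero)
  then show "p - (e \<bullet> p) *\<^sub>R e \<in> half_ball E e p0 r"
    using p 0 E by (auto simp: half_ball_def dist_norm norm_minus_commute subspace_diff subspace_scale)
qed

text \<open>
  The chart \<open>f\<close> is defined near \<open>p0\<close> on the half-space \<open>0 \<le> e \<bullet> p\<close> of \<open>E\<close>, and has the components
  radius \<open>fst (f p)\<close> and direction \<open>snd (f p)\<close>. The assumptions \<open>normal\<close>, \<open>tangential\<close> and \<open>boundary\<close> make
  the radius comparable with the height \<open>e \<bullet> p\<close>, and also its variation along curves, so that one can
  stand for the other in all estimates.
\<close>

locale conic_chart =
  fixes E :: "'b::euclidean_space set" and e p0 :: 'b and d c K :: real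
    and f :: "'b \<Rightarrow> real \<times> 'a::euclidean_space" and D :: "'b \<Rightarrow> 'b \<Rightarrow> real \<times> 'a"
  assumes E: "subspace E" "e \<in> E" "norm e = 1" "p0 \<in> E" "e \<bullet> p0 = 0"
    and d: "0 < d" "d \<le> 1" and c: "0 < c" "c \<le> 1" and K: "1 \<le> K"
    and deriv: "\<And>p. p \<in> cball p0 d \<Longrightarrow> (f has_derivative D p) (at p)"
    and bound: "\<And>p v. p \<in> cball p0 d \<Longrightarrow> norm (D p v) \<le> K * norm v"
    and expanding: "\<And>p q. p \<in> cball p0 d \<Longrightarrow> q \<in> cball p0 d \<Longrightarrow> p - q \<in> E \<Longrightarrow>
      c * norm (p - q) \<le> norm (f p - f q)"
    and normal: "\<And>p. p \<in> cball p0 d \<Longrightarrow> c \<le> fst (D p e)"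
    and tangential: "\<And>p w. p \<in> half_ball E e p0 d \<Longrightarrow> w \<in> E \<Longrightarrow> e \<bullet> w = 0 \<Longrightarrow>
      \<bar>fst (D p w)\<bar> \<le> K * (e \<bullet> p) * norm w"
    and boundary: "\<And>p. p \<in> half_ball E e p0 d \<Longrightarrow> e \<bullet> p = 0 \<Longrightarrow> fst (f p) = 0"
    and unit: "\<And>p. p \<in> half_ball E e p0 d \<Longrightarrow> norm (snd (f p)) = 1"
begin

abbreviation H :: "real \<Rightarrow> 'b set" where "H \<equiv> half_ball E e p0"

lemma e_e: "e \<bullet> e = 1"
  using E(3) by (simp add: norm_eq_1)

lemma H_segment: "p \<in> H r \<Longrightarrow> q \<in> H r \<Longrightarrow> t \<in> {0..1} \<Longrightarrow> p + t *\<^sub>R (q - p) \<in> H r"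
  using convexD_alt[OF convex_half_ball[OF E(1)], of p e p0 r q t] by (simp add: algebra_simps)

lemma height_le: "p \<in> H r \<Longrightarrow> e \<bullet> p \<le> r"
proof -
  assume p: "p \<in> H r"
  have "e \<bullet> p = e \<bullet> (p - p0)" using E(5) by (simp add: inner_diff_right)
  also have "\<dots> \<le> norm e * norm (p - p0)" by (rule norm_cauchy_schwarz)
  also have "\<dots> \<le> r" using p E(3) by (simp add: half_ball_def dist_norm norm_minus_commute)
  finally show ?thesis .
qed

lemma foot_in_H: "p \<in> H r \<Longrightarrow> p - (e \<bullet> p) *\<^sub>R e \<in> H r"
    "e \<bullet> (p - (e \<bullet> p) *\<^sub>R e) = 0"
  using foot_in_half_ball[OF E] by auto

lemma translate_in_H:
  assumes p: "p \<in> H r" and t: "- (e \<bullet> p) \<le> t" and "\<bar>t\<bar> \<le> r'"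
  shows "p + t *\<^sub>R e \<in> H (r + r')"
proof -
  have "dist p0 (p + t *\<^sub>R e) \<le> dist p0 p + norm (t *\<^sub>R e)"
    by (metis dist_triangle dist_norm add_diff_cancel_left' dist_commute)
  then show ?thesis
    using assms E e_e
    by (auto simp: half_ball_def inner_add_right subspace_add subspace_scale)
qed

lemma H_cball: "p \<in> H d \<Longrightarrow> p \<in> cball p0 d"
  by (simp add: half_ball_def)

lemma lip: "p \<in> cball p0 d \<Longrightarrow> q \<in> cball p0 d \<Longrightarrow> norm (f p - f q) \<le> K * norm (p - q)"
  by (rule lipschitz_bound_on_convex[OF convex_cball[of p0 d] deriv bound])

lemma lip_fst: "p \<in> cball p0 d \<Longrightarrow> q \<in> cball p0 d \<Longrightarrow> \<bar>fst (f p) - fst (f q)\<bar> \<le> K * norm (p - q)"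
  using lip[of p q] norm_fst_le[of "fst (f p - f q)" "snd (f p - f q)"]
  by (simp del: fst_diff snd_diff) (simp add: fst_diff)

lemma lip_snd: "p \<in> cball p0 d \<Longrightarrow> q \<in> cball p0 d \<Longrightarrow> norm (snd (f p) - snd (f q)) \<le> K * norm (p - q)"
  using lip[of p q] norm_snd_le[of "snd (f p - f q)" "fst (f p - f q)"]
  by (simp del: fst_diff snd_diff) (simp add: snd_diff)

text \<open>
  Along \<open>e\<close> the function \<open>fst (f (p + s e)) - c s\<close> has a nonnegative derivative.
\<close>

lemma radius_increase:
  assumes p: "p \<in> cball p0 d" "p + t *\<^sub>R e \<in> cball p0 d" and t: "0 \<le> t"
  shows "c * t \<le> fst (f (p + t *\<^sub>R e)) - fst (f p)"
proof -
  have "fst (f (p + 0 *\<^sub>R e)) - c * 0 \<le> fst (f (p + t *\<^sub>R e)) - c * t"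
  proof (rule DERIV_nonneg_imp_nondecreasing[OF t])
    fix s assume s: "0 \<le> s" "s \<le> t"
    have "p + s *\<^sub>R e \<in> cball p0 d"
    proof (cases "t = 0")
      case False
      then have "p + s *\<^sub>R e = p + (s / t) *\<^sub>R ((p + t *\<^sub>R e) - p)" by simp
      also have "\<dots> \<in> cball p0 d"
        using convexD_alt[OF convex_cball[of p0 d] p, of "s / t"] s False t
        by (simp add: scaleR_left_diff_distrib scaleR_right_distrib)
      finally show ?thesis .
    qed (use s p in auto)
    note ps = this
    have "((\<lambda>s. f (p + s *\<^sub>R e)) has_derivative (\<lambda>h. D (p + s *\<^sub>R e) (h *\<^sub>R e))) (at s)"
      by (rule has_derivative_compose[where f = "\<lambda>s. p + s *\<^sub>R e", OF _ deriv[OF ps]])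
        (auto intro!: derivative_eq_intros)
    then have "((\<lambda>s. fst (f (p + s *\<^sub>R e))) has_derivative (\<lambda>h. fst (D (p + s *\<^sub>R e) (h *\<^sub>R e)))) (at s)"
      by (rule has_derivative_fst)
    moreover have "(\<lambda>h. fst (D (p + s *\<^sub>R e) (h *\<^sub>R e))) = (\<lambda>h. fst (D (p + s *\<^sub>R e) e) * h)"
      using linear_scale[OF has_derivative_linear[OF deriv[OF ps]]] by (simp add: fun_eq_iff)
    ultimately have "((\<lambda>s. fst (f (p + s *\<^sub>R e))) has_real_derivative fst (D (p + s *\<^sub>R e) e)) (at s)"
      by (simp add: has_field_derivative_def)
    then have "((\<lambda>s. fst (f (p + s *\<^sub>R e)) - c * s) has_real_derivative fst (D (p + s *\<^sub>R e) e) - c) (at s)"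
      by (auto intro!: derivative_eq_intros)
    then show "\<exists>y. ((\<lambda>s. fst (f (p + s *\<^sub>R e)) - c * s) has_real_derivative y) (at s) \<and> 0 \<le> y"
      using normal[OF ps] by (intro exI conjI) auto
  qed
  then show ?thesis by simp
qed

lemma radius_bounds:
  assumes p: "p \<in> H d"
  shows "c * (e \<bullet> p) \<le> fst (f p)" "fst (f p) \<le> K * (e \<bullet> p)"
proof -
  let ?q = "p - (e \<bullet> p) *\<^sub>R e"
  have q: "?q \<in> H d" "fst (f ?q) = 0" using foot_in_H(1)[OF p] foot_in_H(2)[of p] boundary by auto
  have "norm (p - ?q) = e \<bullet> p" using p E(3) by (simp add: half_ball_def)
  then show "fst (f p) \<le> K * (e \<bullet> p)"
    using lip_fst[OF H_cball[OF p] H_cball[OF q(1)]] q(2) by simp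
  show "c * (e \<bullet> p) \<le> fst (f p)"
    using radius_increase[OF H_cball[OF q(1)], of "e \<bullet> p"] p q(2) by (simp add: half_ball_def)
qed

lemma radius_le: "p \<in> H d \<Longrightarrow> fst (f p) \<le> K"
  using radius_bounds(2)[of p] height_le[of p d] d K mult_left_mono[of "e \<bullet> p" 1 K] by linarith

lemma radius_pos: "p \<in> H d \<Longrightarrow> 0 < e \<bullet> p \<Longrightarrow> 0 < fst (f p)"
  using radius_bounds(1)[of p] c by (smt (verit) mult_pos_pos)

lemma radius_on_level:
  assumes pq: "p \<in> H d" "q \<in> H d" and level: "e \<bullet> q = e \<bullet> p"
  shows "\<bar>fst (f p) - fst (f q)\<bar> \<le> K * (e \<bullet> p) * norm (q - p)"
proof -
  have E': "q - p \<in> E" "e \<bullet> (q - p) = 0" "0 \<le> e \<bullet> p"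
    using pq level E(1) by (auto simp: half_ball_def subspace_diff inner_diff_right)
  have "(K * (e \<bullet> p) * norm (q - p))-lipschitz_on {0..1} (\<lambda>t. fst (f (p + t *\<^sub>R (q - p))))"
  proof (rule lipschitz_on_segment)
    fix t :: real assume t: "t \<in> {0..1}"
    have pt: "p + t *\<^sub>R (q - p) \<in> H d" using H_segment[OF pq t] .
    show "((\<lambda>x. fst (f x)) has_derivative (\<lambda>v. fst (D (p + t *\<^sub>R (q - p)) v))) (at (p + t *\<^sub>R (q - p)))"
      by (intro has_derivative_fst deriv H_cball pt)
    show "norm (fst (D (p + t *\<^sub>R (q - p)) (q - p))) \<le> K * (e \<bullet> p) * norm (q - p)"
      using tangential[OF pt E'(1,2)] E'(2) by (simp add: inner_add_right)
  qed (use K E'(3) in auto)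
  from lipschitz_onD[OF this, of 0 1] show ?thesis by (simp add: dist_real_def)
qed

end

text \<open>
  In polar coordinates the radial difference is bounded by the distance, and then so is the
  angular difference weighted by a radius.
\<close>

lemma unit_polar_lower:
  fixes u u' :: "'a::real_normed_vector"
  assumes u: "norm u = 1" "norm u' = 1" and s: "0 \<le> s" "0 \<le> s'"
  shows "\<bar>s - s'\<bar> \<le> norm (s *\<^sub>R u - s' *\<^sub>R u')"
    and "s * norm (u - u') \<le> 2 * norm (s *\<^sub>R u - s' *\<^sub>R u')"
proof -
  show 1: "\<bar>s - s'\<bar> \<le> norm (s *\<^sub>R u - s' *\<^sub>R u')"
    using norm_triangle_ineq3[of "s *\<^sub>R u" "s' *\<^sub>R u'"] u s by simp
  have "s *\<^sub>R (u - u') = (s *\<^sub>R u - s' *\<^sub>R u') + (s' - s) *\<^sub>R u'" by (simp add: algebra_simps)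
  then have "s * norm (u - u') \<le> norm (s *\<^sub>R u - s' *\<^sub>R u') + \<bar>s' - s\<bar>"
    using norm_triangle_ineq[of "s *\<^sub>R u - s' *\<^sub>R u'" "(s' - s) *\<^sub>R u'"] u s
    by (metis abs_of_nonneg mult.right_neutral norm_scaleR)
  with 1 show "s * norm (u - u') \<le> 2 * norm (s *\<^sub>R u - s' *\<^sub>R u')" by linarith
qed

context conic_chart
begin

text \<open>
  \<open>near_const\<close> compares, for a segment of the chart, its tangential part and its relative
  change of height with the gap between the end points. \<open>path_const\<close> then bounds the speed and the
  variation of the radius along the segment.
\<close>

definition near_const :: real where "near_const = 3 * K\<^sup>2 / c\<^sup>2"
definition path_const :: real where "path_const = 9 * K ^ 3 / c ^ 3"

text \<open>
  The distance of two points of the cylinder with metric \<open>|dr| / r + |du|\<close>, up to a constant while the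
  radii are comparable.
\<close>

definition gap :: "'b \<Rightarrow> 'b \<Rightarrow> real" where
  "gap p q = \<bar>fst (f p) - fst (f q)\<bar> / fst (f p) + norm (snd (f p) - snd (f q))"

lemma const_bounds: "1 \<le> near_const" "2 * K\<^sup>2 / c \<le> near_const" "near_const \<le> path_const" "3 * K * near_const / c = path_const" "2 * K / c \<le> path_const"
proof -
  have c1: "c\<^sup>2 \<le> c" "c ^ 3 \<le> c\<^sup>2" "0 < c\<^sup>2" "0 < c ^ 3"
    using c by (auto simp: power2_eq_square power3_eq_cube mult_left_le)
  have K1: "1 \<le> K\<^sup>2" "K \<le> K\<^sup>2" "K\<^sup>2 \<le> K ^ 3"
    using K by (auto simp: power2_eq_square power3_eq_cube mult_left_mono[of 1 K K, simplified]
      intro!: mult_right_mono[of 1 K "K * K", simplified] order.trans[of 1 K "K * K"])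
  have c_le: "c\<^sup>2 \<le> 1" using c1 c by linarith
  show "1 \<le> near_const" unfolding near_const_def using c1 K1 c_le by (simp add: field_simps)
  have "2 * K\<^sup>2 / c \<le> 3 * K\<^sup>2 / c" using c K1 by (intro divide_right_mono) auto
  also have "\<dots> \<le> 3 * K\<^sup>2 / c\<^sup>2" using c c1 K1 by (intro divide_left_mono) auto
  finally show 2: "2 * K\<^sup>2 / c \<le> near_const" unfolding near_const_def .
  have "3 * K\<^sup>2 / c\<^sup>2 \<le> 9 * K ^ 3 / c ^ 3"
    using c1 K1 K by (intro frac_le) auto
  then show 3: "near_const \<le> path_const" unfolding near_const_def path_const_def .
  show "3 * K * near_const / c = path_const" unfolding near_const_def path_const_def by (simp add: power2_eq_square power3_eq_cube)
  have "2 * K / c \<le> 2 * K\<^sup>2 / c" using c K1 by (intro divide_right_mono) auto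
  with 2 3 show "2 * K / c \<le> path_const" by linarith
qed

text \<open>
  This is the main estimate. Split the segment into a part \<open>w\<close> parallel to the boundary and a change of
  height \<open>\<eta>\<close>. Bi-Lipschitz continuity of the chart bounds \<open>w\<close> by the gap. The radius
  changes along \<open>w\<close> by \<open>O(b |w|)\<close> only, \<open>b\<close> the height of \<open>p\<close>, and by at least \<open>c |\<eta>|\<close> along \<open>\<eta>\<close>; hence also
  \<open>|\<eta>| / b\<close> is bounded by the gap. If the gap is small, the height stays comparable with
  \<open>b\<close> along the segment, and the derivative of the radius is \<open>O(b |w| + |\<eta>|)\<close>.
\<close>

lemma near_segment:
  assumes p: "p \<in> H (d / 2)" "0 < e \<bullet> p" and q: "q \<in> H (d / 2)"
    and small: "near_const * gap p q \<le> 1 / 2"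
  shows "\<And>t. t \<in> {0..1} \<Longrightarrow> p + t *\<^sub>R (q - p) \<in> H d \<and> 0 < e \<bullet> (p + t *\<^sub>R (q - p)) \<and>
      fst (f p) / path_const \<le> fst (f (p + t *\<^sub>R (q - p))) \<and> fst (f (p + t *\<^sub>R (q - p))) \<le> path_const * fst (f p)"
    and "(path_const * fst (f p) * gap p q)-lipschitz_on {0..1} (\<lambda>t. fst (f (p + t *\<^sub>R (q - p))))"
    and "(path_const * gap p q)-lipschitz_on {0..1} (\<lambda>t. snd (f (p + t *\<^sub>R (q - p))))"
proof -
  define b where "b = e \<bullet> p"
  define \<eta> where "\<eta> = e \<bullet> q - e \<bullet> p"
  \<comment> \<open>the point above the foot of q at the height of p\<close>
  define q0 where "q0 = q - \<eta> *\<^sub>R e"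
  define w where "w = q0 - p"
  define s where "s = fst (f p)"
  define \<Delta> where "\<Delta> = gap p q"
  have pd: "p \<in> H d" and qd: "q \<in> H d" using p q half_ball_mono[of "d / 2" d] d by auto
  have b: "0 < b" "b \<le> 1" using p height_le[OF pd] d by (auto simp: b_def)
  have s: "0 < s" "s \<le> K" "c * b \<le> s" "s \<le> K * b"
    using radius_pos[OF pd p(2)] radius_le[OF pd] radius_bounds[OF pd] by (auto simp: s_def b_def)
  have \<Delta>: "0 \<le> \<Delta>" using s(1) unfolding \<Delta>_def gap_def s_def by simp
  have ds: "\<bar>s - fst (f q)\<bar> \<le> s * \<Delta>"
    using s(1) unfolding \<Delta>_def gap_def s_def[symmetric] by (simp add: distrib_left)
  have du: "norm (snd (f p) - snd (f q)) \<le> \<Delta>"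
    using s(1) unfolding \<Delta>_def gap_def s_def[symmetric] by simp
  have level: "e \<bullet> q0 = e \<bullet> p" using e_e by (simp add: q0_def \<eta>_def inner_diff_right)
  have q0: "q0 \<in> H d"
  proof -
    have "0 \<le> e \<bullet> q" "e \<bullet> q \<le> d / 2" "e \<bullet> p \<le> d / 2"
      using height_le[OF p(1)] height_le[OF q] q by (auto simp: half_ball_def)
    then have "q + (- \<eta>) *\<^sub>R e \<in> H (d / 2 + d / 2)"
      using p(2) unfolding \<eta>_def by (intro translate_in_H[OF q]) linarith+
    then show ?thesis by (simp add: q0_def)
  qed
  have w: "w \<in> E" "e \<bullet> w = 0"
    using q0 pd level E(1) by (auto simp: w_def half_ball_def subspace_diff inner_diff_right)
  have qp: "q - p = w + \<eta> *\<^sub>R e" by (simp add: w_def q0_def)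
  have "orthogonal w (\<eta> *\<^sub>R e)" using w(2) by (simp add: orthogonal_def inner_commute[of w])
  from norm_add_Pythagorean[OF this]
  have "(norm w)\<^sup>2 \<le> (norm (q - p))\<^sup>2"
    unfolding qp using zero_le_power2[of "norm (\<eta> *\<^sub>R e)"] by linarith
  then have "norm w \<le> norm (q - p)" by (rule power2_le_imp_le) (rule norm_ge_zero)
  moreover have qp_le: "norm (q - p) \<le> 2 * K / c * \<Delta>"
  proof -
    have "c * norm (q - p) \<le> norm (f q - f p)"
      using pd qd E(1) by (intro expanding H_cball) (auto simp: half_ball_def subspace_diff)
    also have "\<dots> = norm (fst (f p - f q), snd (f p - f q))" by (simp only: norm_minus_commute prod.collapse)
    also have "\<dots> \<le> \<bar>s - fst (f q)\<bar> + norm (snd (f p) - snd (f q))"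
      using norm_Pair_le[of "fst (f p - f q)" "snd (f p - f q)"] by (simp add: s_def)
    also have "\<dots> \<le> s * \<Delta> + \<Delta>" using ds du by linarith
    also have "\<dots> \<le> K * \<Delta> + K * \<Delta>"
      using s(2) K \<Delta> mult_right_mono[of s K \<Delta>] mult_right_mono[of 1 K \<Delta>] by linarith
    finally show ?thesis using c by (simp add: field_simps)
  qed
  ultimately have w_le: "norm w \<le> 2 * K / c * \<Delta>" by linarith
  have \<eta>_le: "\<bar>\<eta>\<bar> \<le> near_const * \<Delta> * b"
  proof -
    have "c * \<bar>\<eta>\<bar> \<le> \<bar>fst (f q) - fst (f q0)\<bar>"
    proof (cases "0 \<le> \<eta>")
      case True
      then show ?thesis using radius_increase[of q0 \<eta>] H_cball[OF q0] H_cball[OF qd]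
        by (simp add: q0_def)
    next
      case False
      then show ?thesis using radius_increase[of q "- \<eta>"] H_cball[OF q0] H_cball[OF qd]
        by (simp add: q0_def)
    qed
    also have "\<dots> \<le> \<bar>s - fst (f q)\<bar> + \<bar>s - fst (f q0)\<bar>" by linarith
    also have "\<dots> \<le> s * \<Delta> + K * b * norm w"
      using radius_on_level[OF pd q0 level] ds by (simp add: s_def b_def w_def)
    also have "\<dots> \<le> K * b * \<Delta> + K * b * (2 * K / c * \<Delta>)"
      using s(4) \<Delta> w_le K b by (intro add_mono mult_right_mono mult_left_mono) auto
    also have "\<dots> \<le> K\<^sup>2 / c * b * \<Delta> + 2 * K\<^sup>2 / c * b * \<Delta>"
    proof -
      have "K * 1 \<le> K * (K / c)" using K c by (intro mult_left_mono) (auto simp: field_simps)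
      then have "K * (b * \<Delta>) \<le> K\<^sup>2 / c * (b * \<Delta>)"
        using b \<Delta> by (intro mult_right_mono) (auto simp: power2_eq_square)
      moreover have "K * b * (2 * K / c * \<Delta>) = 2 * K\<^sup>2 / c * b * \<Delta>" by (simp add: power2_eq_square)
      ultimately show ?thesis by (simp only: mult.assoc add_mono)
    qed
    finally have "c * \<bar>\<eta>\<bar> \<le> 3 * K\<^sup>2 / c * b * \<Delta>" by (simp add: field_simps)
    then show ?thesis using c unfolding near_const_def by (simp add: field_simps power2_eq_square)
  qed
  have "near_const * \<Delta> * b \<le> 1 / 2 * b" using small b unfolding \<Delta>_def by (intro mult_right_mono) auto
  with \<eta>_le have \<eta>_half: "\<bar>\<eta>\<bar> \<le> b / 2" by linarith
  show main: "p + t *\<^sub>R (q - p) \<in> H d \<and> 0 < e \<bullet> (p + t *\<^sub>R (q - p)) \<and>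
      fst (f p) / path_const \<le> fst (f (p + t *\<^sub>R (q - p))) \<and> fst (f (p + t *\<^sub>R (q - p))) \<le> path_const * fst (f p)"
    if t: "t \<in> {0..1}" for t
  proof -
    let ?x = "p + t *\<^sub>R (q - p)"
    have x: "?x \<in> H d" using H_segment[OF pd qd t] .
    have ex: "e \<bullet> ?x = b + t * \<eta>" by (simp add: b_def \<eta>_def inner_add_right inner_diff_right)
    have "\<bar>t * \<eta>\<bar> \<le> 1 * \<bar>\<eta>\<bar>" using t unfolding abs_mult by (intro mult_right_mono) auto
    then have xb: "b / 2 \<le> e \<bullet> ?x" "e \<bullet> ?x \<le> 2 * b" using \<eta>_half b unfolding ex by linarith+
    have path_const_pos: "0 < path_const" using const_bounds by linarith
    have "s / path_const \<le> s / (2 * K / c)" using const_bounds K c s path_const_pos by (intro divide_left_mono) auto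
    also have "\<dots> \<le> (K * b) / (2 * K / c)" using s K c by (intro divide_right_mono) auto
    also have "\<dots> = c * (b / 2)" using K c by (simp add: field_simps)
    also have "\<dots> \<le> c * (e \<bullet> ?x)" using xb c by (intro mult_left_mono) auto
    also have "\<dots> \<le> fst (f ?x)" using radius_bounds[OF x] by simp
    finally have lo: "s / path_const \<le> fst (f ?x)" .
    have "fst (f ?x) \<le> K * (e \<bullet> ?x)" using radius_bounds[OF x] by simp
    also have "\<dots> \<le> K * (2 * b)" using xb K by (intro mult_left_mono) auto
    also have "\<dots> = 2 * K / c * (c * b)" using c by simp
    also have "\<dots> \<le> path_const * s" using const_bounds s K c b by (intro mult_mono) auto
    finally show ?thesis using lo x xb b unfolding s_def by auto
  qed
  have norm_bound: "norm (D (p + t *\<^sub>R (q - p)) (q - p)) \<le> path_const * \<Delta>" if t: "t \<in> {0..1}" for t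
  proof -
    have "norm (D (p + t *\<^sub>R (q - p)) (q - p)) \<le> K * norm (q - p)"
      using main[OF t] by (intro bound H_cball) auto
    also have "\<dots> \<le> K * (2 * K / c * \<Delta>)" using qp_le K by (intro mult_left_mono) auto
    also have "\<dots> = 2 * K\<^sup>2 / c * \<Delta>" by (simp add: power2_eq_square)
    also have "\<dots> \<le> path_const * \<Delta>" using const_bounds \<Delta> by (intro mult_right_mono) auto
    finally show ?thesis .
  qed
  have path_const\<Delta>: "0 \<le> path_const * \<Delta>" using const_bounds \<Delta> by simp
  show "(path_const * gap p q)-lipschitz_on {0..1} (\<lambda>t. snd (f (p + t *\<^sub>R (q - p))))"
    unfolding \<Delta>_def[symmetric]
  proof (rule lipschitz_on_segment[OF _ _ path_const\<Delta>])
    fix t :: real assume t: "t \<in> {0..1}"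
    show "((\<lambda>x. snd (f x)) has_derivative (\<lambda>v. snd (D (p + t *\<^sub>R (q - p)) v))) (at (p + t *\<^sub>R (q - p)))"
      using main[OF t] by (intro has_derivative_snd deriv H_cball) auto
    show "norm (snd (D (p + t *\<^sub>R (q - p)) (q - p))) \<le> path_const * \<Delta>"
      using norm_bound[OF t] norm_snd_le[of "snd (D (p + t *\<^sub>R (q - p)) (q - p))" "fst (D (p + t *\<^sub>R (q - p)) (q - p))"]
      by simp
  qed
  have speed_nonneg: "0 \<le> path_const * s * \<Delta>" using const_bounds \<Delta> s by simp
  show "(path_const * fst (f p) * gap p q)-lipschitz_on {0..1} (\<lambda>t. fst (f (p + t *\<^sub>R (q - p))))"
    unfolding \<Delta>_def[symmetric] s_def[symmetric]
  proof (rule lipschitz_on_segment[OF _ _ speed_nonneg])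
    fix t :: real assume t: "t \<in> {0..1}"
    let ?x = "p + t *\<^sub>R (q - p)"
    have x: "?x \<in> H d" using main[OF t] by blast
    show "((\<lambda>x. fst (f x)) has_derivative (\<lambda>v. fst (D ?x v))) (at ?x)"
      by (intro has_derivative_fst deriv H_cball x)
    have ex: "e \<bullet> ?x = b + t * \<eta>" by (simp add: b_def \<eta>_def inner_add_right inner_diff_right)
    have "\<bar>t * \<eta>\<bar> \<le> 1 * \<bar>\<eta>\<bar>" using t unfolding abs_mult by (intro mult_right_mono) auto
    then have xb: "0 \<le> e \<bullet> ?x" "e \<bullet> ?x \<le> 3 / 2 * b" using \<eta>_half b unfolding ex by linarith+
    have lin: "linear (D ?x)" using has_derivative_linear[OF deriv[OF H_cball[OF x]]] .
    have "norm (fst (D ?x (q - p))) \<le> \<bar>fst (D ?x w)\<bar> + \<bar>\<eta>\<bar> * \<bar>fst (D ?x e)\<bar>"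
    proof -
      have "D ?x (q - p) = D ?x w + \<eta> *\<^sub>R D ?x e"
        using linear_add[OF lin, of w "\<eta> *\<^sub>R e"] linear_scale[OF lin, of \<eta> e]
        unfolding qp[symmetric] by simp
      then show ?thesis
        using abs_triangle_ineq[of "fst (D ?x w)" "\<eta> * fst (D ?x e)"] by (simp add: abs_mult)
    qed
    also have "\<dots> \<le> K * (e \<bullet> ?x) * norm w + (near_const * \<Delta> * b) * K"
    proof (intro add_mono mult_mono)
      show "\<bar>fst (D ?x w)\<bar> \<le> K * (e \<bullet> ?x) * norm w" using tangential[OF x w] .
      show "\<bar>fst (D ?x e)\<bar> \<le> K"
        using bound[OF H_cball[OF x], of e] E(3)
          norm_fst_le[of "fst (D ?x e)" "snd (D ?x e)"] by simp
    qed (use \<eta>_le const_bounds \<Delta> b K in auto)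
    also have "\<dots> \<le> K * (3 / 2 * b) * (2 * K / c * \<Delta>) + near_const * \<Delta> * b * K"
      using xb K w_le b const_bounds(1) \<Delta> by (intro add_mono mult_mono) auto
    also have "\<dots> = 3 / 2 * (2 * K\<^sup>2 / c) * b * \<Delta> + near_const * b * K * \<Delta>"
      by (simp add: power2_eq_square)
    also have "\<dots> \<le> 3 / 2 * near_const * b * \<Delta> + near_const * b * K * \<Delta>"
      using const_bounds b \<Delta> by (intro add_right_mono mult_right_mono mult_left_mono) auto
    also have "\<dots> \<le> 3 * K * near_const * b * \<Delta>"
    proof -
      have "3 / 2 * (near_const * b * \<Delta>) \<le> 2 * K * (near_const * b * \<Delta>)"
        using K const_bounds b \<Delta> by (intro mult_right_mono) auto
      then show ?thesis by (simp add: algebra_simps)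
    qed
    also have "\<dots> = (3 * K * near_const / c) * (c * b) * \<Delta>" using c by simp
    also have "\<dots> \<le> path_const * s * \<Delta>"
      unfolding const_bounds(4) using s const_bounds \<Delta> b c K by (intro mult_mono) auto
    finally show "norm (fst (D ?x (q - p))) \<le> path_const * s * \<Delta>" .
  qed
qed

text \<open>
  Go straight down to the boundary, which the blow-down map sends to the apex.
\<close>

lemma joinable_cone_apex:
  assumes X: "\<And>p. p \<in> H d \<Longrightarrow> fst (f p) *\<^sub>R snd (f p) + a \<in> X" and p: "p \<in> H d"
  shows "joinable X (fst (f p) *\<^sub>R snd (f p) + a) a (2 * K\<^sup>2 / c * fst (f p))"
proof -
  define b where "b = e \<bullet> p"
  define q where "q = p - b *\<^sub>R e"
  have b: "0 \<le> b" "b \<le> 1" using p d height_le[OF p] by (auto simp: b_def half_ball_def)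
  have q: "q \<in> H d" "fst (f q) = 0" using foot_in_H(1)[OF p] foot_in_H(2)[of p] boundary by (auto simp: q_def b_def)
  have qp: "q - p = (- b) *\<^sub>R e" by (simp add: q_def)
  have x: "p + t *\<^sub>R (q - p) \<in> H d" if "t \<in> {0..1}" for t using H_segment[OF p q(1) that] .
  have diff: "norm ((p + t *\<^sub>R (q - p)) - (p + s *\<^sub>R (q - p))) = b * dist t s" for s t
  proof -
    have "(p + t *\<^sub>R (q - p)) - (p + s *\<^sub>R (q - p)) = (- ((t - s) * b)) *\<^sub>R e"
      unfolding qp by (simp add: algebra_simps)
    then show ?thesis using E(3) b by (simp add: dist_real_def abs_mult)
  qed
  have "(K * b + K * (K * b))-lipschitz_on {0..1}
      (\<lambda>t. fst (f (p + t *\<^sub>R (q - p))) *\<^sub>R snd (f (p + t *\<^sub>R (q - p))) + a)"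
  proof (rule lipschitz_on_polar)
    show "(K * b)-lipschitz_on {0..1} (\<lambda>t. fst (f (p + t *\<^sub>R (q - p))))"
      using lip_fst[OF H_cball[OF x] H_cball[OF x]] b K unfolding diff
      by (intro lipschitz_onI) (auto simp: dist_real_def mult.assoc)
    show "(K * b)-lipschitz_on {0..1} (\<lambda>t. snd (f (p + t *\<^sub>R (q - p))))"
      using lip_snd[OF H_cball[OF x] H_cball[OF x]] b K unfolding diff
      by (intro lipschitz_onI) (auto simp: dist_norm mult.assoc)
    fix t :: real assume t: "t \<in> {0..1}"
    show "norm (snd (f (p + t *\<^sub>R (q - p)))) = 1" using unit[OF x[OF t]] .
    have "0 \<le> c * (e \<bullet> (p + t *\<^sub>R (q - p)))" using x[OF t] c by (simp add: half_ball_def)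
    then show "\<bar>fst (f (p + t *\<^sub>R (q - p)))\<bar> \<le> K"
      using radius_bounds(1)[OF x[OF t]] radius_le[OF x[OF t]] by linarith
  qed (use K in auto)
  then have "joinable X (fst (f (p + 0 *\<^sub>R (q - p))) *\<^sub>R snd (f (p + 0 *\<^sub>R (q - p))) + a)
      (fst (f (p + 1 *\<^sub>R (q - p))) *\<^sub>R snd (f (p + 1 *\<^sub>R (q - p))) + a) (2 * K\<^sup>2 / c * fst (f p))"
  proof (rule joinable_lipschitz_on)
    have "K * b + K * (K * b) \<le> 2 * K\<^sup>2 * b"
      using mult_right_mono[of 1 K "K * b"] K b by (simp add: power2_eq_square)
    also have "\<dots> = 2 * K\<^sup>2 / c * (c * b)" using c by simp
    also have "\<dots> \<le> 2 * K\<^sup>2 / c * fst (f p)"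
      using radius_bounds(1)[OF p] c by (intro mult_left_mono) (auto simp: b_def)
    finally show "(K * b + K * (K * b)) * (1 - 0) \<le> 2 * K\<^sup>2 / c * fst (f p)" by simp
  qed (use X x in auto)
  then show ?thesis using q(2) by simp
qed

text \<open>
  Let \<open>s\<close> be the radius of \<open>p\<close> and \<open>\<delta>\<close> the Euclidean distance. Always \<open>s * gap p q \<le> 3 * \<delta>\<close>. So for a
  small gap the curve from \<open>near_segment\<close>, of length \<open>O(s * gap p q)\<close>, is short enough, and
  for a large gap \<open>s\<close> is itself \<open>O(\<delta>)\<close>, so that a detour through the apex is affordable.
\<close>

lemma joinable_cone:
  assumes X: "\<And>p. p \<in> H d \<Longrightarrow> fst (f p) *\<^sub>R snd (f p) + a \<in> X"
    and p: "p \<in> H (d / 2)" and q: "q \<in> H (d / 2)"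
  shows "joinable X (fst (f p) *\<^sub>R snd (f p) + a) (fst (f q) *\<^sub>R snd (f q) + a)
    ((6 * path_const\<^sup>2 + 2 * K\<^sup>2 / c * (12 * near_const + 1))
      * dist (fst (f p) *\<^sub>R snd (f p) + a) (fst (f q) *\<^sub>R snd (f q) + a))"
    (is "joinable X ?y ?z (?C * ?\<delta>)")
proof -
  define s where "s = fst (f p)"
  define s' where "s' = fst (f q)"
  have pd: "p \<in> H d" and qd: "q \<in> H d" using p q half_ball_mono[of "d / 2" d] d by auto
  have s: "0 \<le> s" "0 \<le> s'"
    using radius_bounds(1)[OF pd] radius_bounds(1)[OF qd] pd qd c
    by (auto simp: s_def s'_def half_ball_def intro: order.trans[rotated])
  have \<delta>: "?\<delta> = norm (s *\<^sub>R snd (f p) - s' *\<^sub>R snd (f q))"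
    by (simp add: dist_norm s_def s'_def)
  have low: "\<bar>s - s'\<bar> \<le> ?\<delta>" "s * norm (snd (f p) - snd (f q)) \<le> 2 * ?\<delta>"
    unfolding \<delta> using unit_polar_lower[OF unit[OF pd] unit[OF qd] s] by auto
  have gap: "s * gap p q \<le> 3 * ?\<delta>"
  proof (cases "s = 0")
    case False
    then have "s * gap p q = \<bar>s - s'\<bar> + s * norm (snd (f p) - snd (f q))"
      by (simp add: gap_def distrib_left flip: s_def s'_def)
    then show ?thesis using low by linarith
  qed simp
  have C: "0 \<le> 6 * path_const\<^sup>2" "0 \<le> 2 * K\<^sup>2 / c * (12 * near_const + 1)" using const_bounds K c by auto
  show ?thesis
  proof (cases "0 < e \<bullet> p \<and> near_const * gap p q \<le> 1 / 2")
    case True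
    then have near: "0 < e \<bullet> p" "near_const * gap p q \<le> 1 / 2" by auto
    note seg = near_segment[OF p near(1) q near(2)]
    have spos: "0 < s" using radius_pos[OF pd near(1)] by (simp add: s_def)
    have "(path_const * s * gap p q + path_const * s * (path_const * gap p q))-lipschitz_on {0..1}
        (\<lambda>t. fst (f (p + t *\<^sub>R (q - p))) *\<^sub>R snd (f (p + t *\<^sub>R (q - p))) + a)"
    proof (rule lipschitz_on_polar[OF seg(2)[folded s_def] seg(3)])
      fix t :: real assume t: "t \<in> {0..1}"
      show "norm (snd (f (p + t *\<^sub>R (q - p)))) = 1" using unit seg(1)[OF t] by blast
      show "\<bar>fst (f (p + t *\<^sub>R (q - p)))\<bar> \<le> path_const * s"
        using seg(1)[OF t] radius_pos[of "p + t *\<^sub>R (q - p)"] by (simp add: s_def)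
    qed (use const_bounds s in auto)
    then have "joinable X (fst (f (p + 0 *\<^sub>R (q - p))) *\<^sub>R snd (f (p + 0 *\<^sub>R (q - p))) + a)
      (fst (f (p + 1 *\<^sub>R (q - p))) *\<^sub>R snd (f (p + 1 *\<^sub>R (q - p))) + a) (?C * ?\<delta>)"
    proof (rule joinable_lipschitz_on)
      have g: "0 \<le> s * gap p q" using spos by (simp add: gap_def s_def)
      have "path_const * s * gap p q + path_const * s * (path_const * gap p q) = (path_const + path_const\<^sup>2) * (s * gap p q)"
        by (simp add: algebra_simps power2_eq_square)
      also have "\<dots> \<le> (path_const\<^sup>2 + path_const\<^sup>2) * (s * gap p q)"
        using const_bounds g mult_left_mono[of 1 path_const path_const]
        by (intro mult_right_mono) (auto simp: power2_eq_square)
      also have "\<dots> \<le> (path_const\<^sup>2 + path_const\<^sup>2) * (3 * ?\<delta>)" using gap by (intro mult_left_mono) auto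
      also have "\<dots> = 6 * path_const\<^sup>2 * ?\<delta>" by simp
      also have "\<dots> \<le> ?C * ?\<delta>" using C by (intro mult_right_mono) auto
      finally show "(path_const * s * gap p q + path_const * s * (path_const * gap p q)) * (1 - 0) \<le> ?C * ?\<delta>" by simp
    qed (use X seg(1) in auto)
    then show ?thesis by simp
  next
    case False
    have "s + s' \<le> (12 * near_const + 1) * ?\<delta>"
    proof (cases "0 < e \<bullet> p")
      case True
      then have "1 / 2 \<le> near_const * gap p q" using False by simp
      then have "s * (1 / 2) \<le> s * (near_const * gap p q)" using s by (intro mult_left_mono)
      also have "\<dots> = near_const * (s * gap p q)" by simp
      also have "\<dots> \<le> near_const * (3 * ?\<delta>)" using gap const_bounds by (intro mult_left_mono) auto
      finally show ?thesis using low(1) by (simp add: algebra_simps)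
    next
      case False
      then have "s = 0" using pd boundary[OF pd] by (simp add: half_ball_def s_def)
      then have "s + s' \<le> ?\<delta>" using low(1) s by simp
      also have "\<dots> \<le> (12 * near_const + 1) * ?\<delta>" using const_bounds by (simp add: distrib_right)
      finally show ?thesis .
    qed
    then have "2 * K\<^sup>2 / c * (s + s') \<le> 2 * K\<^sup>2 / c * ((12 * near_const + 1) * ?\<delta>)"
      using c by (intro mult_left_mono) auto
    also have "\<dots> = 2 * K\<^sup>2 / c * (12 * near_const + 1) * ?\<delta>" by (rule mult.assoc[symmetric])
    also have "\<dots> \<le> ?C * ?\<delta>" using C(1) by (intro mult_right_mono) auto
    finally have "2 * K\<^sup>2 / c * s + 2 * K\<^sup>2 / c * s' \<le> ?C * ?\<delta>" by (simp add: distrib_left)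
    moreover have "joinable X ?y ?z (2 * K\<^sup>2 / c * s + 2 * K\<^sup>2 / c * s')"
      using joinable_trans[OF joinable_cone_apex[OF X pd] joinable_sym[OF joinable_cone_apex[OF X qd]]]
      by (simp add: s_def s'_def)
    ultimately show ?thesis using joinable_mono by blast
  qed
qed

text \<open>
  Near infinity the curve moves away from the boundary up to a fixed height. It is parametrized by the
  reciprocal \<open>R\<close> of the height: as the Euclidean norm is comparable with \<open>R\<close>, the curve
  is then Lipschitz with a fixed constant on an interval of length \<open>O(1 / fst (f p))\<close>.
\<close>

lemma joinable_end_level:
  assumes X: "\<And>p. p \<in> H d \<Longrightarrow> 0 < e \<bullet> p \<Longrightarrow> (1 / fst (f p)) *\<^sub>R snd (f p) \<in> X"
    and p: "p \<in> H (d / 4)" "0 < e \<bullet> p"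
  obtains q where "q \<in> H d" "e \<bullet> q = d / 4"
    "joinable X ((1 / fst (f p)) *\<^sub>R snd (f p)) ((1 / fst (f q)) *\<^sub>R snd (f q))
       (2 * K\<^sup>2 / c\<^sup>2 * (1 / fst (f p)))"
proof -
  define b where "b = e \<bullet> p"
  have pd: "p \<in> H d" using p half_ball_mono[of "d / 4" d] d by auto
  have b: "0 < b" "b \<le> d / 4" using p height_le[OF p(1)] by (auto simp: b_def)
  define x where "x = (\<lambda>R. p + (1 / R - b) *\<^sub>R e)"
  have ex: "e \<bullet> x R = 1 / R" for R using e_e by (simp add: x_def b_def inner_add_right)
  let ?I = "{4 / d .. 1 / b}"
  have I: "0 < R" "1 \<le> R" "b \<le> 1 / R" "1 / R \<le> d / 4" if "R \<in> ?I" for R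
  proof -
    have "1 \<le> 4 / d" "0 < 4 / d" using d by (auto simp: field_simps)
    moreover have "4 / d \<le> R" using that by simp
    ultimately show R: "0 < R" "1 \<le> R" by linarith+
    then show "b \<le> 1 / R" "1 / R \<le> d / 4" using that b d by (auto simp: field_simps)
  qed
  have xH: "x R \<in> H d" if R: "R \<in> ?I" for R
  proof -
    have "x R \<in> H (d / 4 + d / 4)"
      unfolding x_def using I[OF R] b by (intro translate_in_H[OF p(1)]) (auto simp: b_def)
    then show ?thesis using half_ball_mono[of "d / 4 + d / 4" d] d by auto
  qed
  have xpos: "0 < e \<bullet> x R" if "R \<in> ?I" for R using I[OF that] by (simp add: ex)
  have rad: "c / R \<le> fst (f (x R))" "0 < fst (f (x R))" if "R \<in> ?I" for R
    using radius_bounds(1)[OF xH[OF that]] radius_pos[OF xH[OF that] xpos[OF that]] by (auto simp: ex)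
  have diff: "norm (x R - x R') = dist R R' / (R * R')" if "R \<in> ?I" "R' \<in> ?I" for R R'
  proof -
    have "x R - x R' = (1 / R - 1 / R') *\<^sub>R e" by (simp add: x_def algebra_simps)
    then have "norm (x R - x R') = \<bar>1 / R - 1 / R'\<bar>" using E(3) by simp
    also have "1 / R - 1 / R' = (R' - R) / (R * R')" using I(1)[OF that(1)] I(1)[OF that(2)] by (simp add: field_simps)
    finally show ?thesis using I(1)[OF that(1)] I(1)[OF that(2)]
      by (simp add: dist_real_def abs_divide abs_minus_commute abs_mult)
  qed
  have "(2 * K / c\<^sup>2)-lipschitz_on ?I (\<lambda>R. (1 / fst (f (x R))) *\<^sub>R snd (f (x R)))"
  proof (rule lipschitz_onI)
    fix R R' assume RR: "R \<in> ?I" "R' \<in> ?I"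
    define r where "r = fst (f (x R))"
    define r' where "r' = fst (f (x R'))"
    define u where "u = snd (f (x R))"
    define u' where "u' = snd (f (x R'))"
    note pos = I(1,2)[OF RR(1)] I(1,2)[OF RR(2)]
    have r: "0 < r" "0 < r'" "c / R \<le> r" "c / R' \<le> r'"
      using rad[OF RR(1)] rad[OF RR(2)] by (auto simp: r_def r'_def)
    have inv: "1 / r \<le> R / c" "1 / r' \<le> R' / c" using r pos c by (auto simp: field_simps)
    have uu: "norm u = 1" using unit[OF xH[OF RR(1)]] by (simp add: u_def)
    have "(1 / r) *\<^sub>R u - (1 / r') *\<^sub>R u' = (1 / r - 1 / r') *\<^sub>R u + (1 / r') *\<^sub>R (u - u')"
      by (simp add: algebra_simps)
    then have "dist ((1 / r) *\<^sub>R u) ((1 / r') *\<^sub>R u') \<le> \<bar>1 / r - 1 / r'\<bar> + 1 / r' * norm (u - u')"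
      using norm_triangle_ineq[of "(1 / r - 1 / r') *\<^sub>R u" "(1 / r') *\<^sub>R (u - u')"] uu r
      by (simp add: dist_norm)
    also have "\<bar>1 / r - 1 / r'\<bar> = (1 / r) * (1 / r') * \<bar>r - r'\<bar>"
    proof -
      have "1 / r - 1 / r' = (1 / r) * (1 / r') * (r' - r)" using r by (simp add: field_simps)
      then show ?thesis using r by (simp add: abs_mult abs_minus_commute)
    qed
    also have "(1 / r) * (1 / r') * \<bar>r - r'\<bar> + 1 / r' * norm (u - u')
        \<le> (R / c) * (R' / c) * (K * (dist R R' / (R * R'))) + R' / c * (K * (dist R R' / (R * R')))"
      using inv r pos c lip_fst[OF H_cball[OF xH[OF RR(1)]] H_cball[OF xH[OF RR(2)]]]
        lip_snd[OF H_cball[OF xH[OF RR(1)]] H_cball[OF xH[OF RR(2)]]]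
      unfolding diff[OF RR] r_def[symmetric] r'_def[symmetric] u_def[symmetric] u'_def[symmetric]
      by (intro add_mono mult_mono) auto
    also have "\<dots> = (1 / c\<^sup>2 + 1 / (c * R)) * (K * dist R R')"
      using pos c by (simp add: field_simps power2_eq_square)
    also have "\<dots> \<le> (1 / c\<^sup>2 + 1 / c\<^sup>2) * (K * dist R R')"
    proof -
      have "c * c \<le> c * R" using c pos by (intro mult_left_mono) auto
      then have "1 / (c * R) \<le> 1 / c\<^sup>2" using c pos by (simp add: frac_le power2_eq_square)
      then show ?thesis using K by (intro mult_right_mono) auto
    qed
    finally show "dist ((1 / fst (f (x R))) *\<^sub>R snd (f (x R))) ((1 / fst (f (x R'))) *\<^sub>R snd (f (x R')))
        \<le> 2 * K / c\<^sup>2 * dist R R'"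
      by (simp add: r_def r'_def u_def u'_def)
  qed (use K in simp)
  then have "joinable X ((1 / fst (f (x (4 / d)))) *\<^sub>R snd (f (x (4 / d))))
      ((1 / fst (f (x (1 / b)))) *\<^sub>R snd (f (x (1 / b)))) (2 * K\<^sup>2 / c\<^sup>2 * (1 / fst (f p)))"
  proof (rule joinable_lipschitz_on)
    show "4 / d \<le> 1 / b" using b d by (simp add: field_simps)
    have "1 / b \<le> K / fst (f p)"
      using radius_bounds(2)[OF pd] radius_pos[OF pd p(2)] b by (simp add: field_simps b_def)
    moreover have "0 \<le> 4 / d" using d by simp
    ultimately have "1 / b - 4 / d \<le> K / fst (f p)" by linarith
    then have "2 * K / c\<^sup>2 * (1 / b - 4 / d) \<le> 2 * K / c\<^sup>2 * (K / fst (f p))"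
      using K by (intro mult_left_mono) auto
    then show "2 * K / c\<^sup>2 * (1 / b - 4 / d) \<le> 2 * K\<^sup>2 / c\<^sup>2 * (1 / fst (f p))"
      by (simp add: power2_eq_square)
  qed (use X xH xpos in blast)
  moreover have "x (1 / b) = p" by (simp add: x_def)
  moreover have "4 / d \<in> ?I" using b d by (simp add: field_simps)
  ultimately show thesis
    using that[of "x (4 / d)"] xH[of "4 / d"] ex[of "4 / d"] by (auto intro: joinable_sym)
qed

text \<open>
  The points at the fixed height are bounded in norm, so the remaining way to \<open>x0\<close> has bounded length. The
  bound is absorbed into \<open>C\<close> since \<open>1 / fst (f p)\<close> is bounded below.
\<close>

lemma joinable_end_base:
  assumes X: "\<And>p. p \<in> H d \<Longrightarrow> 0 < e \<bullet> p \<Longrightarrow> (1 / fst (f p)) *\<^sub>R snd (f p) \<in> X"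
    and bdd: "\<And>r. \<exists>L. \<forall>x\<in>X \<inter> cball 0 r. joinable X x x0 L"
  obtains C where "0 \<le> C"
    "\<And>p. p \<in> H (d / 4) \<Longrightarrow> 0 < e \<bullet> p \<Longrightarrow>
       joinable X ((1 / fst (f p)) *\<^sub>R snd (f p)) x0 (C * (1 / fst (f p)))"
proof -
  obtain L where L: "\<And>x. x \<in> X \<Longrightarrow> norm x \<le> 4 / (c * d) \<Longrightarrow> joinable X x x0 L"
  proof -
    obtain L where "\<forall>x\<in>X \<inter> cball 0 (4 / (c * d)). joinable X x x0 L" using bdd by blast
    then show ?thesis by (intro that[of L]) auto
  qed
  have "joinable X ((1 / fst (f p)) *\<^sub>R snd (f p)) x0 ((2 * K\<^sup>2 / c\<^sup>2 + K * \<bar>L\<bar>) * (1 / fst (f p)))"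
    if p: "p \<in> H (d / 4)" "0 < e \<bullet> p" for p
  proof -
    have pd: "p \<in> H d" using p half_ball_mono[of "d / 4" d] d by auto
    obtain q where q: "q \<in> H d" "e \<bullet> q = d / 4" and
      pq: "joinable X ((1 / fst (f p)) *\<^sub>R snd (f p)) ((1 / fst (f q)) *\<^sub>R snd (f q))
        (2 * K\<^sup>2 / c\<^sup>2 * (1 / fst (f p)))"
      using joinable_end_level[OF X p] by blast
    have "0 < fst (f q)" "c * (d / 4) \<le> fst (f q)"
      using radius_pos[OF q(1)] radius_bounds(1)[OF q(1)] q(2) d by auto
    then have "norm ((1 / fst (f q)) *\<^sub>R snd (f q)) \<le> 4 / (c * d)"
      using unit[OF q(1)] c d by (simp add: field_simps)
    then have "joinable X ((1 / fst (f q)) *\<^sub>R snd (f q)) x0 L"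
      using q d by (intro L X) auto
    then have "joinable X ((1 / fst (f p)) *\<^sub>R snd (f p)) x0 (2 * K\<^sup>2 / c\<^sup>2 * (1 / fst (f p)) + L)"
      using joinable_trans[OF pq] by blast
    moreover have "L \<le> K * \<bar>L\<bar> * (1 / fst (f p))"
    proof -
      have "1 \<le> K / fst (f p)" using radius_le[OF pd] radius_pos[OF pd p(2)] by simp
      then have "\<bar>L\<bar> * 1 \<le> \<bar>L\<bar> * (K / fst (f p))" by (intro mult_left_mono) auto
      then show ?thesis by (simp add: mult_ac)
    qed
    ultimately show ?thesis
      by (elim joinable_mono) (simp add: distrib_right add_divide_distrib)
  qed
  then show thesis using K by (intro that[of "2 * K\<^sup>2 / c\<^sup>2 + K * \<bar>L\<bar>"]) auto
qed

text \<open>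
  As in \<open>joinable_cone\<close>, with the Euclidean radii \<open>1 / s\<close> and \<open>1 / s'\<close> and the base point in place of the apex.
  The gap is measured relative to \<open>s\<close>, so the case \<open>s' > 2 s\<close>, where the radii already
  differ by at least half of the larger one, is treated apart.
\<close>

lemma joinable_end:
  assumes X: "\<And>p. p \<in> H d \<Longrightarrow> 0 < e \<bullet> p \<Longrightarrow> (1 / fst (f p)) *\<^sub>R snd (f p) \<in> X"
    and base: "0 \<le> C" "\<And>p. p \<in> H (d / 4) \<Longrightarrow> 0 < e \<bullet> p \<Longrightarrow>
       joinable X ((1 / fst (f p)) *\<^sub>R snd (f p)) x0 (C * (1 / fst (f p)))"
    and p: "p \<in> H (d / 4)" "0 < e \<bullet> p" and q: "q \<in> H (d / 4)" "0 < e \<bullet> q"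
  shows "joinable X ((1 / fst (f p)) *\<^sub>R snd (f p)) ((1 / fst (f q)) *\<^sub>R snd (f q))
    ((2 * path_const ^ 3 * (path_const + 2) + C * (16 * near_const + 3))
      * dist ((1 / fst (f p)) *\<^sub>R snd (f p)) ((1 / fst (f q)) *\<^sub>R snd (f q)))"
    (is "joinable X ?y ?z (?C * ?\<delta>)")
proof -
  define s where "s = fst (f p)"
  define s' where "s' = fst (f q)"
  have sub: "H (d / 4) \<subseteq> H d" "H (d / 4) \<subseteq> H (d / 2)"
    using half_ball_mono[of "d / 4" d E e p0] half_ball_mono[of "d / 4" "d / 2" E e p0] d by auto
  have pd: "p \<in> H d" "p \<in> H (d / 2)" and qd: "q \<in> H d" "q \<in> H (d / 2)"
    using p q sub by auto
  have s: "0 < s" "0 < s'" using radius_pos[OF pd(1) p(2)] radius_pos[OF qd(1) q(2)]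
    by (auto simp: s_def s'_def)
  have \<delta>: "?\<delta> = norm ((1 / s) *\<^sub>R snd (f p) - (1 / s') *\<^sub>R snd (f q))"
    by (simp add: dist_norm s_def s'_def)
  have low: "\<bar>1 / s - 1 / s'\<bar> \<le> ?\<delta>" "1 / s * norm (snd (f p) - snd (f q)) \<le> 2 * ?\<delta>"
    unfolding \<delta> using unit_polar_lower[OF unit[OF pd(1)] unit[OF qd(1)], of "1 / s" "1 / s'"] s by auto
  have g: "0 \<le> gap p q" using s by (simp add: gap_def s_def)
  have gap: "1 / s * gap p q \<le> (M + 2) * ?\<delta>" if M: "s' \<le> M * s" "0 \<le> M" for M
  proof -
    have "s - s' = (1 / s' - 1 / s) * (s * s')"
      using s by (simp add: field_simps)
    then have "\<bar>s - s'\<bar> = \<bar>1 / s - 1 / s'\<bar> * (s * s')"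
      using s by (simp add: abs_mult abs_minus_commute)
    then have "1 / s * (\<bar>s - s'\<bar> / s) = \<bar>1 / s - 1 / s'\<bar> * (s' / s)"
      using s by (simp add: field_simps)
    also have "\<dots> \<le> ?\<delta> * M" using low(1) M s by (intro mult_mono) (auto simp: field_simps)
    finally have "1 / s * (\<bar>s - s'\<bar> / s) \<le> M * ?\<delta>" by (simp add: mult.commute)
    moreover have "1 / s * gap p q = 1 / s * (\<bar>s - s'\<bar> / s) + 1 / s * norm (snd (f p) - snd (f q))"
      by (simp add: gap_def distrib_left add_divide_distrib flip: s_def s'_def)
    ultimately show ?thesis using low(2) by (simp add: distrib_right)
  qed
  have Cs: "0 \<le> 2 * path_const ^ 3 * (path_const + 2)" "0 \<le> C * (16 * near_const + 3)" using const_bounds base(1) by auto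
  show ?thesis
  proof (cases "near_const * gap p q \<le> 1 / 2")
    case True
    note seg = near_segment[OF pd(2) p(2) qd(2) True]
    have path_const: "1 \<le> path_const" using const_bounds by linarith
    have m: "0 < s / path_const" using s path_const by simp
    let ?\<rho> = "\<lambda>t. fst (f (p + t *\<^sub>R (q - p)))"
    have recip: "(path_const * s * gap p q / (s / path_const)\<^sup>2)-lipschitz_on {0..1} (\<lambda>t. 1 / ?\<rho> t)"
      using seg(1) by (intro lipschitz_on_reciprocal[OF seg(2)[folded s_def] m]) (auto simp: s_def)
    have "(path_const * s * gap p q / (s / path_const)\<^sup>2 + 1 / (s / path_const) * (path_const * gap p q))-lipschitz_on {0..1}
        (\<lambda>t. (1 / ?\<rho> t) *\<^sub>R snd (f (p + t *\<^sub>R (q - p))) + 0)"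
    proof (rule lipschitz_on_polar[OF recip seg(3)])
      fix t :: real assume t: "t \<in> {0..1}"
      show "norm (snd (f (p + t *\<^sub>R (q - p)))) = 1" using unit seg(1)[OF t] by blast
      have "s / path_const \<le> ?\<rho> t" using seg(1)[OF t] by (simp add: s_def)
      then show "\<bar>1 / ?\<rho> t\<bar> \<le> 1 / (s / path_const)" using m by (simp add: frac_le del: divide_divide_eq_right)
    qed (use m in \<open>simp only: zero_le_divide_1_iff less_imp_le\<close>)
    then have "joinable X ((1 / fst (f (p + 0 *\<^sub>R (q - p)))) *\<^sub>R snd (f (p + 0 *\<^sub>R (q - p))) + 0)
      ((1 / fst (f (p + 1 *\<^sub>R (q - p)))) *\<^sub>R snd (f (p + 1 *\<^sub>R (q - p))) + 0) (?C * ?\<delta>)"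
    proof (rule joinable_lipschitz_on)
      have "s' \<le> path_const * s" using seg(1)[of 1] by (simp add: s_def s'_def)
      then have gap': "1 / s * gap p q \<le> (path_const + 2) * ?\<delta>" using path_const by (intro gap) auto
      have "path_const * s * gap p q / (s / path_const)\<^sup>2 + 1 / (s / path_const) * (path_const * gap p q)
          = (path_const ^ 3 + path_const\<^sup>2) * (1 / s * gap p q)"
        using s path_const by (simp add: field_simps power2_eq_square power3_eq_cube)
      also have "\<dots> \<le> (path_const ^ 3 + path_const ^ 3) * (1 / s * gap p q)"
        using path_const g s by (intro mult_right_mono add_left_mono power_increasing) auto
      also have "\<dots> \<le> (path_const ^ 3 + path_const ^ 3) * ((path_const + 2) * ?\<delta>)"
        using gap' path_const by (intro mult_left_mono) auto
      also have "\<dots> = 2 * path_const ^ 3 * (path_const + 2) * ?\<delta>" by (simp add: algebra_simps)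
      also have "\<dots> \<le> ?C * ?\<delta>" using Cs by (intro mult_right_mono) auto
      finally show "(path_const * s * gap p q / (s / path_const)\<^sup>2 + 1 / (s / path_const) * (path_const * gap p q)) * (1 - 0) \<le> ?C * ?\<delta>"
        by simp
    qed (use X seg(1) in auto)
    then show ?thesis by simp
  next
    case False
    have "1 / s + 1 / s' \<le> (16 * near_const + 3) * ?\<delta>"
    proof (cases "s' \<le> 2 * s")
      case True
      have "1 / s * (1 / 2) \<le> 1 / s * (near_const * gap p q)" using False s by (intro mult_left_mono) auto
      also have "\<dots> = near_const * (1 / s * gap p q)" by simp
      also have "\<dots> \<le> near_const * ((2 + 2) * ?\<delta>)" using gap[OF True] const_bounds by (intro mult_left_mono) auto
      finally have "1 / s \<le> 8 * (near_const * ?\<delta>)" by simp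
      moreover have "0 \<le> near_const * ?\<delta>" using const_bounds by simp
      ultimately show ?thesis using low(1) zero_le_dist[of ?y ?z] unfolding distrib_right mult.assoc by linarith
    next
      case False
      then have "1 / s' \<le> 1 / (2 * s)" using s by (intro divide_left_mono) auto
      then have "1 / s' \<le> 1 / 2 * (1 / s)" by simp
      moreover have "0 \<le> near_const * ?\<delta>" using const_bounds by simp
      ultimately show ?thesis using low(1) unfolding distrib_right mult.assoc by linarith
    qed
    then have "C * (1 / s + 1 / s') \<le> C * ((16 * near_const + 3) * ?\<delta>)" using base(1) by (rule mult_left_mono)
    also have "\<dots> \<le> ?C * ?\<delta>"
      using Cs(1) mult_right_mono[of "C * (16 * near_const + 3)" ?C ?\<delta>] by (simp add: mult.assoc)
    finally have "C * (1 / s) + C * (1 / s') \<le> ?C * ?\<delta>" by (simp add: distrib_left)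
    moreover have "joinable X ?y ?z (C * (1 / s) + C * (1 / s'))"
      using joinable_trans[OF base(2)[OF p] joinable_sym[OF base(2)[OF q]]] by (simp add: s_def s'_def)
    ultimately show ?thesis using joinable_mono by blast
  qed
qed

end

section \<open>Stereographic charts of the collar\<close>

text \<open>
  An algebra of functions that is closed under directional derivatives consists of smooth
  functions. This one contains the coordinates of the inverse stereographic projection, extended
  trivially in the radial coordinate.
\<close>

inductive rational_fun :: "(real \<times> 'a::euclidean_space \<Rightarrow> real) \<Rightarrow> bool" where
  const: "rational_fun (\<lambda>z. c)"
| coord: "rational_fun (\<lambda>z. z \<bullet> w)"
| sq: "rational_fun (\<lambda>z. snd z \<bullet> snd z)"
| recip: "rational_fun (\<lambda>z. 1 / (1 + snd z \<bullet> snd z))"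
| add: "rational_fun f \<Longrightarrow> rational_fun g \<Longrightarrow> rational_fun (\<lambda>z. f z + g z)"
| mult: "rational_fun f \<Longrightarrow> rational_fun g \<Longrightarrow> rational_fun (\<lambda>z. f z * g z)"

lemma rational_fun_derivative:
  fixes h :: "real \<times> 'a::euclidean_space \<Rightarrow> real"
  assumes "rational_fun h"
  shows "\<exists>h'. (\<forall>z. (h has_derivative h' z) (at z)) \<and> (\<forall>w. rational_fun (\<lambda>z. h' z w))"
  using assms
proof induction
  case (const c)
  show ?case by (intro exI[of _ "\<lambda>z w. 0"]) (auto intro: rational_fun.const)
next
  case (coord w)
  show ?case
    by (intro exI[of _ "\<lambda>z v. v \<bullet> w"]) (auto intro: rational_fun.const has_derivative_inner_left)
next
  case sq
  have "rational_fun (\<lambda>z :: real \<times> 'a. 2 * (z \<bullet> (0, snd w)))" for w :: "real \<times> 'a"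
    by (intro rational_fun.intros)
  moreover have "((\<lambda>z :: real \<times> 'a. snd z \<bullet> snd z) has_derivative (\<lambda>w. 2 * (z \<bullet> (0, snd w)))) (at z)" for z
    by (rule derivative_eq_intros refl)+ (simp add: inner_commute fun_eq_iff inner_prod_def)
  ultimately show ?case
    by (intro exI[of _ "\<lambda>z w. 2 * (z \<bullet> (0, snd w))"]) blast
next
  case recip
  have pos: "1 + snd z \<bullet> snd z \<noteq> 0" for z :: "real \<times> 'a"
    using inner_ge_zero[of "snd z"] by (metis add_nonneg_eq_0_iff zero_le_one zero_neq_one)
  have "rational_fun (\<lambda>z :: real \<times> 'a. (- 2) * (z \<bullet> (0, snd w))
      * (1 / (1 + snd z \<bullet> snd z) * (1 / (1 + snd z \<bullet> snd z))))" for w :: "real \<times> 'a"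
    by (intro rational_fun.intros)
  then have "rational_fun (\<lambda>z :: real \<times> 'a. (- 2) * (snd z \<bullet> snd w)
      * (1 / (1 + snd z \<bullet> snd z) * (1 / (1 + snd z \<bullet> snd z))))" for w :: "real \<times> 'a"
    by (simp add: inner_prod_def)
  moreover have "((\<lambda>z :: real \<times> 'a. 1 / (1 + snd z \<bullet> snd z)) has_derivative
      (\<lambda>w. (- 2) * (snd z \<bullet> snd w) * (1 / (1 + snd z \<bullet> snd z) * (1 / (1 + snd z \<bullet> snd z))))) (at z)"
    for z :: "real \<times> 'a"
    by (rule derivative_eq_intros | simp add: pos)+
      (simp add: inner_commute fun_eq_iff field_simps)
  ultimately show ?case
    by (intro exI[of _ "\<lambda>z w. (- 2) * (snd z \<bullet> snd w)
      * (1 / (1 + snd z \<bullet> snd z) * (1 / (1 + snd z \<bullet> snd z)))"]) blast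
next
  case (add f g)
  then obtain f' g' where
    "\<forall>z. (f has_derivative f' z) (at z)" "\<forall>w. rational_fun (\<lambda>z. f' z w)"
    "\<forall>z. (g has_derivative g' z) (at z)" "\<forall>w. rational_fun (\<lambda>z. g' z w)" by blast
  then show ?case
    by (intro exI[of _ "\<lambda>z w. f' z w + g' z w"]) (auto intro: has_derivative_add rational_fun.add simp del: split_paired_All)
next
  case (mult f g)
  then obtain f' g' where
    "\<forall>z. (f has_derivative f' z) (at z)" "\<forall>w. rational_fun (\<lambda>z. f' z w)"
    "\<forall>z. (g has_derivative g' z) (at z)" "\<forall>w. rational_fun (\<lambda>z. g' z w)" by blast
  have "rational_fun (\<lambda>z. f z * g' z w + f' z w * g z)" for w
    using mult.hyps \<open>\<forall>w. rational_fun (\<lambda>z. f' z w)\<close> \<open>\<forall>w. rational_fun (\<lambda>z. g' z w)\<close>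
    by (intro rational_fun.add rational_fun.mult) blast+
  moreover have "((\<lambda>z. f z * g z) has_derivative (\<lambda>w. f z * g' z w + f' z w * g z)) (at z)" for z
    using \<open>\<forall>z. (f has_derivative f' z) (at z)\<close> \<open>\<forall>z. (g has_derivative g' z) (at z)\<close>
    by (intro has_derivative_mult) blast+
  ultimately show ?case by (intro exI[of _ "\<lambda>z w. f z * g' z w + f' z w * g z"]) blast
qed

lemma smooth_on_rational:
  fixes f :: "real \<times> 'a::euclidean_space \<Rightarrow> 'b::euclidean_space"
  assumes "\<And>i. i \<in> Basis \<Longrightarrow> rational_fun (\<lambda>z. f z \<bullet> i)"
  shows "smooth_on f U"
proof -
  have "times_differentiable_on k f U" if "\<And>i. i \<in> Basis \<Longrightarrow> rational_fun (\<lambda>z. f z \<bullet> i)"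
    for k and f :: "real \<times> 'a \<Rightarrow> 'b"
    using that
  proof (induction k arbitrary: f)
    case (0 f)
    have "continuous_on U (\<lambda>z. f z \<bullet> i)" if i: "i \<in> Basis" for i
    proof -
      obtain h' where "\<And>z. ((\<lambda>z. f z \<bullet> i) has_derivative h' z) (at z)"
        using rational_fun_derivative[OF 0[OF i]] by blast
      then show ?thesis
        by (intro continuous_at_imp_continuous_on ballI) (rule has_derivative_continuous)
    qed
    then show ?case by (simp add: continuous_on_componentwise[of U f])
  next
    case (Suc k f)
    obtain h' where h': "\<And>i z. i \<in> Basis \<Longrightarrow> ((\<lambda>z. f z \<bullet> i) has_derivative h' i z) (at z)"
      "\<And>i w. i \<in> Basis \<Longrightarrow> rational_fun (\<lambda>z. h' i z w)"
      using rational_fun_derivative[OF Suc.prems] by metis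
    define f' where "f' = (\<lambda>z w. \<Sum>i\<in>Basis. h' i z w *\<^sub>R i)"
    have f'_i: "f' z w \<bullet> i = h' i z w" if "i \<in> Basis" for z w i
      using that by (simp add: f'_def inner_sum_left inner_Basis if_distrib cong: if_cong)
    have D: "(f has_derivative f' z) (at z)" for z
      using h'(1) by (subst has_derivative_componentwise_within) (simp add: f'_i)
    have "frechet_derivative f (at z) = f' z" for z
      using frechet_derivative_at[OF D] by simp
    moreover have "times_differentiable_on k (\<lambda>z. f' z w) U" for w
      using h'(2) by (intro Suc.IH) (simp add: f'_i)
    moreover have "f differentiable (at z)" for z
      using D by (rule differentiableI)
    ultimately show ?case by simp
  qed
  then show ?thesis using assms by (auto simp: smooth_on_def)
qed

text \<open>
  Inverse stereographic projection from the pole \<open>- u\<close>; it sends the orthogonal complement of \<open>u\<close> to the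
  sphere and 0 to \<open>u\<close>.
\<close>

definition stereo :: "'a::euclidean_space \<Rightarrow> 'a \<Rightarrow> 'a" where
  "stereo u v = (1 / (1 + v \<bullet> v)) *\<^sub>R (2 *\<^sub>R v + (1 - v \<bullet> v) *\<^sub>R u)"

definition unstereo :: "'a::euclidean_space \<Rightarrow> 'a \<Rightarrow> 'a" where
  "unstereo u w = (1 / (1 + w \<bullet> u)) *\<^sub>R (w - (w \<bullet> u) *\<^sub>R u)"

lemma one_plus_inner_pos: "0 < 1 + v \<bullet> (v :: 'a::real_inner)"
  by (simp add: add_pos_nonneg)

lemma stereo_inner:
  assumes "norm u = 1" "v \<bullet> u = 0"
  shows "stereo u v \<bullet> u = (1 - v \<bullet> v) / (1 + v \<bullet> v)"
  using assms by (simp add: stereo_def inner_add_left norm_eq_1)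

lemma stereo_sphere:
  assumes "norm u = 1" "v \<bullet> u = 0"
  shows "norm (stereo u v) = 1" "stereo u v \<bullet> u \<noteq> - 1" "unstereo u (stereo u v) = v"
proof -
  have u: "u \<bullet> u = 1" "u \<bullet> v = 0" using assms by (auto simp: norm_eq_1 inner_commute)
  have pos: "0 < 1 + v \<bullet> v" by (rule one_plus_inner_pos)
  have "(2 *\<^sub>R v + (1 - v \<bullet> v) *\<^sub>R u) \<bullet> (2 *\<^sub>R v + (1 - v \<bullet> v) *\<^sub>R u) = (1 + v \<bullet> v) * (1 + v \<bullet> v)"
    using u assms(2) by (simp add: inner_add_left inner_add_right algebra_simps)
  then show "norm (stereo u v) = 1"
    using pos by (simp add: stereo_def norm_eq_sqrt_inner[of "2 *\<^sub>R v + (1 - v \<bullet> v) *\<^sub>R u"])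
  show "stereo u v \<bullet> u \<noteq> - 1"
    using pos unfolding stereo_inner[OF assms] by (simp add: field_simps)
  have "1 + stereo u v \<bullet> u = 2 / (1 + v \<bullet> v)"
    using pos unfolding stereo_inner[OF assms] by (simp add: field_simps)
  moreover have "stereo u v - (stereo u v \<bullet> u) *\<^sub>R u = (2 / (1 + v \<bullet> v)) *\<^sub>R v"
    unfolding stereo_inner[OF assms] by (simp add: stereo_def scaleR_add_right)
  ultimately have "unstereo u (stereo u v) = (1 / (2 / (1 + v \<bullet> v)) * (2 / (1 + v \<bullet> v))) *\<^sub>R v"
    unfolding unstereo_def[of u "stereo u v"] by (simp only: scaleR_scaleR)
  also have "1 / (2 / (1 + v \<bullet> v)) * (2 / (1 + v \<bullet> v)) = 1" using pos by simp
  finally show "unstereo u (stereo u v) = v" by simp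
qed

lemma unstereo_sphere:
  assumes u: "norm u = 1" and w: "norm w = 1" "w \<bullet> u \<noteq> - 1"
  shows "unstereo u w \<bullet> u = 0" "stereo u (unstereo u w) = w"
proof -
  define t where "t = w \<bullet> u"
  have uu: "u \<bullet> u = 1" "w \<bullet> w = 1" "u \<bullet> w = t" using u w by (auto simp: norm_eq_1 inner_commute t_def)
  have t: "1 + t \<noteq> 0" using w(2) by (auto simp: t_def)
  show "unstereo u w \<bullet> u = 0"
    using uu by (simp add: unstereo_def inner_diff_left)
  have "(w - t *\<^sub>R u) \<bullet> (w - t *\<^sub>R u) = (1 - t) * (1 + t)"
    using uu by (simp add: inner_diff_left inner_diff_right algebra_simps flip: t_def)
  then have vv: "unstereo u w \<bullet> unstereo u w = (1 - t) / (1 + t)"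
    using t by (simp add: unstereo_def flip: t_def)
  have "1 + unstereo u w \<bullet> unstereo u w = 2 / (1 + t)" "1 - unstereo u w \<bullet> unstereo u w = 2 * t / (1 + t)"
    unfolding vv using t by (simp_all add: field_simps)
  then have "stereo u (unstereo u w) =
      ((1 + t) / 2) *\<^sub>R (2 *\<^sub>R ((1 / (1 + t)) *\<^sub>R (w - t *\<^sub>R u)) + (2 * t / (1 + t)) *\<^sub>R u)"
    using t by (simp add: stereo_def unstereo_def[of u w] flip: t_def)
  also have "\<dots> = ((1 + t) / 2 * (2 * (1 / (1 + t)))) *\<^sub>R (w - t *\<^sub>R u) + ((1 + t) / 2 * (2 * t / (1 + t))) *\<^sub>R u"
    by (simp only: scaleR_add_right scaleR_scaleR)
  also have "(1 + t) / 2 * (2 * (1 / (1 + t))) = 1" using t by simp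
  also have "(1 + t) / 2 * (2 * t / (1 + t)) = t" using t by simp
  also have "1 *\<^sub>R (w - t *\<^sub>R u) + t *\<^sub>R u = w" by simp
  finally show "stereo u (unstereo u w) = w" .
qed

definition collar_chart :: "'a::euclidean_space \<Rightarrow> real \<times> 'a \<Rightarrow> real \<times> 'a" where
  "collar_chart u z = (fst z, stereo u (snd z))"

definition collar_chart_inv :: "'a::euclidean_space \<Rightarrow> real \<times> 'a \<Rightarrow> real \<times> 'a" where
  "collar_chart_inv u z = (fst z, unstereo u (snd z))"

definition hyperplane :: "'a::euclidean_space \<Rightarrow> (real \<times> 'a) set" where
  "hyperplane u = {z. snd z \<bullet> u = 0}"

lemma subspace_hyperplane: "subspace (hyperplane u)"
  by (auto simp: hyperplane_def subspace_def inner_add_left)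

lemma collar_chart_inv_left: "norm u = 1 \<Longrightarrow> z \<in> hyperplane u \<Longrightarrow> collar_chart_inv u (collar_chart u z) = z"
  by (simp add: collar_chart_def collar_chart_inv_def hyperplane_def stereo_sphere)

lemma smooth_on_collar_chart: "smooth_on (collar_chart u) V"
proof (rule smooth_on_rational)
  fix i :: "real \<times> 'a"
  have "rational_fun (\<lambda>z. z \<bullet> (fst i, 0)
      + (1 / (1 + snd z \<bullet> snd z)) * (2 * (z \<bullet> (0, snd i)) + (1 + (- 1) * (snd z \<bullet> snd z)) * (u \<bullet> snd i)))"
    by (intro rational_fun.intros)
  moreover have "(\<lambda>z. z \<bullet> (fst i, 0)
      + (1 / (1 + snd z \<bullet> snd z)) * (2 * (z \<bullet> (0, snd i)) + (1 + (- 1) * (snd z \<bullet> snd z)) * (u \<bullet> snd i)))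
    = (\<lambda>z. collar_chart u z \<bullet> i)"
    by (auto simp: collar_chart_def stereo_def inner_prod_def inner_add_left fun_eq_iff)
  ultimately show "rational_fun (\<lambda>z. collar_chart u z \<bullet> i)" by simp
qed

lemma smooth_on_continuous: "smooth_on f V \<Longrightarrow> continuous_on V f"
  unfolding smooth_on_def by (metis times_differentiable_on.simps(1))

lemma smooth_on_has_derivative:
  "smooth_on f V \<Longrightarrow> p \<in> V \<Longrightarrow> (f has_derivative frechet_derivative f (at p)) (at p)"
  unfolding smooth_on_def frechet_derivative_works[symmetric] 
  by (metis times_differentiable_on.simps(2))

lemma has_derivative_along_line:
  assumes "(f has_derivative D) (at p)" "\<And>t. f (p + t *\<^sub>R v) = f p + t *\<^sub>R w"
  shows "D v = w"
proof -
  have "((\<lambda>t. f (p + t *\<^sub>R v)) has_derivative (\<lambda>s. D (s *\<^sub>R v))) (at 0)"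
    by (rule has_derivative_compose[where f = "\<lambda>t. p + t *\<^sub>R v"])
      (use assms(1) in \<open>auto intro!: derivative_eq_intros\<close>)
  moreover have "((\<lambda>t. f (p + t *\<^sub>R v)) has_derivative (\<lambda>s. s *\<^sub>R w)) (at 0)"
    unfolding assms(2) by (auto intro!: derivative_eq_intros)
  ultimately have "(\<lambda>s. D (s *\<^sub>R v)) = (\<lambda>s. s *\<^sub>R w)" by (rule has_derivative_unique)
  from fun_cong[OF this, of 1] show ?thesis by simp
qed

text \<open>
  Differentiating \<open>g (f x) = x\<close> along lines in \<open>E\<close> shows that \<open>G\<close> is a left inverse of \<open>D\<close> on \<open>E\<close>, although
  the identity holds on \<open>E\<close> only.
\<close>

lemma inj_on_derivative_left_inverse:
  assumes f: "(f has_derivative D) (at p)" and g: "(g has_derivative G) (at (f p))"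
    and E: "subspace E" "p \<in> E" and gf: "\<And>x. x \<in> E \<Longrightarrow> g (f x) = x"
  shows "inj_on D E"
proof -
  have "((\<lambda>x. g (f x)) has_derivative (\<lambda>v. G (D v))) (at p)"
    using f g by (rule has_derivative_compose)
  then have "G (D v) = v" if "v \<in> E" for v
    by (rule has_derivative_along_line) (use that E gf in \<open>simp add: subspace_add subspace_scale\<close>)
  then show ?thesis by (rule inj_on_inverseI)
qed

lemma collar_chart_inv_differentiable:
  assumes "snd z \<bullet> u \<noteq> - 1"
  shows "\<exists>G. (collar_chart_inv u has_derivative G) (at z)"
proof -
  have "(\<lambda>z. (fst z, (1 / (1 + snd z \<bullet> u)) *\<^sub>R (snd z - (snd z \<bullet> u) *\<^sub>R u))) differentiable (at z)"
    unfolding differentiable_def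
    by (rule exI, (rule derivative_eq_intros refl | use assms in force)+)
  then show ?thesis unfolding differentiable_def collar_chart_inv_def[abs_def] unstereo_def .
qed

lemma collar_chart_inv_isCont: "snd z \<bullet> u \<noteq> - 1 \<Longrightarrow> isCont (collar_chart_inv u) z"
  using collar_chart_inv_differentiable has_derivative_continuous by blast

lemma local_param_collar:
  assumes T: "open T" and u: "norm u = 1"
  shows "local_param (({0..} \<inter> T) \<times> sphere 0 1) (hyperplane u) (1, 0) (T \<times> UNIV) (collar_chart u)"
    and "chart_dom (hyperplane u) (1, 0) (T \<times> UNIV) = {z. snd z \<bullet> u = 0 \<and> fst z \<in> T \<and> 0 \<le> fst z}"
proof -
  let ?P = "({0..} \<inter> T) \<times> sphere (0 :: 'a) 1"
  show dom: "chart_dom (hyperplane u) (1, 0) (T \<times> UNIV) = {z. snd z \<bullet> u = 0 \<and> fst z \<in> T \<and> 0 \<le> fst z}"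
    by (auto simp: chart_dom_def hyperplane_def inner_prod_def)
  let ?C = "chart_dom (hyperplane u) (1, 0) (T \<times> UNIV)"
  have img: "collar_chart u ` ?C = ?P \<inter> {z. snd z \<bullet> u \<noteq> - 1}"
  proof (intro equalityI subsetI)
    fix z assume "z \<in> collar_chart u ` ?C"
    then show "z \<in> ?P \<inter> {z. snd z \<bullet> u \<noteq> - 1}"
      unfolding dom using stereo_sphere[OF u] by (auto simp: collar_chart_def)
  next
    fix z assume z: "z \<in> ?P \<inter> {z. snd z \<bullet> u \<noteq> - 1}"
    then have "collar_chart u (collar_chart_inv u z) = z" "collar_chart_inv u z \<in> ?C"
      unfolding dom using unstereo_sphere[OF u, of "snd z"]
      by (auto simp: collar_chart_def collar_chart_inv_def)
    then show "z \<in> collar_chart u ` ?C" by (metis imageI)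
  qed
  have "open {z :: real \<times> 'a. snd z \<bullet> u \<noteq> - 1}"
    by (intro open_Collect_neq continuous_intros)
  then have ope: "openin (top_of_set ?P) (collar_chart u ` ?C)"
    unfolding img by (rule openin_open_Int)
  have "homeomorphism ?C (collar_chart u ` ?C) (collar_chart u) (collar_chart_inv u)"
  proof (rule homeomorphismI)
    show "continuous_on ?C (collar_chart u)"
      using smooth_on_continuous[OF smooth_on_collar_chart] .
    show "continuous_on (collar_chart u ` ?C) (collar_chart_inv u)"
      unfolding img
      by (intro continuous_at_imp_continuous_on ballI collar_chart_inv_isCont) simp
    have left: "collar_chart_inv u (collar_chart u z) = z" if "z \<in> ?C" for z
      using that collar_chart_inv_left[OF u] by (auto simp: chart_dom_def)
    then show "collar_chart_inv u (collar_chart u z) = z" if "z \<in> ?C" for z using that .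
    show "collar_chart_inv u ` collar_chart u ` ?C \<subseteq> ?C" using left by auto
    show "collar_chart u (collar_chart_inv u y) = y" if "y \<in> collar_chart u ` ?C" for y
      using that left by auto
  qed auto
  moreover have "inj_on (frechet_derivative (collar_chart u) (at p)) (hyperplane u)" if p: "p \<in> ?C" for p
  proof -
    have "snd (collar_chart u p) \<bullet> u \<noteq> - 1"
      using p stereo_sphere(2)[OF u] unfolding dom by (simp add: collar_chart_def)
    then obtain G where "(collar_chart_inv u has_derivative G) (at (collar_chart u p))"
      using collar_chart_inv_differentiable by blast
    moreover have "(collar_chart u has_derivative frechet_derivative (collar_chart u) (at p)) (at p)"
      using smooth_on_has_derivative[OF smooth_on_collar_chart, of p UNIV] by simp
    moreover have "p \<in> hyperplane u" using p by (simp add: chart_dom_def)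
    ultimately show ?thesis
      using subspace_hyperplane collar_chart_inv_left[OF u] by (metis inj_on_derivative_left_inverse)
  qed
  ultimately show "local_param ?P (hyperplane u) (1, 0) (T \<times> UNIV) (collar_chart u)"
    unfolding local_param_def using subspace_hyperplane T smooth_on_collar_chart ope
    by (auto simp: hyperplane_def open_Times)
qed

section \<open>The boundary of the collar and of its p-sub-manifolds\<close>

lemma chart_dom_ray:
  assumes p: "p \<in> chart_dom E b V" and V: "open V" and E: "subspace E" and v: "v \<in> E"
    and dir: "b \<bullet> p = 0 \<Longrightarrow> 0 \<le> b \<bullet> v"
  shows "\<exists>t0>0. \<forall>t. 0 \<le> t \<longrightarrow> t \<le> t0 \<longrightarrow> p + t *\<^sub>R v \<in> chart_dom E b V"
proof -
  have cont: "((\<lambda>t. p + t *\<^sub>R v) \<longlongrightarrow> p) (at 0)"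
    by (auto intro!: tendsto_eq_intros)
  have "eventually (\<lambda>t. p + t *\<^sub>R v \<in> V) (at 0)"
    using topological_tendstoD[OF cont V] p by (simp add: chart_dom_def)
  then obtain t1 where t1: "0 < t1" "\<And>t. t \<noteq> 0 \<Longrightarrow> \<bar>t\<bar> < t1 \<Longrightarrow> p + t *\<^sub>R v \<in> V"
    unfolding eventually_at by (auto simp: dist_real_def)
  have in_V: "p + t *\<^sub>R v \<in> V" if "0 \<le> t" "t < t1" for t
    using t1(2)[of t] that p by (cases "t = 0") (auto simp: chart_dom_def)
  obtain t2 where t2: "0 < t2" "\<And>t. 0 \<le> t \<Longrightarrow> t \<le> t2 \<Longrightarrow> 0 \<le> b \<bullet> (p + t *\<^sub>R v)"
  proof (cases "b \<bullet> p = 0")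
    case True
    then show ?thesis using dir by (intro that[of 1]) (auto simp: inner_add_right)
  next
    case False
    then have pos: "0 < b \<bullet> p" using p by (simp add: chart_dom_def)
    show ?thesis
    proof (rule that[of "(b \<bullet> p) / (1 + \<bar>b \<bullet> v\<bar>)"])
      show "0 < (b \<bullet> p) / (1 + \<bar>b \<bullet> v\<bar>)" using pos by simp
      fix t assume t: "0 \<le> t" "t \<le> (b \<bullet> p) / (1 + \<bar>b \<bullet> v\<bar>)"
      then have "t * (1 + \<bar>b \<bullet> v\<bar>) \<le> b \<bullet> p" by (simp add: field_simps)
      moreover have "t * (- (b \<bullet> v)) \<le> t * (1 + \<bar>b \<bullet> v\<bar>)" using t(1) by (intro mult_left_mono) auto
      ultimately show "0 \<le> b \<bullet> (p + t *\<^sub>R v)" by (simp add: inner_add_right)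
    qed
  qed
  show ?thesis
    using in_V t1(1) t2 p v E
    by (intro exI[of _ "min (t1 / 2) t2"]) (auto simp: chart_dom_def subspace_add subspace_scale)
qed

lemma derivative_nonneg_at_min:
  fixes h :: "'a::real_normed_vector \<Rightarrow> real"
  assumes D: "(h has_derivative D) (at p)" and t0: "0 < t0"
    and min: "\<And>t. 0 \<le> t \<Longrightarrow> t \<le> t0 \<Longrightarrow> h p \<le> h (p + t *\<^sub>R v)"
  shows "0 \<le> D v"
proof (rule ccontr)
  assume "\<not> 0 \<le> D v"
  then have neg: "D v < 0" by simp
  have "((\<lambda>t. h (p + t *\<^sub>R v)) has_derivative (\<lambda>s. D (s *\<^sub>R v))) (at 0)"
    by (rule has_derivative_compose[where f = "\<lambda>t. p + t *\<^sub>R v"])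
      (use D in \<open>auto intro!: derivative_eq_intros\<close>)
  moreover have "(\<lambda>s. D (s *\<^sub>R v)) = (\<lambda>s. D v * s)"
    using linear_scale[OF has_derivative_linear[OF D]] by (simp add: fun_eq_iff)
  ultimately have "((\<lambda>t. h (p + t *\<^sub>R v)) has_real_derivative D v) (at 0)"
    by (simp add: has_field_derivative_def)
  from DERIV_neg_dec_right[OF this neg] obtain e where e: "0 < e"
    "\<And>t. 0 < t \<Longrightarrow> t < e \<Longrightarrow> h (p + t *\<^sub>R v) < h p" by auto
  from min[of "min (e / 2) t0"] e(2)[of "min (e / 2) t0"] e(1) t0 show False by (simp add: min_less_iff_disj)
qed

lemma local_paramD:
  assumes "local_param N E b V f"
  shows "subspace E" "b \<in> E" "open V" "smooth_on f V"
    "\<And>p. p \<in> chart_dom E b V \<Longrightarrow> inj_on (frechet_derivative f (at p)) E"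
    "openin (top_of_set N) (f ` chart_dom E b V)"
    "\<And>p. p \<in> chart_dom E b V \<Longrightarrow> f p \<in> N"
    "\<And>p. p \<in> chart_dom E b V \<Longrightarrow> (f has_derivative frechet_derivative f (at p)) (at p)"
    "continuous_on V f"
proof -
  show 1: "subspace E" "b \<in> E" "open V" "smooth_on f V"
    "\<And>p. p \<in> chart_dom E b V \<Longrightarrow> inj_on (frechet_derivative f (at p)) E"
    "openin (top_of_set N) (f ` chart_dom E b V)"
    using assms by (auto simp: local_param_def)
  show "\<And>p. p \<in> chart_dom E b V \<Longrightarrow> f p \<in> N"
    using openin_imp_subset[OF 1(6)] by blast
  show "\<And>p. p \<in> chart_dom E b V \<Longrightarrow> (f has_derivative frechet_derivative f (at p)) (at p)"
    using smooth_on_has_derivative[OF 1(4)] by (simp add: chart_dom_def)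
  show "continuous_on V f" using smooth_on_continuous[OF 1(4)] .
qed

lemma half_space_not_openin:
  assumes E: "subspace E" "b \<in> E" "b \<noteq> 0" and S: "openin (top_of_set E) S" "\<And>q. q \<in> S \<Longrightarrow> 0 \<le> b \<bullet> q"
    and p: "p \<in> S" "b \<bullet> p = 0"
  shows False
proof -
  obtain d where d: "0 < d" "ball p d \<inter> E \<subseteq> S"
    using S(1) p(1) unfolding openin_contains_ball by blast
  define t where "t = d / (2 * norm b)"
  have t: "0 < t" "t * norm b < d" using d E(3) by (auto simp: t_def)
  have "p \<in> E" using S(1) p(1) openin_imp_subset by blast
  then have "p - t *\<^sub>R b \<in> ball p d \<inter> E"
    using t E by (auto simp: dist_norm subspace_diff subspace_scale)
  then have "0 \<le> b \<bullet> (p - t *\<^sub>R b)" using d S(2) by blast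
  then have "t * (b \<bullet> b) \<le> 0" using p by (simp add: inner_diff_right)
  moreover have "0 < t * (b \<bullet> b)" using t(1) E(3) by simp
  ultimately show False by linarith
qed

text \<open>
  Suppose that a chart of the collar has a boundary point \<open>p\<close> over a point \<open>x\<close> with positive radius. Near \<open>x\<close>
  the collar is also parametrized by an open piece \<open>W\<close> of a linear subspace \<open>?F\<close>. The given chart
  embeds an open piece of \<open>E\<close> into \<open>?F\<close>, whence \<open>dim E \<le> dim ?F\<close>; so by invariance of domain the change
  of charts maps \<open>W\<close> to an open subset of \<open>E\<close>. This set contains \<open>p\<close> but lies in a half-space
  with \<open>p\<close> on its boundary.
\<close>

lemma mfd_boundary_collar_subset:
  fixes T :: "real set"
  assumes T: "open T"
  shows "mfd_boundary (({0..} \<inter> T) \<times> sphere (0 :: 'a::euclidean_space) 1) \<subseteq> {0} \<times> sphere 0 1"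
proof
  let ?P = "({0..} \<inter> T) \<times> sphere (0 :: 'a) 1"
  fix x assume "x \<in> mfd_boundary ?P"
  then obtain E b V f p where f: "local_param ?P E b V f" and p: "p \<in> chart_dom E b V"
    and x: "x = f p" and b: "b \<noteq> 0" "b \<bullet> p = 0"
    unfolding mfd_boundary_def by blast
  note f' = local_paramD[OF f]
  let ?C = "chart_dom E b V"
  obtain g where g: "homeomorphism ?C (f ` ?C) f g" using f unfolding local_param_def by blast
  have xP: "x \<in> ?P" using f'(7)[OF p] x by simp
  define u where "u = snd x"
  have u: "norm u = 1" using xP by (auto simp: u_def)
  show "x \<in> {0} \<times> sphere 0 1"
  proof (rule ccontr)
    assume "x \<notin> {0} \<times> sphere 0 1"
    then have x0: "0 < fst x" "fst x \<in> T" using xP by auto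
    let ?F = "hyperplane u" and ?h = "collar_chart u" and ?k = "collar_chart_inv u"
    define Q where "Q = {y \<in> ?P. 0 < fst y \<and> snd y \<bullet> u \<noteq> - 1}"
    have kQ: "?k y \<in> ?F" "?h (?k y) = y" if "y \<in> Q" for y
      using that unstereo_sphere[OF u, of "snd y"]
      by (auto simp: Q_def hyperplane_def collar_chart_def collar_chart_inv_def)
    have openQ: "open {y :: real \<times> 'a. 0 < fst y \<and> snd y \<bullet> u \<noteq> - 1}"
      by (intro open_Collect_conj open_Collect_neq open_Collect_less continuous_intros)
    obtain A where A: "open A" "f ` ?C = ?P \<inter> A"
      using f'(6) unfolding openin_open by blast
    define W where "W = {z \<in> ?F. 0 < fst z \<and> fst z \<in> T \<and> ?h z \<in> A}"
    have cont_h: "continuous_on UNIV ?h"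
      using smooth_on_continuous[OF smooth_on_collar_chart] .
    have W: "openin (top_of_set ?F) W"
    proof -
      have "open {z :: real \<times> 'a. 0 < fst z}"
        by (intro open_Collect_less continuous_intros)
      moreover have "open (fst -` T :: (real \<times> 'a) set)"
        using T by (intro open_vimage) (auto intro: continuous_intros)
      moreover have "open (?h -` A)" using A(1) cont_h by (rule open_vimage)
      ultimately have "open ({z. 0 < fst z} \<inter> fst -` T \<inter> ?h -` A)" by (intro open_Int)
      moreover have "W = ?F \<inter> ({z. 0 < fst z} \<inter> fst -` T \<inter> ?h -` A)" by (auto simp: W_def)
      ultimately show ?thesis by (auto intro: openin_open_Int)
    qed
    have hW: "?h z \<in> f ` ?C" if "z \<in> W" for z
      using that stereo_sphere(1)[OF u, of "snd z"] unfolding A(2)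
      by (auto simp: W_def hyperplane_def collar_chart_def)
    have dim: "dim E \<le> dim ?F"
    proof -
      define S where "S = {q \<in> V \<inter> E. 0 < b \<bullet> q \<and> f q \<in> {y. 0 < fst y \<and> snd y \<bullet> u \<noteq> - 1}}"
      have S_sub: "S \<subseteq> ?C" by (auto simp: S_def chart_dom_def)
      have fS: "f q \<in> Q" if "q \<in> S" for q
        using that f'(7)[of q] S_sub by (auto simp: S_def Q_def)
      have openV: "open (V \<inter> f -` {y. 0 < fst y \<and> snd y \<bullet> u \<noteq> - 1})"
        using continuous_open_preimage[OF f'(9,3) openQ] .
      show ?thesis
      proof (rule invariance_of_dimension_subspaces[of E S ?F "\<lambda>q. ?k (f q)"])
        have "open {q. 0 < b \<bullet> q}" by (simp add: open_halfspace_gt)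
        moreover have "S = E \<inter> ((V \<inter> f -` {y. 0 < fst y \<and> snd y \<bullet> u \<noteq> - 1}) \<inter> {q. 0 < b \<bullet> q})"
          by (auto simp: S_def)
        ultimately show "openin (top_of_set E) S" using openV by (simp only: openin_open_Int open_Int)
        show "continuous_on S (\<lambda>q. ?k (f q))"
        proof (rule continuous_on_compose2[where t = Q and g = "?k" and f = f])
          show "continuous_on Q ?k"
            by (intro continuous_at_imp_continuous_on ballI collar_chart_inv_isCont) (simp add: Q_def)
          show "continuous_on S f" using f'(9) by (rule continuous_on_subset) (auto simp: S_def)
        qed (use fS in auto)
        show "(\<lambda>q. ?k (f q)) \<in> S \<rightarrow> ?F" using fS kQ by auto
        show "inj_on (\<lambda>q. ?k (f q)) S"
        proof (rule inj_onI)
          fix q r assume qr: "q \<in> S" "r \<in> S" "?k (f q) = ?k (f r)"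
          then have "f q = f r" using kQ(2) fS by metis
          then show "q = r" using homeomorphism_apply1[OF g] qr S_sub by (metis subsetD)
        qed
        have "eventually (\<lambda>t. p + t *\<^sub>R b \<in> V \<inter> f -` {y. 0 < fst y \<and> snd y \<bullet> u \<noteq> - 1}) (at 0)"
        proof (rule topological_tendstoD[OF _ openV])
          show "((\<lambda>t. p + t *\<^sub>R b) \<longlongrightarrow> p) (at 0)" by (auto intro!: tendsto_eq_intros)
          have "u \<bullet> u = 1" using u by (simp add: norm_eq_1)
          then show "p \<in> V \<inter> f -` {y. 0 < fst y \<and> snd y \<bullet> u \<noteq> - 1}"
            using p x0 x by (auto simp: chart_dom_def u_def)
        qed
        then obtain t where t: "0 < t" "p + t *\<^sub>R b \<in> V \<inter> f -` {y. 0 < fst y \<and> snd y \<bullet> u \<noteq> - 1}"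
          unfolding eventually_at
          by (metis (no_types, lifting) UNIV_I abs_of_pos dist_real_def diff_zero field_lbound_gt_zero zero_less_one less_irrefl)
        then have "p + t *\<^sub>R b \<in> S"
          using p f'(1,2) b by (auto simp: S_def chart_dom_def subspace_add subspace_scale inner_add_right)
        then show "S \<noteq> {}" by blast
      qed (use f'(1) subspace_hyperplane in auto)
    qed
    have "openin (top_of_set E) ((\<lambda>z. g (?h z)) ` W)"
    proof (rule invariance_of_domain_subspaces[OF W subspace_hyperplane f'(1) dim])
      show "continuous_on W (\<lambda>z. g (?h z))"
      proof (rule continuous_on_compose2[where t = "f ` ?C" and g = g and f = ?h])
        show "continuous_on W ?h" by (rule continuous_on_subset[OF cont_h subset_UNIV])
        show "?h ` W \<subseteq> f ` ?C" using hW by (rule image_subsetI)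
      qed (rule homeomorphism_cont2[OF g])
      have "g y \<in> ?C" if "y \<in> f ` ?C" for y using that homeomorphism_image2[OF g] by blast
      then show "(\<lambda>z. g (?h z)) \<in> W \<rightarrow> E" using hW by (auto simp: chart_dom_def)
      show "inj_on (\<lambda>z. g (?h z)) W"
      proof (rule inj_onI)
        fix y z assume yz: "y \<in> W" "z \<in> W" "g (?h y) = g (?h z)"
        then have "f (g (?h y)) = f (g (?h z))" by simp
        then have "?h y = ?h z"
          using homeomorphism_apply2[OF g hW[OF yz(1)]] homeomorphism_apply2[OF g hW[OF yz(2)]] by simp
        then have "?k (?h y) = ?k (?h z)" by simp
        moreover have "y \<in> ?F" "z \<in> ?F" using yz by (auto simp: W_def)
        ultimately show "y = z" by (simp add: collar_chart_inv_left[OF u])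
      qed
    qed
    moreover have "0 \<le> b \<bullet> q" if "q \<in> (\<lambda>z. g (?h z)) ` W" for q
      using that hW homeomorphism_image2[OF g] by (auto simp: chart_dom_def)
    moreover have "p \<in> (\<lambda>z. g (?h z)) ` W"
    proof
      have "?h (fst x, 0) = x" by (simp add: collar_chart_def stereo_def u_def)
      then show "p = g (?h (fst x, 0))" using homeomorphism_apply1[OF g p] x by simp
      have "x \<in> A" using A(2) p x by blast
      then show "(fst x, 0) \<in> W"
        using x0 \<open>?h (fst x, 0) = x\<close> by (simp add: W_def hyperplane_def)
    qed
    ultimately show False using half_space_not_openin f'(1,2) b by blast
  qed
qed

text \<open>
  Read off from the stereographic chart at \<open>(0, 0)\<close>, where \<open>collar_chart u (t, 0) = (t, u)\<close>.
\<close>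

lemma mem_mfd_boundary_collar:
  fixes u :: "'a::euclidean_space" and T :: "real set"
  assumes T: "open T" "0 \<in> T" and u: "norm u = 1"
  shows "(0, u) \<in> mfd_boundary (({0..} \<inter> T) \<times> sphere 0 1)"
    and "(1, 0) \<in> tangent_space (({0..} \<inter> T) \<times> sphere 0 1) (0, u)"
proof -
  note chart = local_param_collar[OF T(1) u]
  have p: "(0, 0) \<in> chart_dom (hyperplane u) (1, 0) (T \<times> UNIV)" using T(2) unfolding chart(2) by simp
  have h: "collar_chart u (t, 0) = (t, u)" for t by (simp add: collar_chart_def stereo_def)
  have "(1 :: real, 0 :: 'a) \<noteq> 0" "(1 :: real, 0 :: 'a) \<bullet> (0, 0) = 0" by (auto simp: zero_prod_def)
  then show "(0, u) \<in> mfd_boundary (({0..} \<inter> T) \<times> sphere 0 1)"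
    unfolding mfd_boundary_def using chart(1) p h by (metis (mono_tags, lifting) mem_Collect_eq)
  have "frechet_derivative (collar_chart u) (at (0, 0)) (1, 0) = (1, 0)"
    by (rule has_derivative_along_line[OF local_paramD(8)[OF chart(1) p]]) (simp add: h)
  moreover have "(1, 0) \<in> hyperplane u" by (simp add: hyperplane_def)
  ultimately show "(1, 0) \<in> tangent_space (({0..} \<inter> T) \<times> sphere 0 1) (0, u)"
    unfolding tangent_space_def using chart(1) p h by (metis (mono_tags, lifting) mem_Collect_eq)
qed

text \<open>
  On a half-space only one of \<open>v\<close> and \<open>- v\<close> need point inwards, and along that ray the first
  coordinate is constant.
\<close>

lemma tangent_space_in_slice:
  assumes M: "M \<subseteq> {0} \<times> S" and w: "w \<in> tangent_space M x"
  shows "fst (w :: real \<times> 'a::euclidean_space) = 0"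
proof -
  obtain E b V f p v where f: "local_param M E b V f" and p: "p \<in> chart_dom E b V"
    and v: "v \<in> E" and w: "w = frechet_derivative f (at p) v"
    using w unfolding tangent_space_def by blast
  note f' = local_paramD[OF f]
  have zero: "fst (f q) = 0" if "q \<in> chart_dom E b V" for q
    using f'(7)[OF that] M by auto
  have D: "((\<lambda>q. fst (f q)) has_derivative (\<lambda>v. fst (frechet_derivative f (at p) v))) (at p)"
    using f'(8)[OF p] by (rule has_derivative_fst)
  have D': "((\<lambda>q. - fst (f q)) has_derivative (\<lambda>v. - fst (frechet_derivative f (at p) v))) (at p)"
    using D by (rule has_derivative_minus)
  have main: "fst (frechet_derivative f (at p) v) = 0" if v: "v \<in> E" "0 \<le> b \<bullet> v" for v
  proof -
    obtain t0 where t0: "0 < t0" "\<And>t. 0 \<le> t \<Longrightarrow> t \<le> t0 \<Longrightarrow> p + t *\<^sub>R v \<in> chart_dom E b V"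
      using chart_dom_ray[OF p f'(3,1) v(1)] v(2) by blast
    show ?thesis
      using derivative_nonneg_at_min[OF D t0(1), of v] derivative_nonneg_at_min[OF D' t0(1), of v]
        zero[OF p] zero[OF t0(2)] by simp
  qed
  have "fst (frechet_derivative f (at p) v) = 0"
  proof (cases "0 \<le> b \<bullet> v")
    case False
    then have "fst (frechet_derivative f (at p) (- v)) = 0"
      using main[of "- v"] v f'(1) by (simp add: subspace_neg)
    then show ?thesis using linear_neg[OF has_derivative_linear[OF f'(8)[OF p]], of v] by simp
  qed (use main v in blast)
  then show ?thesis using w by simp
qed

text \<open>
  The first coordinate has a minimum at \<open>p\<close>, so its derivative is nonnegative in all
  directions in which the chart domain can be entered.
\<close>

lemma radial_derivative_nonneg:
  fixes f :: "real \<times> 'a::euclidean_space \<Rightarrow> real \<times> 'a"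
  assumes f: "local_param N E b V f" and p: "p \<in> chart_dom E b V" "fst (f p) = 0"
    and nonneg: "\<And>q. q \<in> chart_dom E b V \<Longrightarrow> 0 \<le> fst (f q)"
    and v: "v \<in> E" "b \<bullet> p = 0 \<Longrightarrow> 0 \<le> b \<bullet> v"
  shows "0 \<le> fst (frechet_derivative f (at p) v)"
proof -
  note f' = local_paramD[OF f]
  obtain t0 where t0: "0 < t0" "\<And>t. 0 \<le> t \<Longrightarrow> t \<le> t0 \<Longrightarrow> p + t *\<^sub>R v \<in> chart_dom E b V"
    using chart_dom_ray[OF p(1) f'(3,1) v] by blast
  then show ?thesis
    using derivative_nonneg_at_min[OF has_derivative_fst[OF f'(8)[OF p(1)]] t0(1), of v] nonneg p(2) by simp
qed

lemma radial_derivative_zero: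
  fixes f :: "real \<times> 'a::euclidean_space \<Rightarrow> real \<times> 'a"
  assumes f: "local_param N E b V f" and p: "p \<in> chart_dom E b V" "fst (f p) = 0"
    and nonneg: "\<And>q. q \<in> chart_dom E b V \<Longrightarrow> 0 \<le> fst (f q)"
    and v: "v \<in> E" "b \<bullet> p = 0 \<Longrightarrow> b \<bullet> v = 0"
  shows "fst (frechet_derivative f (at p) v) = 0"
proof -
  note f' = local_paramD[OF f]
  have "0 \<le> fst (frechet_derivative f (at p) v)"
    using v by (intro radial_derivative_nonneg[OF f p nonneg]) auto
  moreover have "0 \<le> fst (frechet_derivative f (at p) (- v))"
    using v f'(1) by (intro radial_derivative_nonneg[OF f p nonneg]) (auto simp: subspace_neg)
  ultimately show ?thesis
    using linear_neg[OF has_derivative_linear[OF f'(8)[OF p(1)]], of v] by simp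
qed

text \<open>
  Transversality at \<open>(0, u)\<close> provides a tangent vector of \<open>N\<close> with nonzero radial component, since tangent
  vectors of the boundary of the collar have none. Take the chart \<open>f\<close> that this vector comes from.
  As the radius has a minimum at \<open>p\<close>, its derivative would vanish identically if \<open>p\<close> were an interior
  point of the chart, and it does vanish in the directions parallel to the boundary; hence it is
  positive along the inner normal \<open>b\<close>.
\<close>

lemma p_submanifold_boundary_chart:
  fixes N :: "(real \<times> 'a::euclidean_space) set" and T :: "real set"
  assumes T: "open T" "0 \<in> T" and N: "p_submanifold N (({0..} \<inter> T) \<times> sphere 0 1)" and u: "(0, u) \<in> N"
  obtains E b V f p where "local_param N E b V f" "p \<in> chart_dom E b V" "f p = (0, u)"
    "b \<noteq> 0" "b \<bullet> p = 0" "0 < fst (frechet_derivative f (at p) b)"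
    "\<And>q. q \<in> chart_dom E b V \<Longrightarrow> b \<bullet> q = 0 \<Longrightarrow> fst (f q) = 0"
proof -
  let ?P = "({0..} \<inter> T) \<times> sphere (0 :: 'a) 1"
  have N_sub: "N \<subseteq> ?P" and bd: "mfd_boundary N = N \<inter> mfd_boundary ?P"
    and trans: "\<And>x. x \<in> mfd_boundary N \<Longrightarrow>
      {v + w |v w. v \<in> tangent_space N x \<and> w \<in> tangent_space (mfd_boundary ?P) x} = tangent_space ?P x"
    using N unfolding p_submanifold_def by auto
  have nu: "norm u = 1" using N_sub u by auto
  have "(0, u) \<in> mfd_boundary N" using bd u mem_mfd_boundary_collar(1)[OF T nu] by blast
  then have "(1, 0) \<in> {v + w |v w. v \<in> tangent_space N (0, u) \<and> w \<in> tangent_space (mfd_boundary ?P) (0, u)}"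
    using trans mem_mfd_boundary_collar(2)[OF T nu] by blast
  then obtain v w where vw: "(1, 0) = v + w" "v \<in> tangent_space N (0, u)" "w \<in> tangent_space (mfd_boundary ?P) (0, u)"
    by blast
  have "fst w = 0" using tangent_space_in_slice[OF mfd_boundary_collar_subset[OF T(1)] vw(3)] .
  then have "fst v = 1" using vw(1) by (metis add.right_neutral fst_add fst_conv)
  moreover obtain E b V f p a where f: "local_param N E b V f" and p: "p \<in> chart_dom E b V" "f p = (0, u)"
    and a: "a \<in> E" "v = frechet_derivative f (at p) a"
    using vw(2) unfolding tangent_space_def by blast
  ultimately have Da: "fst (frechet_derivative f (at p) a) = 1" by simp
  note f' = local_paramD[OF f]
  let ?D = "\<lambda>v. fst (frechet_derivative f (at p) v)"
  have D: "((\<lambda>q. fst (f q)) has_derivative ?D) (at p)"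
    using f'(8)[OF p(1)] by (rule has_derivative_fst)
  have linD: "linear ?D" using has_derivative_linear[OF D] .
  have nonneg: "0 \<le> fst (f q)" if "q \<in> chart_dom E b V" for q
    using f'(7)[OF that] N_sub by auto
  have D_nonneg: "0 \<le> ?D v" if "v \<in> E" "b \<bullet> p = 0 \<Longrightarrow> 0 \<le> b \<bullet> v" for v
    using radial_derivative_nonneg[OF f p(1) _ nonneg that] p(2) by simp
  have D_zero: "?D v = 0" if "v \<in> E" "b \<bullet> p = 0 \<Longrightarrow> b \<bullet> v = 0" for v
    using radial_derivative_zero[OF f p(1) _ nonneg that] p(2) by simp
  have bp: "b \<bullet> p = 0" "b \<noteq> 0"
    using D_zero[OF a(1)] Da by auto
  have "b \<bullet> (a - ((b \<bullet> a) / (b \<bullet> b)) *\<^sub>R b) = 0"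
    using bp by (simp add: inner_diff_right)
  then have "?D (a - ((b \<bullet> a) / (b \<bullet> b)) *\<^sub>R b) = 0"
    using a f'(1,2) by (intro D_zero) (auto simp: subspace_diff subspace_scale)
  then have "?D a = (b \<bullet> a) / (b \<bullet> b) * ?D b"
    by (simp add: linear_diff[OF linD] linear_scale[OF linD])
  then have "?D b \<noteq> 0" using Da by auto
  then have "0 < ?D b" using D_nonneg[OF f'(2)] inner_ge_zero[of b] by auto
  moreover have "fst (f q) = 0" if q: "q \<in> chart_dom E b V" "b \<bullet> q = 0" for q
  proof -
    have "f q \<in> mfd_boundary N" unfolding mfd_boundary_def using f q bp(2) by blast
    then have "f q \<in> {0} \<times> sphere 0 1" using bd mfd_boundary_collar_subset[OF T(1)] by blast
    then show ?thesis by auto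
  qed
  ultimately show thesis using that f p bp by blast
qed

section \<open>Local Lipschitz estimates\<close>

lemma smooth_on_subset: "smooth_on f V \<Longrightarrow> U \<subseteq> V \<Longrightarrow> smooth_on f U"
proof -
  assume V: "smooth_on f V" and U: "U \<subseteq> V"
  have "times_differentiable_on k g U" if "times_differentiable_on k g V" for k and g :: "'a \<Rightarrow> 'b"
    using that
  proof (induction k arbitrary: g)
    case 0
    then show ?case using U by (auto intro: continuous_on_subset)
  next
    case (Suc k)
    then show ?case using U by auto
  qed
  with V show ?thesis by (simp add: smooth_on_def)
qed

lemma local_param_nhd:
  assumes f: "local_param N E b V f" and p: "p \<in> chart_dom E b V" and r: "0 < r"
  shows "\<exists>U. open U \<and> f p \<in> U \<and> N \<inter> U \<subseteq> f ` (chart_dom E b V \<inter> ball p r)"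
proof -
  obtain g where "homeomorphism (chart_dom E b V) (f ` chart_dom E b V) f g"
    using f unfolding local_param_def by blast
  then have "openin (top_of_set (f ` chart_dom E b V)) (f ` (chart_dom E b V \<inter> ball p r))"
    by (rule homeomorphism_imp_open_map) (simp add: openin_open_Int)
  then have "openin (top_of_set N) (f ` (chart_dom E b V \<inter> ball p r))"
    using local_paramD(6)[OF f] openin_trans by blast
  then obtain U where U: "open U" "f ` (chart_dom E b V \<inter> ball p r) = N \<inter> U"
    unfolding openin_open by blast
  moreover have "f p \<in> U" using U(2) p r by auto
  ultimately show ?thesis by blast
qed

text \<open>
  Chart domains, cut down to a ball, are convex. So the segment between the parameters of two points stays in
  the chart, and its image is short because the chart is bi-Lipschitz near \<open>p\<close>.
\<close>

lemma joinable_near_smooth_point: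
  fixes X :: "'a::euclidean_space set"
  assumes N: "submanifold N" and germ: "same_germ {x} X N" and x: "x \<in> X"
  shows "\<exists>U C. open U \<and> x \<in> U \<and> (\<forall>y\<in>X \<inter> U. \<forall>z\<in>X \<inter> U. joinable X y z (C * dist y z))"
proof -
  obtain W where W: "open W" "x \<in> W" "X \<inter> W = N \<inter> W"
    using germ unfolding same_germ_def by auto
  then have "x \<in> N" using x by blast
  then obtain E b V f where f: "local_param N E b V f" and "x \<in> f ` chart_dom E b V"
    using N unfolding submanifold_def submanifold_with_boundary_def by blast
  then obtain p where p: "p \<in> chart_dom E b V" "f p = x" by blast
  note f' = local_paramD[OF f]
  let ?D = "\<lambda>p. frechet_derivative f (at p)"
  let ?V = "V \<inter> f -` W"
  have V: "open ?V" "p \<in> ?V" "smooth_on f ?V"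
    using continuous_open_preimage[OF f'(9,3) W(1)] p W(2) smooth_on_subset[OF f'(4)]
    by (auto simp: chart_dom_def)
  obtain d K where d: "0 < d" "d \<le> 1" "1 \<le> K" "cball p d \<subseteq> ?V"
    and D: "\<And>q. q \<in> cball p d \<Longrightarrow> (f has_derivative ?D q) (at q)"
    and bound: "\<And>q v. q \<in> cball p d \<Longrightarrow> norm (?D q v) \<le> K * norm v"
    and lip: "\<And>q r v. q \<in> cball p d \<Longrightarrow> r \<in> cball p d \<Longrightarrow>
      norm (?D q v - ?D r v) \<le> K * norm (q - r) * norm v"
    using smooth_on_C2_near[OF V(3,1,2)] by metis
  obtain c d' where d': "0 < c" "0 < d'" "d' \<le> d"
    and exp: "\<And>q r. q \<in> cball p d' \<Longrightarrow> r \<in> cball p d' \<Longrightarrow> q - r \<in> E \<Longrightarrow>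
      c * norm (q - r) \<le> norm (f q - f r)"
    using immersion_expanding_near[OF d(1,3) D lip f'(1) f'(5)[OF p(1)]] by metis
  let ?H = "chart_dom E b V \<inter> cball p d'"
  have "?H = cball p d' \<inter> E \<inter> {q. 0 \<le> b \<bullet> q}"
    using d(4) d'(3) by (auto simp: chart_dom_def)
  then have convex: "convex ?H"
    using f'(1) by (simp add: convex_Int subspace_imp_convex convex_halfspace_ge[of 0, simplified])
  obtain U where U: "open U" "x \<in> U" "N \<inter> U \<subseteq> f ` (chart_dom E b V \<inter> ball p d')"
    using local_param_nhd[OF f p(1) d'(2)] p(2) by blast
  have "joinable X y z (K / c * dist y z)" if y: "y \<in> X \<inter> (U \<inter> W)" and z: "z \<in> X \<inter> (U \<inter> W)" for y z
  proof -
    have "y \<in> N \<inter> U" "z \<in> N \<inter> U" using y z W(3) by blast+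
    then obtain q r where q: "q \<in> ?H" "f q = y" and r: "r \<in> ?H" "f r = z"
      using U(3) ball_subset_cball by blast
    have seg: "q + t *\<^sub>R (r - q) \<in> ?H" if "t \<in> {0..1}" for t
      using convexD_alt[OF convex q(1) r(1), of t] that by (simp add: algebra_simps)
    have "(K * norm (r - q))-lipschitz_on {0..1} (\<lambda>t. f (q + t *\<^sub>R (r - q)))"
    proof (rule lipschitz_on_segment)
      fix t :: real assume "t \<in> {0..1}"
      then have "q + t *\<^sub>R (r - q) \<in> cball p d" using seg d'(3) by fastforce
      then show "(f has_derivative ?D (q + t *\<^sub>R (r - q))) (at (q + t *\<^sub>R (r - q)))"
        "norm (?D (q + t *\<^sub>R (r - q)) (r - q)) \<le> K * norm (r - q)"
        using D bound by blast+
    qed (use d in auto)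
    then have "joinable X (f (q + 0 *\<^sub>R (r - q))) (f (q + 1 *\<^sub>R (r - q))) (K / c * dist y z)"
    proof (rule joinable_lipschitz_on)
      have "f s \<in> X" if "s \<in> ?H" for s
      proof -
        have "s \<in> cball p d" using that d'(3) by auto
        then have "f s \<in> W" using d(4) by blast
        then show ?thesis using that f'(7)[of s] W(3) by blast
      qed
      then show "(\<lambda>t. f (q + t *\<^sub>R (r - q))) ` {0..1} \<subseteq> X" using seg by blast
      have "r - q \<in> E" using q r f'(1) by (auto simp: chart_dom_def subspace_diff)
      then have "c * norm (r - q) \<le> dist y z"
        using exp[of r q] q r by (simp add: dist_norm norm_minus_commute)
      then have "K / c * (c * norm (r - q)) \<le> K / c * dist y z"
        using d d' by (intro mult_left_mono) auto
      then show "K * norm (r - q) * (1 - 0) \<le> K / c * dist y z" using d'(1) by simp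
    qed simp
    then show ?thesis using q r by simp
  qed
  then show ?thesis
    using U W by (intro exI[of _ "U \<inter> W"] exI[of _ "K / c"]) auto
qed

text \<open>
  All estimates required by \<open>conic_chart\<close> come from the Lipschitz continuity of the derivative. The tangential
  derivative of the radius vanishes at the foot of \<open>q\<close> on the boundary, which is at distance
  \<open>e \<bullet> q\<close>; and its normal derivative stays above half of its value \<open>m\<close> at \<open>p\<close> on a ball of radius
  \<open>m / (2 K)\<close>. The last conclusion turns estimates on a small half-ball of the chart into
  estimates on a neighbourhood of \<open>(0, u)\<close> in \<open>N\<close>.
\<close>

lemma p_submanifold_conic_chart:
  fixes N :: "(real \<times> 'a::euclidean_space) set" and T :: "real set"
  assumes T: "open T" "0 \<in> T" and N: "p_submanifold N (({0..} \<inter> T) \<times> sphere 0 1)"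
    and u: "(0, u) \<in> N" and W: "open W" "(0, u) \<in> W"
  obtains E e p0 d c K f and D :: "real \<times> 'a \<Rightarrow> real \<times> 'a \<Rightarrow> real \<times> 'a" where
    "conic_chart E e p0 d c K f D"
    "\<forall>p\<in>half_ball E e p0 d. f p \<in> N \<inter> W"
    "\<forall>r>0. \<exists>U. open U \<and> (0, u) \<in> U \<and> N \<inter> U \<subseteq> f ` half_ball E e p0 r"
proof -
  obtain E b V f p where f: "local_param N E b V f" and p: "p \<in> chart_dom E b V" "f p = (0, u)"
    and b: "b \<noteq> 0" "b \<bullet> p = 0" "0 < fst (frechet_derivative f (at p) b)"
    and bd: "\<And>q. q \<in> chart_dom E b V \<Longrightarrow> b \<bullet> q = 0 \<Longrightarrow> fst (f q) = 0"
    using p_submanifold_boundary_chart[OF T N u] by metis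
  note f' = local_paramD[OF f]
  have N_sub: "N \<subseteq> ({0..} \<inter> T) \<times> sphere 0 1" using N by (simp add: p_submanifold_def)
  let ?D = "\<lambda>p. frechet_derivative f (at p)"
  let ?V = "V \<inter> f -` W"
  have V: "open ?V" "p \<in> ?V" "smooth_on f ?V"
    using continuous_open_preimage[OF f'(9,3) W(1)] p W(2) smooth_on_subset[OF f'(4)]
    by (auto simp: chart_dom_def)
  obtain d1 K where d1: "0 < d1" "d1 \<le> 1" "1 \<le> K" "cball p d1 \<subseteq> ?V"
    and D: "\<And>q. q \<in> cball p d1 \<Longrightarrow> (f has_derivative ?D q) (at q)"
    and bound: "\<And>q v. q \<in> cball p d1 \<Longrightarrow> norm (?D q v) \<le> K * norm v"
    and lip: "\<And>q r v. q \<in> cball p d1 \<Longrightarrow> r \<in> cball p d1 \<Longrightarrow>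
      norm (?D q v - ?D r v) \<le> K * norm (q - r) * norm v"
    using smooth_on_C2_near[OF V(3,1,2)] by metis
  obtain c1 d2 where d2: "0 < c1" "0 < d2" "d2 \<le> d1"
    and exp: "\<And>q r. q \<in> cball p d2 \<Longrightarrow> r \<in> cball p d2 \<Longrightarrow> q - r \<in> E \<Longrightarrow>
      c1 * norm (q - r) \<le> norm (f q - f r)"
    using immersion_expanding_near[OF d1(1,3) D lip f'(1) f'(5)[OF p(1)]] by metis
  define e where "e = (1 / norm b) *\<^sub>R b"
  define m where "m = fst (?D p e)"
  define d where "d = min d2 (m / (2 * K))"
  define c where "c = min 1 (min c1 (m / 2))"
  have p_d1: "p \<in> cball p d1" using d1 by simp
  have E: "subspace E" "e \<in> E" "norm e = 1" "p \<in> E" "e \<bullet> p = 0"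
    using f'(1,2) b p by (auto simp: e_def subspace_scale chart_dom_def)
  have m: "0 < m"
    using b linear_scale[OF has_derivative_linear[OF D[OF p_d1]], of "1 / norm b" b]
    by (simp add: m_def e_def)
  have d_le: "d \<le> d2" "d \<le> m / (2 * K)" by (auto simp: d_def)
  have d: "0 < d" "d \<le> 1" "d \<le> d1" "d \<le> d2"
    using d1 d2 m d_le(1) by (auto simp: d_def)
  have Kd: "K * d \<le> m / 2" using d_le(2) d1(3) by (simp add: field_simps)
  have c: "0 < c" "c \<le> 1" "c \<le> c1" "c \<le> m / 2" using d2 m by (auto simp: c_def)
  have sub: "cball p d \<subseteq> cball p d1" "cball p d \<subseteq> cball p d2" using d by auto
  have b_e: "b \<bullet> q = norm b * (e \<bullet> q)" for q using b by (simp add: e_def)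
  have H_dom: "q \<in> chart_dom E b V" if "q \<in> half_ball E e p d" for q
    using that sub d1(4) b by (auto simp: half_ball_def chart_dom_def b_e)
  have nonneg: "0 \<le> fst (f q)" if "q \<in> chart_dom E b V" for q
    using f'(7)[OF that] N_sub by auto
  have "conic_chart E e p d c K f ?D"
  proof
    fix q v assume q: "q \<in> cball p d"
    show "(f has_derivative ?D q) (at q)" using q sub D by blast
    show "norm (?D q v) \<le> K * norm v" using q sub bound by blast
    have "norm (?D q e - ?D p e) \<le> K * norm (q - p) * norm e" using q sub p_d1 lip by blast
    also have "\<dots> \<le> K * d"
      using q E(3) d1(3) by (simp add: dist_norm norm_minus_commute)
    also have "\<dots> \<le> m / 2" by (rule Kd)
    finally have "norm (?D q e - ?D p e) \<le> m / 2" .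
    then have "\<bar>fst (?D q e - ?D p e)\<bar> \<le> m / 2"
      using norm_fst_le[of "fst (?D q e - ?D p e)" "snd (?D q e - ?D p e)"]
      unfolding prod.collapse real_norm_def by linarith
    then have "\<bar>fst (?D q e) - m\<bar> \<le> m / 2" by (simp add: m_def)
    then show "c \<le> fst (?D q e)" using c(4) by linarith
  next
    fix q r assume qr: "q \<in> cball p d" "r \<in> cball p d" "q - r \<in> E"
    have "c * norm (q - r) \<le> c1 * norm (q - r)" using c by (intro mult_right_mono) auto
    also have "\<dots> \<le> norm (f q - f r)" using qr sub exp by blast
    finally show "c * norm (q - r) \<le> norm (f q - f r)" .
  next
    fix q w assume q: "q \<in> half_ball E e p d" and w: "w \<in> E" "e \<bullet> w = 0"
    let ?q = "q - (e \<bullet> q) *\<^sub>R e"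
    note foot = foot_in_half_ball(1)[OF E q] foot_in_half_ball(2)[OF E, of q]
    have "fst (?D ?q w) = 0"
      using radial_derivative_zero[OF f H_dom[OF foot(1)] bd[OF H_dom[OF foot(1)]] nonneg] w foot(2)
      by (simp add: b_e)
    moreover have "norm (?D q w - ?D ?q w) \<le> K * norm (q - ?q) * norm w"
      using q foot(1) sub by (intro lip) (auto simp: half_ball_def)
    moreover have "norm (q - ?q) = e \<bullet> q" using q E(3) by (simp add: half_ball_def)
    ultimately show "\<bar>fst (?D q w)\<bar> \<le> K * (e \<bullet> q) * norm w"
      using norm_fst_le[of "fst (?D q w - ?D ?q w)" "snd (?D q w - ?D ?q w)"]
      unfolding prod.collapse by simp
  next
    fix q assume q: "q \<in> half_ball E e p d"
    show "fst (f q) = 0" if "e \<bullet> q = 0" using bd[OF H_dom[OF q]] that by (simp add: b_e)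
    show "norm (snd (f q)) = 1" using f'(7)[OF H_dom[OF q]] N_sub by auto
  qed (use E d c d1 in auto)
  moreover have "f q \<in> N \<inter> W" if "q \<in> half_ball E e p d" for q
  proof -
    have "q \<in> cball p d" using that by (simp add: half_ball_def)
    then have "f q \<in> W" using sub d1(4) by blast
    then show ?thesis using f'(7)[OF H_dom[OF that]] by blast
  qed
  moreover have "\<exists>U. open U \<and> (0, u) \<in> U \<and> N \<inter> U \<subseteq> f ` half_ball E e p r" if r: "0 < r" for r
  proof -
    have "chart_dom E b V \<inter> ball p r \<subseteq> half_ball E e p r"
      using b by (auto simp: chart_dom_def half_ball_def b_e zero_le_mult_iff)
    then have "f ` (chart_dom E b V \<inter> ball p r) \<subseteq> f ` half_ball E e p r" by (rule image_mono)
    moreover obtain U where "open U" "(0, u) \<in> U" "N \<inter> U \<subseteq> f ` (chart_dom E b V \<inter> ball p r)"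
      using local_param_nhd[OF f p(1) r] unfolding p(2) by blast
    ultimately show ?thesis by (intro exI[of _ U] conjI) (assumption | erule order_trans)+
  qed
  ultimately show thesis using that by blast
qed

lemma joinable_near_cone_direction:
  fixes N :: "(real \<times> 'a::euclidean_space) set" and T :: "real set"
  assumes T: "open T" "0 \<in> T" and N: "p_submanifold N (({0..} \<inter> T) \<times> sphere 0 1)"
    and u: "(0, u) \<in> N" and X: "\<And>y. y \<in> N \<Longrightarrow> fst y *\<^sub>R snd y + a \<in> X"
  obtains U C where "open U" "(0, u) \<in> U"
    "\<And>y z. y \<in> N \<inter> U \<Longrightarrow> z \<in> N \<inter> U \<Longrightarrow>
      joinable X (fst y *\<^sub>R snd y + a) (fst z *\<^sub>R snd z + a)
        (C * dist (fst y *\<^sub>R snd y + a) (fst z *\<^sub>R snd z + a))"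
proof -
  obtain E e p0 d c K f and D :: "real \<times> 'a \<Rightarrow> real \<times> 'a \<Rightarrow> real \<times> 'a" where
    chart: "conic_chart E e p0 d c K f D"
    and fN: "\<forall>p\<in>half_ball E e p0 d. f p \<in> N \<inter> UNIV"
    and nhd: "\<forall>r>0. \<exists>U. open U \<and> (0, u) \<in> U \<and> N \<inter> U \<subseteq> f ` half_ball E e p0 r"
    using p_submanifold_conic_chart[OF T N u open_UNIV UNIV_I] by blast
  interpret conic_chart E e p0 d c K f D by (rule chart)
  obtain U where U: "open U" "(0, u) \<in> U" "N \<inter> U \<subseteq> f ` H (d / 2)"
    using nhd d(1) half_gt_zero by blast
  have X': "fst (f p) *\<^sub>R snd (f p) + a \<in> X" if "p \<in> H d" for p
    using fN that X by blast
  show thesis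
  proof (rule that[OF U(1,2)])
    fix y z assume "y \<in> N \<inter> U" "z \<in> N \<inter> U"
    then obtain p q where "p \<in> H (d / 2)" "y = f p" "q \<in> H (d / 2)" "z = f q"
      using U(3) by blast
    then show "joinable X (fst y *\<^sub>R snd y + a) (fst z *\<^sub>R snd z + a)
        ((6 * path_const\<^sup>2 + 2 * K\<^sup>2 / c * (12 * near_const + 1))
          * dist (fst y *\<^sub>R snd y + a) (fst z *\<^sub>R snd z + a))"
      using joinable_cone[where a = a and X = X] X' by blast
  qed
qed

lemma joinable_near_end_direction:
  fixes N :: "(real \<times> 'a::euclidean_space) set" and T :: "real set"
  assumes T: "open T" "0 \<in> T" and N: "p_submanifold N (({0..} \<inter> T) \<times> sphere 0 1)"
    and u: "(0, u) \<in> N" and W: "open W" "(0, u) \<in> W"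
    and X: "\<And>y. y \<in> N \<inter> W \<Longrightarrow> 0 < fst y \<Longrightarrow> (1 / fst y) *\<^sub>R snd y \<in> X"
    and bdd: "\<And>r. \<exists>L. \<forall>x\<in>X \<inter> cball 0 r. joinable X x x0 L"
  obtains U C where "open U" "(0, u) \<in> U"
    "\<And>y z. y \<in> N \<inter> U \<Longrightarrow> z \<in> N \<inter> U \<Longrightarrow> 0 < fst y \<Longrightarrow> 0 < fst z \<Longrightarrow>
      joinable X ((1 / fst y) *\<^sub>R snd y) ((1 / fst z) *\<^sub>R snd z)
        (C * dist ((1 / fst y) *\<^sub>R snd y) ((1 / fst z) *\<^sub>R snd z))"
    "\<And>y. y \<in> N \<inter> U \<Longrightarrow> 0 < fst y \<Longrightarrow> joinable X ((1 / fst y) *\<^sub>R snd y) x0 (C * (1 / fst y))"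
proof -
  obtain E e p0 d c K f and D :: "real \<times> 'a \<Rightarrow> real \<times> 'a \<Rightarrow> real \<times> 'a" where
    chart: "conic_chart E e p0 d c K f D"
    and fN: "\<forall>p\<in>half_ball E e p0 d. f p \<in> N \<inter> W"
    and nhd: "\<forall>r>0. \<exists>U. open U \<and> (0, u) \<in> U \<and> N \<inter> U \<subseteq> f ` half_ball E e p0 r"
    using p_submanifold_conic_chart[OF T N u W] by blast
  interpret conic_chart E e p0 d c K f D by (rule chart)
  obtain U where U: "open U" "(0, u) \<in> U" "N \<inter> U \<subseteq> f ` H (d / 4)"
    using nhd[rule_format, of "d / 4"] d(1) by auto
  have X': "(1 / fst (f p)) *\<^sub>R snd (f p) \<in> X" if "p \<in> H d" "0 < e \<bullet> p" for p
    using fN that(1) X radius_pos[OF that] by blast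
  obtain C where C: "0 \<le> C" "\<And>p. p \<in> H (d / 4) \<Longrightarrow> 0 < e \<bullet> p \<Longrightarrow>
       joinable X ((1 / fst (f p)) *\<^sub>R snd (f p)) x0 (C * (1 / fst (f p)))"
    using joinable_end_base[OF X' bdd] by blast
  define C' where "C' = max C (2 * path_const ^ 3 * (path_const + 2) + C * (16 * near_const + 3))"
  have lift: "\<exists>p. p \<in> H (d / 4) \<and> 0 < e \<bullet> p \<and> y = f p" if y: "y \<in> N \<inter> U" "0 < fst y" for y
  proof -
    obtain p where p: "p \<in> H (d / 4)" "y = f p" using U(3) y(1) by blast
    have pd: "p \<in> H d" using p(1) half_ball_mono[of "d / 4" d] d by auto
    have "e \<bullet> p \<noteq> 0" using boundary[OF pd] y(2) p(2) by auto
    then have "0 < e \<bullet> p" using p by (auto simp: half_ball_def)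
    then show ?thesis using p by blast
  qed
  show thesis
  proof (rule that[OF U(1,2)])
    fix y z assume "y \<in> N \<inter> U" "z \<in> N \<inter> U" "0 < fst y" "0 < fst z"
    then obtain p q where p: "p \<in> H (d / 4)" "0 < e \<bullet> p" "y = f p"
      and q: "q \<in> H (d / 4)" "0 < e \<bullet> q" "z = f q"
      using lift by meson
    have "joinable X ((1 / fst y) *\<^sub>R snd y) ((1 / fst z) *\<^sub>R snd z)
        ((2 * path_const ^ 3 * (path_const + 2) + C * (16 * near_const + 3))
          * dist ((1 / fst y) *\<^sub>R snd y) ((1 / fst z) *\<^sub>R snd z))"
      using joinable_end[OF X' C p(1,2) q(1,2)] p(3) q(3) by blast
    then show "joinable X ((1 / fst y) *\<^sub>R snd y) ((1 / fst z) *\<^sub>R snd z)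
        (C' * dist ((1 / fst y) *\<^sub>R snd y) ((1 / fst z) *\<^sub>R snd z))"
      by (rule joinable_mono) (auto simp: C'_def intro!: mult_right_mono)
  next
    fix y assume y: "y \<in> N \<inter> U" "0 < fst y"
    then obtain p where p: "p \<in> H (d / 4)" "0 < e \<bullet> p" "y = f p" using lift by blast
    then have "joinable X ((1 / fst y) *\<^sub>R snd y) x0 (C * (1 / fst y))" using C(2) by blast
    then show "joinable X ((1 / fst y) *\<^sub>R snd y) x0 (C' * (1 / fst y))"
      using y(2) by (elim joinable_mono) (auto simp: C'_def intro!: divide_right_mono)
  qed
qed

section \<open>Uniformity over all directions\<close>

text \<open>
  If the directions of \<open>y\<close> and \<open>z\<close> seen from \<open>a\<close> are separated by \<open>r\<close>, then the sum of their distances to \<open>a\<close>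
  is at most \<open>4 / r\<close> times their mutual distance, and they may be joined through \<open>b\<close>.
\<close>

lemma joinable_all_directions:
  fixes X :: "'a::euclidean_space set"
  assumes near: "\<And>y z. y \<in> A \<Longrightarrow> z \<in> A \<Longrightarrow> dist (sgn (y - a)) (sgn (z - a)) < r \<Longrightarrow>
      joinable X y z (C * dist y z)"
    and base: "\<And>y. y \<in> A \<Longrightarrow> joinable X y b (C * norm (y - a))"
    and A: "a \<notin> A" and r: "0 < r" and C: "0 \<le> C" and yz: "y \<in> A" "z \<in> A"
  shows "joinable X y z ((C + 4 * C / r) * dist y z)"
proof (cases "dist (sgn (y - a)) (sgn (z - a)) < r")
  case True
  show ?thesis
    using near[OF yz True] by (rule joinable_mono) (use C r in \<open>auto intro!: mult_right_mono\<close>)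
next
  case False
  define s where "s = norm (y - a)"
  define s' where "s' = norm (z - a)"
  have ya: "y - a \<noteq> 0" "z - a \<noteq> 0" using yz A by auto
  have unit: "norm (sgn (y - a)) = 1" "norm (sgn (z - a)) = 1" using ya by (auto simp: norm_sgn)
  have s: "0 \<le> s" "0 \<le> s'" by (auto simp: s_def s'_def)
  have y: "s *\<^sub>R sgn (y - a) = y - a" "s' *\<^sub>R sgn (z - a) = z - a"
    using ya by (auto simp: s_def s'_def sgn_div_norm)
  have far: "r \<le> norm (sgn (y - a) - sgn (z - a))" "r \<le> norm (sgn (z - a) - sgn (y - a))"
    using False by (auto simp: dist_norm norm_minus_commute)
  have "s * r \<le> 2 * dist y z" "s' * r \<le> 2 * dist y z"
    using unit_polar_lower(2)[OF unit s] unit_polar_lower(2)[OF unit(2,1) s(2,1)]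
      mult_left_mono[OF far(1) s(1)] mult_left_mono[OF far(2) s(2)]
    unfolding y by (auto simp: dist_norm norm_minus_commute)
  then have "(s + s') * r \<le> 4 * dist y z" unfolding distrib_right by linarith
  then have "s + s' \<le> 4 / r * dist y z" using r by (simp add: field_simps)
  then have "C * (s + s') \<le> C * (4 / r * dist y z)" using C by (rule mult_left_mono)
  also have "\<dots> \<le> (C + 4 * C / r) * dist y z"
  proof -
    have "0 \<le> C * dist y z" "C * (4 / r * dist y z) = 4 * C / r * dist y z" using C by auto
    then show ?thesis unfolding distrib_right by linarith
  qed
  finally have "C * s + C * s' \<le> (C + 4 * C / r) * dist y z" by (simp add: distrib_left)
  moreover have "joinable X y z (C * s + C * s')"
    using joinable_trans[OF base[OF yz(1)] joinable_sym[OF base[OF yz(2)]]] by (simp add: s_def s'_def)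
  ultimately show ?thesis by (rule joinable_mono[rotated])
qed

lemma open_near_zero_slice:
  fixes U :: "(real \<times> 'a::metric_space) set"
  assumes "open U" "(0, v) \<in> U"
  obtains e where "0 < e" "\<And>s w. 0 \<le> s \<Longrightarrow> s < e \<Longrightarrow> w \<in> ball v e \<Longrightarrow> (s, w) \<in> U"
proof -
  obtain A B where AB: "open A" "open B" "0 \<in> A" "v \<in> B" "A \<times> B \<subseteq> U"
    using assms by (metis mem_Sigma_iff open_prod_elim)
  obtain e1 e2 where e: "0 < e1" "ball 0 e1 \<subseteq> A" "0 < e2" "ball v e2 \<subseteq> B"
    using AB by (meson open_contains_ball)
  show thesis
  proof (rule that[of "min e1 e2"])
    fix s w assume "0 \<le> s" "s < min e1 e2" "w \<in> ball v (min e1 e2)"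
    then have "s \<in> A" "w \<in> B" using e by (auto simp: subset_iff dist_real_def)
    then show "(s, w) \<in> U" using AB by blast
  qed (use e in auto)
qed

text \<open>
  In the application \<open>S\<close> consists of the points of positive radius of a p-sub-manifold of the collar. One number
  \<open>C\<close> serves both as the constant of the estimate and, through \<open>1 / C\<close>, as the bound for the radius, so
  that the local statements are monotone in \<open>C\<close> and compactness of the sphere applies.
\<close>

lemma uniform_over_directions:
  fixes S :: "(real \<times> 'a::euclidean_space) set" and P :: "real \<Rightarrow> real \<times> 'a \<Rightarrow> real \<times> 'a \<Rightarrow> bool"
  assumes mono: "\<And>C C' y z. P C y z \<Longrightarrow> C \<le> C' \<Longrightarrow> y \<in> S \<Longrightarrow> z \<in> S \<Longrightarrow> P C' y z"
    and S: "S \<subseteq> {0<..} \<times> sphere 0 1"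
    and loc: "\<And>v. v \<in> sphere 0 1 \<Longrightarrow> \<exists>U C. open U \<and> (0, v) \<in> U \<and>
      (\<forall>y\<in>S \<inter> U. \<forall>z\<in>S \<inter> U. P C y z)"
  shows "\<exists>r>0. \<exists>C\<ge>1. \<forall>y\<in>S. \<forall>z\<in>S. fst y < 1 / C \<longrightarrow> fst z < 1 / C \<longrightarrow>
    dist (snd y) (snd z) < r \<longrightarrow> P C y z"
proof -
  define Q where "Q = (\<lambda>C v w. \<forall>s t. (s, v) \<in> S \<longrightarrow> (t, w) \<in> S \<longrightarrow> s * C < 1 \<longrightarrow> t * C < 1 \<longrightarrow>
    P C (s, v) (t, w))"
  have Q_mono: "Q C' v w" if Q: "Q C v w" and le: "C \<le> C'" for C C' v w
    unfolding Q_def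
  proof (intro allI impI)
    fix s t assume st: "(s, v) \<in> S" "(t, w) \<in> S" "s * C' < 1" "t * C' < 1"
    then have "0 < s" "0 < t" using S by auto
    then have "s * C < 1" "t * C < 1"
      using st le mult_left_mono[OF le, of s] mult_left_mono[OF le, of t] by linarith+
    then show "P C' (s, v) (t, w)" using Q st le mono unfolding Q_def by blast
  qed
  have Q_loc: "\<exists>U C. open U \<and> v \<in> U \<and> (\<forall>x\<in>sphere 0 1 \<inter> U. \<forall>w\<in>sphere 0 1 \<inter> U. Q C x w)"
    if v: "v \<in> sphere 0 1" for v
  proof -
    obtain U C where U: "open U" "(0, v) \<in> U" "\<And>y z. y \<in> S \<inter> U \<Longrightarrow> z \<in> S \<inter> U \<Longrightarrow> P C y z"
      using loc[OF v] by blast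
    obtain e where e: "0 < e" "\<And>s w. 0 \<le> s \<Longrightarrow> s < e \<Longrightarrow> w \<in> ball v e \<Longrightarrow> (s, w) \<in> U"
      using open_near_zero_slice[OF U(1,2)] by metis
    have "Q (max C (1 / e)) x w" if xw: "x \<in> ball v e" "w \<in> ball v e" for x w
      unfolding Q_def
    proof (intro allI impI)
      fix s t assume st: "(s, x) \<in> S" "(t, w) \<in> S" "s * max C (1 / e) < 1" "t * max C (1 / e) < 1"
      then have pos: "0 < s" "0 < t" using S by auto
      then have "s * (1 / e) < 1" "t * (1 / e) < 1"
        using st mult_left_mono[of "1 / e" "max C (1 / e)" s] mult_left_mono[of "1 / e" "max C (1 / e)" t]
        by linarith+
      then have "s < e" "t < e" using e(1) by (auto simp: field_simps)
      then have "P C (s, x) (t, w)" using U(3) e(2) pos st xw by (meson IntI less_imp_le)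
      then show "P (max C (1 / e)) (s, x) (t, w)" using mono st by (meson max.cobounded1)
    qed
    then show ?thesis using e(1) by (intro exI[of _ "ball v e"] exI[of _ "max C (1 / e)"]) auto
  qed
  have "\<exists>r>0. \<exists>C. \<forall>v\<in>sphere 0 1. \<forall>w\<in>sphere 0 1. dist v w < r \<longrightarrow> Q C v w"
    by (rule uniform_constant_on_compact[OF compact_sphere Q_mono Q_loc])
  then obtain r C where r: "0 < r"
    "\<And>v w. v \<in> sphere 0 1 \<Longrightarrow> w \<in> sphere 0 1 \<Longrightarrow> dist v w < r \<Longrightarrow> Q C v w"
    by blast
  have "\<forall>y\<in>S. \<forall>z\<in>S. fst y < 1 / max C 1 \<longrightarrow> fst z < 1 / max C 1 \<longrightarrow>
    dist (snd y) (snd z) < r \<longrightarrow> P (max C 1) y z"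
  proof (intro ballI impI)
    fix y z assume yz: "y \<in> S" "z \<in> S" "fst y < 1 / max C 1" "fst z < 1 / max C 1" "dist (snd y) (snd z) < r"
    have "Q C (snd y) (snd z)" using yz S by (intro r(2)) auto
    then have "Q (max C 1) (snd y) (snd z)" by (rule Q_mono) simp
    moreover have "fst y * max C 1 < 1" "fst z * max C 1 < 1"
      using yz(3,4) by (auto simp: pos_less_divide_eq)
    ultimately show "P (max C 1) y z" unfolding Q_def using yz(1,2) by (metis prod.collapse)
  qed
  then show ?thesis using r(1) max.cobounded2 by blast
qed

text \<open>
  Directions that are not limits of directions of \<open>X\<close> have a neighbourhood free of points of \<open>X\<close>, because the
  strict transform is relatively closed; for the others there is a conic chart.
  The bound for the way to the apex is the special case of a pair whose second point lies on the boundary.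
\<close>

lemma joinable_near_conic_point:
  fixes X :: "'a::euclidean_space set"
  assumes X: "closed X" and a: "conic_point X a"
  shows "\<exists>U C. open U \<and> a \<in> U \<and> (\<forall>y\<in>X \<inter> U. \<forall>z\<in>X \<inter> U. joinable X y z (C * dist y z))"
proof -
  obtain r where r: "0 < r" and
    clo: "closedin (top_of_set ({0..<r} \<times> sphere 0 1))
      (strict_transform (X \<inter> ball a r) a \<inter> {0..<r} \<times> sphere 0 1)" and
    sub: "p_submanifold (strict_transform (X \<inter> ball a r) a \<inter> {0..<r} \<times> sphere 0 1) ({0..<r} \<times> sphere 0 1)"
    using a unfolding conic_point_def Let_def by blast
  define P :: "(real \<times> 'a) set" where "P = {0..<r} \<times> sphere 0 1"
  define N where "N = strict_transform (X \<inter> ball a r) a \<inter> P"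
  have P: "P = ({0..} \<inter> {..<r}) \<times> sphere 0 1" by (auto simp: P_def)
  have clo: "closedin (top_of_set P) N" using clo by (simp add: N_def P_def)
  have sub: "p_submanifold N (({0..} \<inter> {..<r}) \<times> sphere 0 1)"
    using sub unfolding N_def P[symmetric] by (simp add: P_def)
  have "closed (blowdown a -` X)"
    using X unfolding blowdown_def case_prod_beta
    by (intro closed_vimage) (auto intro!: continuous_intros)
  then have "strict_transform (X \<inter> ball a r) a \<subseteq> blowdown a -` X"
    unfolding strict_transform_def by (intro closure_minimal) auto
  then have NX: "fst y *\<^sub>R snd y + a \<in> X" if "y \<in> N" for y
    using that by (auto simp: N_def blowdown_def case_prod_beta)
  define S where "S = N \<inter> {0<..} \<times> sphere 0 1"
  let ?b = "\<lambda>y :: real \<times> 'a. fst y *\<^sub>R snd y + a"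
  define Q where "Q = (\<lambda>C y z. joinable X (?b y) (?b z) (C * dist (?b y) (?b z)) \<and>
    joinable X (?b y) a (C * fst y))"
  have "\<exists>e>0. \<exists>C\<ge>1. \<forall>y\<in>S. \<forall>z\<in>S. fst y < 1 / C \<longrightarrow> fst z < 1 / C \<longrightarrow>
      dist (snd y) (snd z) < e \<longrightarrow> Q C y z"
  proof (rule uniform_over_directions)
    fix C C' y z assume Q: "Q C y z" and le: "C \<le> C'" and "y \<in> S" "z \<in> S"
    then have "0 \<le> fst y" by (auto simp: S_def)
    then have "C * fst y \<le> C' * fst y" "C * dist (?b y) (?b z) \<le> C' * dist (?b y) (?b z)"
      using le by (auto intro!: mult_right_mono)
    then show "Q C' y z" using Q unfolding Q_def by (meson joinable_mono)
  next
    fix v :: 'a assume v: "v \<in> sphere 0 1"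
    show "\<exists>U C. open U \<and> (0, v) \<in> U \<and> (\<forall>y\<in>S \<inter> U. \<forall>z\<in>S \<inter> U. Q C y z)"
    proof (cases "(0, v) \<in> N")
      case True
      have "open {..<r}" "0 \<in> {..<r}" using r by auto
      then obtain U C where U: "open U" "(0, v) \<in> U" "\<And>y z. y \<in> N \<inter> U \<Longrightarrow> z \<in> N \<inter> U \<Longrightarrow>
          joinable X (?b y) (?b z) (C * dist (?b y) (?b z))"
        using joinable_near_cone_direction[OF _ _ sub True NX] by metis
      have "Q C y z" if yz: "y \<in> S \<inter> U" "z \<in> S \<inter> U" for y z
      proof -
        have y: "0 < fst y" "norm (snd y) = 1" "y \<in> N \<inter> U" "z \<in> N \<inter> U" using yz by (auto simp: S_def)
        have "joinable X (?b y) (?b (0, v)) (C * dist (?b y) (?b (0, v)))"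
          using U(2) True y by (intro U(3)) auto
        then have "joinable X (?b y) a (C * fst y)" using y by (simp add: dist_norm)
        then show ?thesis using U(3) y unfolding Q_def by blast
      qed
      then show ?thesis using U(1,2) by blast
    next
      case False
      obtain F where F: "closed F" "N = P \<inter> F" using clo unfolding closedin_closed by blast
      have "(0, v) \<in> P" using v r by (simp add: P_def)
      then have "open (- F)" "(0, v) \<in> - F" "S \<inter> - F = {}"
        using F False by (auto simp: S_def)
      then show ?thesis by (metis empty_iff)
    qed
  qed (auto simp: S_def)
  then obtain e C where e: "0 < e" and C: "1 \<le> C"
    and near: "\<And>y z. y \<in> S \<Longrightarrow> z \<in> S \<Longrightarrow> fst y < 1 / C \<Longrightarrow> fst z < 1 / C \<Longrightarrow>
      dist (snd y) (snd z) < e \<Longrightarrow> Q C y z"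
    by blast
  define \<delta> where "\<delta> = min r (1 / C)"
  have \<delta>: "0 < \<delta>" using r C by (simp add: \<delta>_def)
  define A where "A = X \<inter> ball a \<delta> - {a}"
  have lift: "(norm (y - a), sgn (y - a)) \<in> S \<and> norm (y - a) < 1 / C
      \<and> ?b (norm (y - a), sgn (y - a)) = y" if y: "y \<in> A" for y
  proof -
    have ya: "y - a \<noteq> 0" "norm (y - a) < r" "norm (y - a) < 1 / C" "y \<in> X" "y \<in> ball a r"
      using y by (auto simp: A_def \<delta>_def dist_norm norm_minus_commute)
    have b: "norm (y - a) *\<^sub>R sgn (y - a) + a = y" using ya by (simp add: sgn_div_norm)
    have "(norm (y - a), sgn (y - a)) \<in> {z \<in> blowup_space. blowdown a z \<in> X \<inter> ball a r - {a}}"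
      using ya b by (auto simp: blowup_space_def blowdown_def norm_sgn)
    then have "(norm (y - a), sgn (y - a)) \<in> strict_transform (X \<inter> ball a r) a"
      unfolding strict_transform_def by (rule subsetD[OF closure_subset])
    then show ?thesis using ya b by (simp add: S_def N_def P_def norm_sgn)
  qed
  have base: "joinable X y a (C * norm (y - a))" if y: "y \<in> A" for y
    using near[of "(norm (y - a), sgn (y - a))" "(norm (y - a), sgn (y - a))"] lift[OF y] e
    by (simp add: Q_def)
  have pair: "joinable X y z ((C + 4 * C / e) * dist y z)" if yz: "y \<in> A" "z \<in> A" for y z
  proof (rule joinable_all_directions[OF _ base _ e _ yz])
    fix y z assume yz: "y \<in> A" "z \<in> A" "dist (sgn (y - a)) (sgn (z - a)) < e"
    then have "Q C (norm (y - a), sgn (y - a)) (norm (z - a), sgn (z - a))"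
      using near lift by simp
    moreover have "?b (norm (y - a), sgn (y - a)) = y" "?b (norm (z - a), sgn (z - a)) = z"
      using lift yz by blast+
    ultimately show "joinable X y z (C * dist y z)" unfolding Q_def by (simp only:)
  qed (use C in \<open>auto simp: A_def\<close>)
  have C': "C \<le> C + 4 * C / e" using C e by simp
  have "joinable X y z ((C + 4 * C / e) * dist y z)"
    if yz: "y \<in> X \<inter> ball a \<delta>" "z \<in> X \<inter> ball a \<delta>" for y z
  proof -
    have apex: "joinable X x a ((C + 4 * C / e) * dist x a)" if "x \<in> A" for x
      using base[OF that] by (rule joinable_mono) (use C' in \<open>auto simp: dist_norm intro!: mult_right_mono\<close>)
    consider "y = a" "z = a" | "y \<in> A" "z = a" | "y = a" "z \<in> A" | "y \<in> A" "z \<in> A"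
      using yz by (auto simp: A_def)
    then show ?thesis
    proof cases
      case 1
      then show ?thesis using yz by (auto intro: joinable_refl)
    next
      case 3
      then show ?thesis using joinable_sym[OF apex[of z]] by (simp add: dist_commute)
    qed (use apex pair in auto)
  qed
  then show ?thesis using \<delta> by (intro exI[of _ "ball a \<delta>"] exI[of _ "C + 4 * C / e"]) auto
qed

text \<open>
  Away from the sphere at infinity, taking the closure adds nothing to a closed set.
\<close>

lemma closure_at_infinity_interior:
  assumes X: "closed X" and z: "z \<in> closure_at_infinity X" "0 < fst z"
  shows "(1 / fst z) *\<^sub>R snd z \<in> X" "norm (snd z) = 1"
proof -
  obtain x where x: "\<And>n. x n \<in> {z \<in> {0<..} \<times> sphere 0 1. infinity_chart z \<in> X}" "x \<longlonglongrightarrow> z"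
    using z(1) unfolding closure_at_infinity_def closure_sequential by blast
  have "(\<lambda>n. (1 / fst (x n)) *\<^sub>R snd (x n)) \<longlonglongrightarrow> (1 / fst z) *\<^sub>R snd z"
    using z(2) by (intro tendsto_intros x(2)) auto
  moreover have "(1 / fst (x n)) *\<^sub>R snd (x n) \<in> X" for n
    using x(1)[of n] by (auto simp: infinity_chart_def case_prod_beta)
  ultimately show "(1 / fst z) *\<^sub>R snd z \<in> X"
    using closed_sequentially[OF X, of "\<lambda>n. (1 / fst (x n)) *\<^sub>R snd (x n)"] by blast
  have "(\<lambda>n. norm (snd (x n))) \<longlonglongrightarrow> norm (snd z)"
    by (intro tendsto_intros x(2))
  moreover have "norm (snd (x n)) = 1" for n using x(1)[of n] by auto
  ultimately show "norm (snd z) = 1" by (simp add: LIMSEQ_const_iff)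
qed

text \<open>
  The same argument as at a conic point. The way to the base point cannot be obtained from the pairs here, since
  the boundary of the collar is not part of the space; it is carried along as a second estimate.
\<close>

lemma joinable_near_infinity:
  fixes X :: "'a::euclidean_space set"
  assumes X: "closed X" and inf: "conic_at_infinity X" "\<not> bounded X"
    and bdd: "\<And>r. \<exists>L. \<forall>x\<in>X \<inter> cball 0 r. joinable X x x0 L"
  obtains R C where "0 < R" "0 \<le> C"
    "\<And>y z. y \<in> X \<Longrightarrow> z \<in> X \<Longrightarrow> R < norm y \<Longrightarrow> R < norm z \<Longrightarrow> joinable X y z (C * dist y z)"
    "\<And>y. y \<in> X \<Longrightarrow> R < norm y \<Longrightarrow> joinable X y x0 (C * norm y)"
proof -
  let ?cl = "closure_at_infinity X"
  obtain N where N: "p_submanifold N infinity_collar" and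
    germ: "same_germ ({0} \<times> asymptotic_set X) ?cl N"
    using inf unfolding conic_at_infinity_def by blast
  obtain W where W: "open W" "{0} \<times> asymptotic_set X \<subseteq> W" "?cl \<inter> W = N \<inter> W"
    using germ unfolding same_germ_def by blast
  have N: "p_submanifold N (({0..} \<inter> UNIV) \<times> sphere 0 1)"
    using N by (simp add: infinity_collar_def)
  define S where "S = ?cl \<inter> {0<..} \<times> sphere 0 1"
  let ?b = "\<lambda>y :: real \<times> 'a. (1 / fst y) *\<^sub>R snd y"
  define Q where "Q = (\<lambda>C y z. joinable X (?b y) (?b z) (C * dist (?b y) (?b z)) \<and>
    joinable X (?b y) x0 (C * (1 / fst y)))"
  have "\<exists>e>0. \<exists>C\<ge>1. \<forall>y\<in>S. \<forall>z\<in>S. fst y < 1 / C \<longrightarrow> fst z < 1 / C \<longrightarrow>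
      dist (snd y) (snd z) < e \<longrightarrow> Q C y z"
  proof (rule uniform_over_directions)
    fix C C' y z assume Q: "Q C y z" and le: "C \<le> C'" and "y \<in> S" "z \<in> S"
    then have "0 \<le> 1 / fst y" by (auto simp: S_def)
    then have "C * (1 / fst y) \<le> C' * (1 / fst y)" "C * dist (?b y) (?b z) \<le> C' * dist (?b y) (?b z)"
      using le by (auto intro!: mult_right_mono simp del: times_divide_eq_right)
    then show "Q C' y z" using Q unfolding Q_def by (meson joinable_mono)
  next
    fix v :: 'a assume v: "v \<in> sphere 0 1"
    show "\<exists>U C. open U \<and> (0, v) \<in> U \<and> (\<forall>y\<in>S \<inter> U. \<forall>z\<in>S \<inter> U. Q C y z)"
    proof (cases "(0, v) \<in> ?cl")
      case True
      then have vW: "(0, v) \<in> W" "(0, v) \<in> N" using W(2,3) v by (auto simp: asymptotic_set_def)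
      have in_X: "?b y \<in> X" if "y \<in> N \<inter> W" "0 < fst y" for y
        using closure_at_infinity_interior(1)[OF X] that W(3) by blast
      obtain U C where U: "open U" "(0, v) \<in> U"
        and UQ: "\<And>y z. y \<in> N \<inter> U \<Longrightarrow> z \<in> N \<inter> U \<Longrightarrow> 0 < fst y \<Longrightarrow> 0 < fst z \<Longrightarrow>
          joinable X (?b y) (?b z) (C * dist (?b y) (?b z))"
          "\<And>y. y \<in> N \<inter> U \<Longrightarrow> 0 < fst y \<Longrightarrow> joinable X (?b y) x0 (C * (1 / fst y))"
        using joinable_near_end_direction[OF open_UNIV UNIV_I N vW(2) W(1) vW(1) in_X bdd] by metis
      have "Q C y z" if yz: "y \<in> S \<inter> (U \<inter> W)" "z \<in> S \<inter> (U \<inter> W)" for y z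
      proof -
        have "y \<in> N \<inter> U" "z \<in> N \<inter> U" "0 < fst y" "0 < fst z"
          using yz W(3) by (auto simp: S_def)
        then show ?thesis unfolding Q_def using UQ by blast
      qed
      then show ?thesis using U W(1) vW by (intro exI[of _ "U \<inter> W"] exI[of _ C]) auto
    next
      case False
      have "open (- ?cl)" "S \<inter> - ?cl = {}" by (auto simp: S_def closure_at_infinity_def)
      then show ?thesis using False by (metis ComplI empty_iff)
    qed
  qed (auto simp: S_def)
  then obtain e C where e: "0 < e" and C: "1 \<le> C"
    and near: "\<And>y z. y \<in> S \<Longrightarrow> z \<in> S \<Longrightarrow> fst y < 1 / C \<Longrightarrow> fst z < 1 / C \<Longrightarrow>
      dist (snd y) (snd z) < e \<Longrightarrow> Q C y z"
    by blast
  define A where "A = {y \<in> X. C < norm y}"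
  have lift: "(1 / norm y, sgn y) \<in> S \<and> 1 / norm y < 1 / C \<and> ?b (1 / norm y, sgn y) = y"
    if y: "y \<in> A" for y
  proof -
    have y': "y \<in> X" "C < norm y" "y \<noteq> 0" using y C by (auto simp: A_def)
    have b: "(1 / (1 / norm y)) *\<^sub>R sgn y = y" using y'(3) by (simp add: sgn_div_norm)
    have "(1 / norm y, sgn y) \<in> {z \<in> {0<..} \<times> sphere 0 1. infinity_chart z \<in> X}"
      using y' b by (simp add: infinity_chart_def norm_sgn)
    then have "(1 / norm y, sgn y) \<in> ?cl"
      unfolding closure_at_infinity_def by (rule subsetD[OF closure_subset])
    moreover have "1 / norm y < 1 / C" using y' C by (intro divide_strict_left_mono) auto
    ultimately show ?thesis using y' b by (simp add: S_def norm_sgn)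
  qed
  have base: "joinable X y x0 (C * norm (y - 0))" if y: "y \<in> A" for y
    using near[of "(1 / norm y, sgn y)" "(1 / norm y, sgn y)"] lift[OF y] e
    by (simp add: Q_def)
  have pair: "joinable X y z ((C + 4 * C / e) * dist y z)" if yz: "y \<in> A" "z \<in> A" for y z
  proof (rule joinable_all_directions[OF _ base _ e _ yz])
    fix y z assume yz: "y \<in> A" "z \<in> A" "dist (sgn (y - 0)) (sgn (z - 0)) < e"
    then show "joinable X y z (C * dist y z)"
      using near[of "(1 / norm y, sgn y)" "(1 / norm z, sgn z)"] lift[of y] lift[of z]
      by (simp add: Q_def)
  qed (use C in \<open>auto simp: A_def\<close>)
  have C': "C \<le> C + 4 * C / e" using C e by simp
  show thesis
  proof (rule that[of C "C + 4 * C / e"])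
    fix y assume y: "y \<in> X" "C < norm y"
    have "joinable X y x0 (C * norm (y - 0))" using base y by (simp add: A_def)
    then show "joinable X y x0 ((C + 4 * C / e) * norm y)"
      by (rule joinable_mono) (use C' in \<open>auto intro!: mult_right_mono\<close>)
  qed (use pair C e in \<open>auto simp: A_def\<close>)
qed

lemma joinable_of_connected:
  fixes X :: "'a::metric_space set"
  assumes X: "connected X" and
    loc: "\<And>x. x \<in> X \<Longrightarrow> \<exists>U. open U \<and> x \<in> U \<and> (\<forall>y\<in>X \<inter> U. \<exists>L. joinable X x y L)"
    and xy: "x \<in> X" "y \<in> X"
  shows "\<exists>L. joinable X x y L"
proof -
  define R where "R = (\<lambda>x y. \<exists>L. joinable X x y L)"
  have "R x y"
  proof (rule connected_equivalence_relation[OF X xy])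
    show "R b a" if "R a b" for a b using that joinable_sym unfolding R_def by blast
    show "R a c" if "R a b" "R b c" for a b c using that joinable_trans unfolding R_def by blast
    fix a assume "a \<in> X"
    then obtain U where U: "open U" "a \<in> U" "\<forall>y\<in>X \<inter> U. R a y" using loc unfolding R_def by blast
    show "\<exists>T. openin (top_of_set X) T \<and> a \<in> T \<and> (\<forall>x\<in>T. R a x)"
      using U \<open>a \<in> X\<close> by (intro exI[of _ "X \<inter> U"]) auto
  qed
  then show ?thesis by (simp add: R_def)
qed

section \<open>From local to global\<close>

text \<open>
  The first statement follows from connectedness and compactness. For the second one, close points
  are covered by the local estimates, and points at distance at least \<open>e\<close> by the
  first statement, as \<open>L \<le> (L / e) * dist x y\<close> for them.
\<close>

lemma joinable_on_bounded:
  fixes X :: "'a::euclidean_space set"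
  assumes X: "closed X" "connected X" and
    loc: "\<And>x. x \<in> X \<Longrightarrow> \<exists>U C. open U \<and> x \<in> U \<and> (\<forall>y\<in>X \<inter> U. \<forall>z\<in>X \<inter> U. joinable X y z (C * dist y z))"
  shows "\<exists>L. \<forall>x\<in>X \<inter> cball 0 r. \<forall>y\<in>X \<inter> cball 0 r. joinable X x y L"
    and "\<exists>C\<ge>0. \<forall>x\<in>X \<inter> cball 0 r. \<forall>y\<in>X \<inter> cball 0 r. joinable X x y (C * dist x y)"
proof -
  let ?K = "X \<inter> cball 0 r"
  have K: "compact ?K" using X(1) by (intro closed_Int_compact compact_cball)
  have link: "\<exists>L. joinable X x y L" if "x \<in> X" "y \<in> X" for x y
  proof (rule joinable_of_connected[OF X(2) _ that])
    fix x assume "x \<in> X"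
    then show "\<exists>U. open U \<and> x \<in> U \<and> (\<forall>y\<in>X \<inter> U. \<exists>L. joinable X x y L)"
      using loc by (metis IntI)
  qed
  show bounded: "\<exists>L. \<forall>x\<in>?K. \<forall>y\<in>?K. joinable X x y L"
  proof (cases "?K = {}")
    case False
    then obtain x0 where x0: "x0 \<in> X" by blast
    have "\<exists>U L. open U \<and> x \<in> U \<and> (\<forall>y\<in>X \<inter> U. joinable X y x0 L)" if x: "x \<in> ?K" for x
    proof -
      obtain U C where U: "open U" "x \<in> U" "\<And>y z. y \<in> X \<inter> U \<Longrightarrow> z \<in> X \<inter> U \<Longrightarrow> joinable X y z (C * dist y z)"
        using loc[of x] x by blast
      obtain L where L: "joinable X x x0 L" using link x x0 by blast
      have "joinable X y x0 (\<bar>C\<bar> + L)" if y: "y \<in> X \<inter> (U \<inter> ball x 1)" for y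
      proof -
        have "C * dist y x \<le> \<bar>C\<bar> * 1"
          using y by (intro mult_mono) (auto simp: dist_commute)
        then have "joinable X y x \<bar>C\<bar>" using U(2,3) x y by (intro joinable_mono[OF U(3)]) auto
        then show ?thesis using L joinable_trans by blast
      qed
      then show ?thesis
        using U(1,2) by (intro exI[of _ "U \<inter> ball x 1"] exI[of _ "\<bar>C\<bar> + L"]) auto
    qed
    then obtain U L where U: "\<And>x. x \<in> ?K \<Longrightarrow> open (U x) \<and> x \<in> U x \<and> (\<forall>y\<in>X \<inter> U x. joinable X y x0 (L x))"
      by metis
    obtain F where F: "F \<subseteq> ?K" "finite F" "?K \<subseteq> (\<Union>x\<in>F. U x)"
      using compactE_image[OF K, of ?K U] U by (metis UN_I subsetI)
    have "joinable X y x0 (Max (L ` F))" if "y \<in> ?K" for y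
    proof -
      obtain x where x: "x \<in> F" "y \<in> U x" using F(3) \<open>y \<in> ?K\<close> by blast
      then have "joinable X y x0 (L x)" using U F(1) \<open>y \<in> ?K\<close> by blast
      moreover have "L x \<le> Max (L ` F)" using x F(2) by simp
      ultimately show ?thesis by (rule joinable_mono)
    qed
    then have "joinable X x y (Max (L ` F) + Max (L ` F))" if "x \<in> ?K" "y \<in> ?K" for x y
      using that joinable_trans joinable_sym by blast
    then show ?thesis by blast
  qed auto
  then obtain L where L: "\<And>x y. x \<in> ?K \<Longrightarrow> y \<in> ?K \<Longrightarrow> joinable X x y L" by blast
  have "\<exists>e>0. \<exists>C. \<forall>x\<in>?K. \<forall>y\<in>?K. dist x y < e \<longrightarrow> joinable X x y (C * dist x y)"
  proof (rule uniform_constant_on_compact[OF K])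
    fix C C' x y assume "joinable X x y (C * dist x y)" "C \<le> C'"
    then show "joinable X x y (C' * dist x y)"
      by (elim joinable_mono) (auto intro: mult_right_mono)
  next
    fix x assume "x \<in> ?K"
    then show "\<exists>U C. open U \<and> x \<in> U \<and> (\<forall>y\<in>?K \<inter> U. \<forall>z\<in>?K \<inter> U. joinable X y z (C * dist y z))"
      using loc[of x] by (metis (no_types, lifting) Int_iff)
  qed
  then obtain e C where e: "0 < e"
    "\<And>x y. x \<in> ?K \<Longrightarrow> y \<in> ?K \<Longrightarrow> dist x y < e \<Longrightarrow> joinable X x y (C * dist x y)"
    by blast
  have "joinable X x y (max \<bar>C\<bar> (\<bar>L\<bar> / e) * dist x y)" if xy: "x \<in> ?K" "y \<in> ?K" for x y
  proof (cases "dist x y < e")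
    case True
    show ?thesis
      by (rule joinable_mono[OF e(2)[OF xy True]]) (auto intro!: mult_right_mono)
  next
    case False
    have "L \<le> \<bar>L\<bar> / e * e" using e(1) by simp
    also have "\<dots> \<le> max \<bar>C\<bar> (\<bar>L\<bar> / e) * dist x y" using False e(1) by (intro mult_mono) auto
    finally show ?thesis using L[OF xy] joinable_mono by blast
  qed
  then show "\<exists>C\<ge>0. \<forall>x\<in>?K. \<forall>y\<in>?K. joinable X x y (C * dist x y)"
    by (intro exI[of _ "max \<bar>C\<bar> (\<bar>L\<bar> / e)"]) auto
qed

text \<open>
  For unbounded \<open>X\<close>, two points lie both in the ball of radius \<open>2 R\<close>, or both outside the ball of radius \<open>R\<close>,
  or else one has norm at most \<open>R\<close> and the other one norm larger than \<open>2 R\<close>; in the last case their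
  distance is comparable with the larger norm, and they are joined through \<open>x0\<close>.
\<close>

theorem theorem4p13:
  fixes X :: "(real ^ 'n) set"
  assumes "conic_singular_submanifold X" and "connected X"
  shows "LNE X"
proof -
  have X: "closed X" and conic: "\<And>a. a \<in> singular_points X \<Longrightarrow> conic_point X a"
    and inf: "conic_at_infinity X"
    using assms(1) unfolding conic_singular_submanifold_def by auto
  have loc: "\<exists>U C. open U \<and> x \<in> U \<and> (\<forall>y\<in>X \<inter> U. \<forall>z\<in>X \<inter> U. joinable X y z (C * dist y z))"
    if x: "x \<in> X" for x
  proof (cases "x \<in> singular_points X")
    case True
    then show ?thesis using joinable_near_conic_point[OF X conic] by blast
  next
    case False
    then obtain N where "submanifold N" "same_germ {x} X N"
      using x unfolding singular_points_def by blast
    then show ?thesis using joinable_near_smooth_point x by blast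
  qed
  note on_bounded = joinable_on_bounded[OF X assms(2) loc]
  have "\<exists>C\<ge>0. \<forall>x\<in>X. \<forall>y\<in>X. joinable X x y (C * dist x y)"
  proof (cases "bounded X")
    case True
    then obtain r where "\<forall>x\<in>X. norm x \<le> r" unfolding bounded_iff by blast
    then have "X \<inter> cball 0 r = X" by auto
    then show ?thesis using on_bounded(2)[of r] by simp
  next
    case False
    then obtain x0 where x0: "x0 \<in> X" by (metis bounded_empty equals0I)
    have bdd: "\<exists>L. \<forall>x\<in>X \<inter> cball 0 r. joinable X x x0 L" for r
    proof -
      obtain L where L: "\<forall>x\<in>X \<inter> cball 0 (max r (norm x0)).
          \<forall>y\<in>X \<inter> cball 0 (max r (norm x0)). joinable X x y L"
        using on_bounded(1)[of "max r (norm x0)"] by blast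
      then have "joinable X x x0 L" if "x \<in> X \<inter> cball 0 r" for x
        using that x0 by auto
      then show ?thesis by blast
    qed
    obtain R C where R: "0 < R" "0 \<le> C"
      and far: "\<And>y z. y \<in> X \<Longrightarrow> z \<in> X \<Longrightarrow> R < norm y \<Longrightarrow> R < norm z \<Longrightarrow> joinable X y z (C * dist y z)"
        "\<And>y. y \<in> X \<Longrightarrow> R < norm y \<Longrightarrow> joinable X y x0 (C * norm y)"
      using joinable_near_infinity[OF X inf False bdd] by metis
    obtain L where L: "\<And>x. x \<in> X \<Longrightarrow> norm x \<le> R \<Longrightarrow> joinable X x x0 L"
    proof -
      obtain L where "\<forall>x\<in>X \<inter> cball 0 R. joinable X x x0 L" using bdd by blast
      then show thesis by (intro that[of L]) auto
    qed
    obtain B where B: "0 \<le> B" "\<And>x y. x \<in> X \<inter> cball 0 (2 * R) \<Longrightarrow> y \<in> X \<inter> cball 0 (2 * R) \<Longrightarrow>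
        joinable X x y (B * dist x y)"
      using on_bounded(2)[of "2 * R"] by blast
    define M where "M = B + 2 * C + \<bar>L\<bar> / R"
    have mixed: "joinable X x y (M * dist x y)"
      if x: "x \<in> X" "norm x \<le> R" and y: "y \<in> X" "2 * R < norm y" for x y
    proof -
      have "norm y \<le> norm x + dist x y" using norm_triangle_sub[of y x] by (simp add: dist_norm norm_minus_commute)
      then have d: "norm y \<le> 2 * dist x y" "R \<le> dist x y" using x y by linarith+
      have "joinable X x y (L + C * norm y)"
        using joinable_trans[OF L[OF x] joinable_sym[OF far(2)[OF y(1)]]] y(2) R(1) by simp
      moreover have "L + C * norm y \<le> M * dist x y"
      proof -
        have "\<bar>L\<bar> / R * R \<le> \<bar>L\<bar> / R * dist x y" using d R by (intro mult_left_mono) auto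
        moreover have "C * norm y \<le> C * (2 * dist x y)" using d R by (intro mult_left_mono)
        moreover have "0 \<le> B * dist x y" using B by simp
        ultimately show ?thesis using R(1) unfolding M_def distrib_right by simp
      qed
      ultimately show ?thesis by (rule joinable_mono)
    qed
    have M: "B \<le> M" "C \<le> M" "0 \<le> M" using B R by (auto simp: M_def)
    have "joinable X x y (M * dist x y)" if xy: "x \<in> X" "y \<in> X" for x y
    proof -
      consider "norm x \<le> 2 * R" "norm y \<le> 2 * R" | "R < norm x" "R < norm y"
        | "norm x \<le> R" "2 * R < norm y" | "norm y \<le> R" "2 * R < norm x"
        using R(1) by linarith
      then show ?thesis
      proof cases
        case 1
        then have "joinable X x y (B * dist x y)" using xy by (intro B(2)) auto
        then show ?thesis by (rule joinable_mono) (use M in \<open>auto intro: mult_right_mono\<close>)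
      next
        case 2
        then have "joinable X x y (C * dist x y)" using xy far(1) by blast
        then show ?thesis by (rule joinable_mono) (use M in \<open>auto intro: mult_right_mono\<close>)
      next
        case 3
        then show ?thesis using mixed xy by blast
      next
        case 4
        then show ?thesis using joinable_sym[OF mixed[of y x]] xy by (simp add: dist_commute)
      qed
    qed
    then show ?thesis using M by blast
  qed
  then obtain C where C: "0 \<le> C" "\<And>x y. x \<in> X \<Longrightarrow> y \<in> X \<Longrightarrow> joinable X x y (C * dist x y)"
    by blast
  have "inner_dist X x y \<le> ereal ((C + 1) * dist x y)" if "x \<in> X" "y \<in> X" for x y
  proof (rule inner_dist_le_joinable[OF joinable_mono[OF C(2)[OF that]]])
    show "C * dist x y \<le> (C + 1) * dist x y" by (intro mult_right_mono) auto
  qed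
  then show ?thesis unfolding LNE_def using C(1) by (intro exI[of _ "C + 1"]) auto
qed

end
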